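(* Let $T_f$ be a class $P$-homeomorphism of the circle with lift $f$ satisfying the following conditions: (a) the rotation number $\rho=\rho_f$ of $T_f$ is irrational; (b) $T_f$ has two break points $a_b, c_b$, and the product of the jump ratios of $Df$ at the break points is nontrivial, i.e. $\sigma_f(a_b)\cdot\sigma_f(c_b)\neq 1$; (c) $Df$ is absolutely continuous on every connected interval of $S^1\setminus\{a_b,c_b\}$ and the second derivative $D^2f$ belongs to $L^1$. Then the (unique) $T_f$-invariant probability measure $\mu_f$ is singular with respect to Lebesgue measure on $S^1$.
   Context: $S^1=\mathbb{R}/\mathbb{Z}$ is identified with $[0,1)$. An orientation preserving circle homeomorphism $T_f$ has a lift $f:\mathbb{R}\to\mathbb{R}$, continuous, strictly increasing, with $f(x+1)=f(x)+1$, and $T_f x=f(x) \bmod 1$. Its rotation number is $\rho_f=\lim_{n\to\infty} f^n(x)/n \bmod 1$ ($f^n$ the $n$-th iterate; the limit is independent of $x$). If $\rho_f$ is irrational, $T_f$ has a unique invariant probability measure $\mu_f$. Class $P$-homeomorphism: an orientation preserving circle homeomorphism $T_f$ which is differentiable away from countably many points, called break points (set $BP(f)$), at which the left and right derivatives $Df_-$, $Df_+$ exist, such that (i) there are constants $0<c_1<c_2<\infty$ with $c_1<Df(x)<c_2$ for all $x\in S^1\setminus BP(f)$, and $c_1<Df_-(x_b)<c_2$, $c_1<Df_+(x_b)<c_2$ for all $x_b\in BP(f)$; (ii) $\log Df$ has bounded variation. "$T_f$ has two break points $a_b,c_b$" means $BP(f)=\{a_b,c_b\}$, $a_b\ne c_b$.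 The jump ratio at a break point $x_b$ is $\sigma_f(x_b)=Df_-(x_b)/Df_+(x_b)$. Singular means there is a measurable $A\subset S^1$ with $\mu_f(A)=1$ and Lebesgue measure $0$. *)

theory Defs
  imports "HOL-Analysis.Analysis" "HOL-Probability.Probability"
begin

text \<open>
  The circle is represented by the interval [0,1). A circle homeomorphism is given by a lift
  f on the real line; since f(x + 1) = f(x) + 1, derivatives of the circle map at a point of
  [0,1) are those of f at that real number, also at the point 0.
\<close>

definition circle_lift :: "(real \<Rightarrow> real) \<Rightarrow> bool" where
  "circle_lift f \<longleftrightarrow>
     continuous_on UNIV f \<and> strict_mono f \<and> (\<forall>x. f (x + 1) = f x + 1)"

definition circle_map :: "(real \<Rightarrow> real) \<Rightarrow> real \<Rightarrow> real" where
  "circle_map f x = frac (f x)"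

text \<open>For a lift the limit does not depend on the starting point, here 0.\<close>

definition rotation_number :: "(real \<Rightarrow> real) \<Rightarrow> real" where
  "rotation_number f = frac (lim (\<lambda>n. (f ^^ n) 0 / real n))"

definition break_points :: "(real \<Rightarrow> real) \<Rightarrow> real set" where
  "break_points f = {x \<in> {0..<1}. \<not> f differentiable (at x)}"

definition left_deriv :: "(real \<Rightarrow> real) \<Rightarrow> real \<Rightarrow> real" where
  "left_deriv f x = vector_derivative f (at_left x)"

definition right_deriv :: "(real \<Rightarrow> real) \<Rightarrow> real \<Rightarrow> real" where
  "right_deriv f x = vector_derivative f (at_right x)"

definition jump_ratio :: "(real \<Rightarrow> real) \<Rightarrow> real \<Rightarrow> real" where
  "jump_ratio f x = left_deriv f x / right_deriv f x"

text \<open>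
  The set S need not be an interval: the derivative of a class P homeomorphism is only defined
  off the break points, which may be dense, so partition points are taken from S, while the
  intervals between them need not be contained in S.
\<close>

definition bounded_variation_on :: "real set \<Rightarrow> (real \<Rightarrow> real) \<Rightarrow> bool" where
  "bounded_variation_on S g \<longleftrightarrow>
     (\<exists>M. \<forall>(n::nat) (x::nat \<Rightarrow> real).
        (\<forall>i\<le>n. x i \<in> S) \<and> (\<forall>i<n. x i \<le> x (Suc i)) \<longrightarrow>
        (\<Sum>i<n. \<bar>g (x (Suc i)) - g (x i)\<bar>) \<le> M)"

definition absolutely_continuous_on :: "real set \<Rightarrow> (real \<Rightarrow> real) \<Rightarrow> bool" where
  "absolutely_continuous_on I g \<longleftrightarrow>
     (\<forall>\<epsilon>>0. \<exists>\<delta>>0. \<forall>(n::nat) (a::nat \<Rightarrow> real) (b::nat \<Rightarrow> real).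
        (\<forall>i<n. a i \<le> b i \<and> {a i..b i} \<subseteq> I) \<and>
        (\<forall>i<n. \<forall>j<n. i \<noteq> j \<longrightarrow> {a i<..<b i} \<inter> {a j<..<b j} = {}) \<and>
        (\<Sum>i<n. b i - a i) < \<delta> \<longrightarrow>
        (\<Sum>i<n. \<bar>g (b i) - g (a i)\<bar>) < \<epsilon>)"

text \<open>
  Variation over [0,1) and variation over the circle differ by the single increment across 0,
  so one is finite if and only if the other is.
\<close>

definition class_P :: "(real \<Rightarrow> real) \<Rightarrow> bool" where
  "class_P f \<longleftrightarrow>
     circle_lift f \<and>
     countable (break_points f) \<and>
     (\<forall>x\<in>break_points f. f differentiable (at_left x) \<and> f differentiable (at_right x)) \<and>
     (\<exists>c1 c2. 0 < c1 \<and> c1 < c2 \<and>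
        (\<forall>x\<in>{0..<1} - break_points f. c1 < deriv f x \<and> deriv f x < c2) \<and>
        (\<forall>x\<in>break_points f. c1 < left_deriv f x \<and> left_deriv f x < c2 \<and>
                             c1 < right_deriv f x \<and> right_deriv f x < c2)) \<and>
     bounded_variation_on ({0..<1} - break_points f) (\<lambda>x. ln (deriv f x))"

definition invariant_prob :: "(real \<Rightarrow> real) \<Rightarrow> real measure \<Rightarrow> bool" where
  "invariant_prob f \<mu> \<longleftrightarrow>
     prob_space \<mu> \<and> sets \<mu> = sets (restrict_space borel {0..<1}) \<and>
     (\<forall>A\<in>sets \<mu>. emeasure \<mu> (circle_map f -` A \<inter> space \<mu>) = emeasure \<mu> A)"

definition singular_on_circle :: "real measure \<Rightarrow> bool" where
  "singular_on_circle \<mu> \<longleftrightarrow>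
     (\<exists>A\<in>sets \<mu>. emeasure \<mu> A = 1 \<and> emeasure lborel A = 0)"

end

theory Submission
  imports Defs "HOL-Analysis.Kronecker_Approximation_Theorem"
begin

text \<open>
  Let \<open>h\<close> semiconjugate \<open>f\<close> to the rotation by \<open>\<alpha>\<close>, and let \<open>q\<close> run through denominators with
  \<open>\<bar>\<alpha> - p/q\<bar> < 1/q\<^sup>2\<close>. For such \<open>q\<close> the first \<open>q\<close> points of an orbit shadow a grid of mesh \<open>1/q\<close>,
  which gives a Denjoy-Koksma inequality for functions of bounded variation. It yields unique
  ergodicity, bounded distortion of \<open>f\<^sup>i\<close>, \<open>i < q\<close>, on intervals of \<open>h\<close>-length \<open>O(1/q)\<close>, and
  ergodicity of Lebesgue measure.

  If the invariant measure were not singular, Lebesgue measure would therefore be absolutely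
  continuous with respect to it, \<open>h\<close> would be a homeomorphism, and Lebesgue measure would become
  \<open>G dy\<close> with \<open>G > 0\<close> in the coordinate \<open>y = h x\<close>. Write \<open>g\<close> for the inverse of \<open>h\<close> and
  \<open>\<Phi> y = log Df\<^sup>q (g y)\<close>. From \<open>exp (\<Phi> y) G y = G (y + q \<alpha> - p)\<close> and the continuity of
  translations in \<open>L\<^sup>1\<close> it follows that \<open>\<Phi> \<rightarrow> 0\<close> in measure as \<open>q \<rightarrow> \<infinity>\<close>.
  On the other hand \<open>log Df\<close> is absolutely continuous off the break points with a density of
  integral \<open>K = log (\<sigma>(a) \<sigma>(c)) \<noteq> 0\<close>, so by equidistribution \<open>\<Phi> (y + t) - \<Phi> y = q t K + o(1)\<close>,
  uniformly in \<open>0 \<le> t \<le> 1/q\<close>, as long as none of the \<open>2 q\<close> break points of \<open>f\<^sup>q\<close> is crossed. With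
  \<open>t = 1/(8 q)\<close> this holds for a set of \<open>y\<close> of measure at least \<open>3/4\<close>, a contradiction.
\<close>

section \<open>A Denjoy-Koksma inequality\<close>

text \<open>The obstacle is that h may have plateaus for most of the argument: equal h-values say
  nothing about the order of points. Estimates therefore use strict inequalities between h-values or
  a right inverse of h, and h becomes injective only once Lebesgue measure is known to be absolutely
  continuous with respect to the invariant one. One notion, \<open>equivariant V\<close>, covers
  lifts, semiconjugacies and their sections (V = 1) as well as distribution and variation functions
  of mass V per period, so that a single Koksma estimate with error 5 V serves counting, distortion
  and integrals. This bounded error is either divided by q or beaten by the main term 6 V of a cell
  of h-length 6/q. The number K is the growth of the continuous part of log Df over one turn; by
  periodicity it cancels the jumps, whose logarithms add up to - log (\<sigma>(a) \<sigma>(c)). Two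
  effects collide: q steps of the rotation nearly return to the starting point, which forces \<Phi>
  to be small, while \<Phi> drifts at the rate q K between break points.\<close>

definition equivariant :: "real \<Rightarrow> (real \<Rightarrow> real) \<Rightarrow> bool" where
  "equivariant V W \<longleftrightarrow> mono W \<and> (\<forall>x. W (x + 1) = W x + V)"

lemma equivariant_int:
  assumes "equivariant V W"
  shows "W (x + of_int k) = W x + of_int k * V"
proof (induction k rule: int_induct[where k = 0])
  case base
  then show ?case by simp
next
  case (step1 i)
  have "W (x + of_int i + 1) = W (x + of_int i) + V"
    using assms unfolding equivariant_def by blast
  then show ?case using step1 by (simp add: algebra_simps)
next
  case (step2 i)
  have "W (x + of_int (i - 1) + 1) = W (x + of_int (i - 1)) + V"
    using assms unfolding equivariant_def by blast
  then show ?case using step2 by (simp add: algebra_simps)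
qed

lemma equivariant_nonneg: "equivariant V W \<Longrightarrow> 0 \<le> V"
  by (smt (verit) equivariant_def monoD)

lemma equivariant_mono: "equivariant V W \<Longrightarrow> x \<le> y \<Longrightarrow> W x \<le> W y"
  by (simp add: equivariant_def monoD)

text \<open>Coprimality makes the orbit of the rotation by p/q run through every point of the grid
  of mesh 1/q modulo 1.\<close>

definition near_rational :: "real \<Rightarrow> nat \<Rightarrow> int \<Rightarrow> bool" where
  "near_rational \<alpha> q p \<longleftrightarrow> 0 < q \<and> coprime p (int q) \<and> \<bar>\<alpha> - p / q\<bar> < 1 / (real q)\<^sup>2"

lemma near_rational_exists:
  assumes "\<alpha> \<notin> \<rat>"
  obtains q p where "near_rational \<alpha> q p" "Q < q"
proof -
  have "infinite (approx_set \<alpha>)"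
    using assms rational_iff_finite_approx_set by blast
  then obtain h k where "(h, k) \<in> approx_set \<alpha>" "k > int Q"
    using infinite_approx_set[of \<alpha> "int Q"] by auto
  then have "near_rational \<alpha> (nat k) h" "Q < nat k"
    by (auto simp: approx_set_def near_rational_def of_nat_nat)
  then show ?thesis by (rule that)
qed

text \<open>Over fewer than q steps the drift is at most q * (1/q^2). The crude bound 2/q leaves
  room for the strict inequalities between h-values that \<open>koksma\<close> needs.\<close>

lemma near_rational_orbit:
  assumes "near_rational \<alpha> q p" "i < q"
  shows "\<bar>real i * \<alpha> - real i * p / q\<bar> < 2 / q"
proof -
  have "real i * \<alpha> - real i * p / q = real i * (\<alpha> - p / q)"
    by (simp add: right_diff_distrib)
  then have "\<bar>real i * \<alpha> - real i * p / q\<bar> = real i * \<bar>\<alpha> - p / q\<bar>"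
    by (simp add: abs_mult)
  also have "\<dots> \<le> real q * (1 / (real q)\<^sup>2)"
    using assms by (intro mult_mono) (auto simp: near_rational_def)
  also have "\<dots> < 2 / q"
    using assms by (simp add: power2_eq_square divide_strict_right_mono)
  finally show ?thesis .
qed

text \<open>Shifting the rational rotation by \<open>1/q\<close> permutes its orbit up to integers, so the
  orbit sum increases by exactly one period.\<close>

lemma rational_orbit_sum_shift:
  fixes X :: "real \<Rightarrow> real" and p :: int and q :: nat
  assumes X: "equivariant V X" and q: "0 < q" and pq: "coprime p (int q)"
  shows "(\<Sum>i<q. X (w + 1 / q + real i * p / q)) = (\<Sum>i<q. X (w + real i * p / q)) + V"
proof -
  obtain u v :: int where uv: "u * p + v * int q = 1"
    using bezout_int[of p "int q"] pq by auto
  \<comment> \<open>n inverts p modulo q: after n steps the rotation by p/q has moved a point by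
    1/q, up to the integer s. The Bezout coefficient is reduced modulo q because a number of steps
    cannot be negative.\<close>
  define n where "n = nat (u mod int q)"
  define s where "s = - v - p * (u div int q)"
  have "int n = u - int q * (u div int q)"
    using q by (simp add: n_def minus_mult_div_eq_mod)
  then have "p * int n = p * (u - int q * (u div int q))"
    by simp
  then have s: "p * int n = 1 + s * int q"
    using uv by (simp add: s_def algebra_simps)
  define a where "a i = X (w + real i * p / q)" for i
  have aq: "a (i + q) = a i + p * V" for i
    using equivariant_int[OF X, of "w + real i * p / q" p] q
    by (simp add: a_def field_simps)
  \<comment> \<open>Moving the window of summation by one index replaces a n by a (q + n), a gain of
    p V.\<close>
  have shift: "(\<Sum>i<q. a (i + n)) = (\<Sum>i<q. a i) + real n * p * V" for n
  proof (induction n)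
    case (Suc n)
    have "(\<Sum>i<q. a (i + Suc n)) - (\<Sum>i<q. a (i + n)) = (\<Sum>i<q. a (Suc i + n) - a (i + n))"
      by (simp add: sum_subtractf)
    also have "\<dots> = a (q + n) - a n"
      using sum_lessThan_telescope[of "\<lambda>i. a (i + n)" q] by simp
    also have "\<dots> = p * V"
      using aq[of n] by (simp add: add.commute)
    finally show ?case using Suc by (simp add: algebra_simps)
  qed simp
  have "X (w + 1 / q + real i * p / q) = a (i + n) - s * V" for i
  proof -
    have "real_of_int p * real n = 1 + real_of_int s * real q"
      using arg_cong[OF s, of real_of_int] by simp
    then have "w + real (i + n) * p / q = (w + 1 / q + real i * p / q) + of_int s"
      using q by (simp add: field_simps)
    then show ?thesis
      unfolding a_def using equivariant_int[OF X, of "w + 1 / q + real i * p / q" s] by (simp only:)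
  qed
  then have "(\<Sum>i<q. X (w + 1 / q + real i * p / q)) = (\<Sum>i<q. a (i + n) - s * V)"
    by simp
  also have "\<dots> = (\<Sum>i<q. a i) + (real n * p - real q * s) * V"
    by (simp add: sum_subtractf shift algebra_simps)
  also have "real n * p - real q * s = 1"
    using arg_cong[OF s, of real_of_int] by (simp add: algebra_simps)
  finally show ?thesis by (simp add: a_def)
qed

text \<open>Rescaled by q, the monotone function R gains exactly V over each unit interval, so it
  stays within V of a linear function.\<close>

lemma rational_orbit_sum:
  fixes X :: "real \<Rightarrow> real" and p :: int and q :: nat and R :: "real \<Rightarrow> real" and V w w' :: real
  assumes X: "equivariant V X" and q: "0 < q" and pq: "coprime p (int q)"
  defines "R \<equiv> \<lambda>w::real. \<Sum>i<q. X (w + real i * p / q)"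
  shows "\<bar>R w' - R w - q * V * (w' - w)\<bar> \<le> V"
proof -
  have step: "R (w + 1 / q) = R w + V" for w
    unfolding R_def using rational_orbit_sum_shift[OF X q pq] by simp
  have "equivariant V (\<lambda>t. R (t / q))"
    unfolding equivariant_def
  proof (intro conjI allI monoI)
    fix x y :: real assume "x \<le> y"
    then show "R (x / q) \<le> R (y / q)"
      unfolding R_def by (intro sum_mono equivariant_mono[OF X]) (simp add: divide_right_mono)
  next
    fix x show "R ((x + 1) / q) = R (x / q) + V"
      using step[of "x / q"] by (simp add: add_divide_distrib)
  qed
  note S = this
  define n where "n = \<lfloor>q * (w' - w)\<rfloor>"
  have Rn: "R (w + of_int k / q) = R w + k * V" for k
    using equivariant_int[OF S, of "q * w" k] q by (simp add: add_divide_distrib)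
  have m: "x \<le> y \<Longrightarrow> R x \<le> R y" for x y
    unfolding R_def by (intro sum_mono equivariant_mono[OF X]) simp
  have n: "n \<le> q * (w' - w)" "q * (w' - w) \<le> n + 1"
    unfolding n_def by linarith+
  then have "w + n / q \<le> w'" "w' \<le> w + of_int (n + 1) / q"
    using q by (simp_all add: field_simps)
  then have "R w + n * V \<le> R w'" "R w' \<le> R w + (n + 1) * V"
    using m Rn by (metis, metis m Rn of_int_add of_int_1)
  moreover have "n * V \<le> q * (w' - w) * V" "q * (w' - w) * V \<le> (n + 1) * V"
    using n equivariant_nonneg[OF X] by (simp_all add: mult_right_mono)
  ultimately show ?thesis
    unfolding abs_le_iff by (simp add: algebra_simps)
qed

section \<open>Semiconjugacy to a rotation and sums along orbits\<close>

definition semiconj :: "real \<Rightarrow> (real \<Rightarrow> real) \<Rightarrow> (real \<Rightarrow> real) \<Rightarrow> bool" where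
  "semiconj \<alpha> f h \<longleftrightarrow> equivariant 1 h \<and> continuous_on UNIV h \<and> (\<forall>x. h (f x) = h x + \<alpha>)"

lemma semiconj_iter: "semiconj \<alpha> f h \<Longrightarrow> h ((f ^^ n) x) = h x + n * \<alpha>"
  by (induction n) (auto simp: semiconj_def algebra_simps)

text \<open>Only the fractional part is chosen, to make the right inverse of \<open>h\<close> equivariant.\<close>

definition section_of :: "(real \<Rightarrow> real) \<Rightarrow> real \<Rightarrow> real" where
  "section_of h y = (SOME x. h x = frac y) + of_int \<lfloor>y\<rfloor>"

lemma equivariant_surj:
  assumes "equivariant 1 h" "continuous_on UNIV h"
  shows "\<exists>x. h x = y"
proof -
  define n where "n = \<lfloor>y - h 0\<rfloor>"
  have "h (of_int k) = h 0 + of_int k" for k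
    using equivariant_int[OF assms(1), of 0 k] by simp
  from this[of n] this[of "n + 1"] have "h (of_int n) \<le> y" "y \<le> h (of_int (n + 1))"
    unfolding n_def by linarith+
  then show ?thesis
    using IVT'[of h "of_int n" y "of_int (n + 1)"] assms(2) continuous_on_subset by fastforce
qed

lemma section_of:
  assumes "equivariant 1 h" "continuous_on UNIV h"
  shows "h (section_of h y) = y" "section_of h (y + 1) = section_of h y + 1"
    "x < y \<Longrightarrow> section_of h x < section_of h y" "equivariant 1 (section_of h)"
proof -
  have h: "h (section_of h y) = y" for y
    using someI_ex[OF equivariant_surj[OF assms, of "frac y"]] equivariant_int[OF assms(1)]
    by (simp add: section_of_def frac_def)
  show "h (section_of h y) = y" by fact
  show p: "section_of h (y + 1) = section_of h y + 1" for y
    by (simp add: section_of_def frac_def)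
  show s: "x < y \<Longrightarrow> section_of h x < section_of h y" for x y
    using h equivariant_mono[OF assms(1)] by (metis linorder_not_less)
  show "equivariant 1 (section_of h)"
    unfolding equivariant_def using s p by (auto intro!: monoI simp: le_less)
qed

text \<open>In the coordinate h the map is a rotation, so the orbit of z lies term by term between
  the grids started at h z - 2/q and h z + 2/q. Doing this for z and z' changes the distance of the
  starting points by up to 4/q, which costs 4 V; comparing the two grid sums by
  \<open>rational_orbit_sum\<close> costs one more V.\<close>

lemma koksma:
  assumes W: "equivariant V W" and h: "semiconj \<alpha> f h" and nr: "near_rational \<alpha> q p"
  shows "\<bar>(\<Sum>i<q. W ((f ^^ i) z')) - (\<Sum>i<q. W ((f ^^ i) z)) - q * V * (h z' - h z)\<bar> \<le> 5 * V"
proof -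
  define g where "g = section_of h"
  define X where "X = (\<lambda>w. W (g w))"
  have h': "equivariant 1 h" "continuous_on UNIV h" using h by (auto simp: semiconj_def)
  note g = section_of[OF h', folded g_def]
  have X: "equivariant V X"
    using W g(4) unfolding equivariant_def X_def by (auto simp: mono_def)
  have q: "0 < q" "coprime p (int q)" using nr by (auto simp: near_rational_def)
  define R where "R w = (\<Sum>i<q. X (w + real i * p / q))" for w
  have R: "\<bar>R w' - R w - q * V * (w' - w)\<bar> \<le> V" for w w'
    unfolding R_def by (rule rational_orbit_sum[OF X q])
  have less: "x \<le> y" if "h x < h y" for x y
    using that equivariant_mono[OF h'(1), of y x] by linarith
  have lower: "R (h z - 2 / q) \<le> (\<Sum>i<q. W ((f ^^ i) z))" for z
    unfolding R_def X_def
  proof (intro sum_mono equivariant_mono[OF W] less)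
    fix i assume "i \<in> {..<q}"
    then have "\<bar>real i * \<alpha> - real i * p / q\<bar> < 2 / q"
      using near_rational_orbit[OF nr, of i] by simp
    then show "h (g (h z - 2 / q + real i * p / q)) < h ((f ^^ i) z)"
      unfolding g(1) semiconj_iter[OF h] abs_less_iff by simp
  qed
  have upper: "(\<Sum>i<q. W ((f ^^ i) z)) \<le> R (h z + 2 / q)" for z
    unfolding R_def X_def
  proof (intro sum_mono equivariant_mono[OF W] less)
    fix i assume "i \<in> {..<q}"
    then have "\<bar>real i * \<alpha> - real i * p / q\<bar> < 2 / q"
      using near_rational_orbit[OF nr, of i] by simp
    then show "h ((f ^^ i) z) < h (g (h z + 2 / q + real i * p / q))"
      unfolding g(1) semiconj_iter[OF h] abs_less_iff by simp
  qed
  have "q * V * ((h z' + 2 / q) - (h z - 2 / q)) = q * V * (h z' - h z) + 4 * V"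
    "q * V * ((h z' - 2 / q) - (h z + 2 / q)) = q * V * (h z' - h z) - 4 * V"
    using q by (simp_all add: field_simps)
  then show ?thesis
    using R[of "h z' + 2 / q" "h z - 2 / q"] R[of "h z' - 2 / q" "h z + 2 / q"]
      lower[of z] lower[of z'] upper[of z] upper[of z'] by linarith
qed

section \<open>The invariant measure\<close>

lemma equivariant_iter:
  assumes "equivariant 1 f" shows "equivariant 1 (f ^^ n)"
proof (induction n)
  case 0 show ?case by (auto simp: equivariant_def mono_def)
next
  case (Suc n) then show ?case using assms by (auto simp: equivariant_def mono_def)
qed

lemma equivariant_displacement:
  assumes F: "equivariant 1 F" shows "\<bar>(F x - x) - (F y - y)\<bar> \<le> 1"
proof -
  define k where "k = \<lfloor>x - y\<rfloor>"
  have "y + of_int k \<le> x" "x \<le> y + of_int (k + 1)"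
    unfolding k_def by linarith+
  then have "F (y + of_int k) \<le> F x" "F x \<le> F (y + of_int (k + 1))"
    using equivariant_mono[OF F] by blast+
  then show ?thesis
    using \<open>y + of_int k \<le> x\<close> \<open>x \<le> y + of_int (k + 1)\<close>
    unfolding equivariant_int[OF F] by (simp add: abs_le_iff)
qed

lemma equivariant_iter_bound:
  assumes F: "equivariant 1 F" shows "\<bar>(F ^^ n) x - x - n * F 0\<bar> \<le> n"
proof (induction n)
  case (Suc n)
  have "\<bar>(F ((F ^^ n) x) - (F ^^ n) x) - (F 0 - 0)\<bar> \<le> 1"
    by (rule equivariant_displacement[OF F])
  then show ?case using Suc by (simp add: algebra_simps abs_le_iff)
qed simp

text \<open>The displacement of an iterate varies by at most 1 over the line, so
  \<open>(f ^^ (m * n)) 0\<close> is n times \<open>(f ^^ m) 0\<close> up to n, and also m times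
  \<open>(f ^^ n) 0\<close> up to m; comparing the two gives the Cauchy property. The bound 2 is 1
  for the starting point 0 and 1 for changing it. It is what keeps the limsup in
  \<open>semiconj_exists\<close> finite.\<close>

lemma translation_number:
  assumes f: "equivariant 1 f"
  obtains \<alpha> where "(\<lambda>n. (f ^^ n) 0 / real n) \<longlonglongrightarrow> \<alpha>" "\<And>n x. \<bar>(f ^^ n) x - x - n * \<alpha>\<bar> \<le> 2"
proof -
  define a where "a n = (f ^^ n) 0" for n
  have prod: "\<bar>a (m * n) - n * a m\<bar> \<le> n" for m n
    using equivariant_iter_bound[OF equivariant_iter[OF f, of m], of n 0]
    by (simp add: a_def funpow_mult)
  have diff: "\<bar>a m / m - a n / n\<bar> \<le> 1 / m + 1 / n" if "0 < m" "0 < n" for m n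
  proof -
    have "\<bar>n * a m - m * a n\<bar> \<le> real n + m"
      using prod[of m n] prod[of n m] by (simp add: mult.commute[of m n] abs_le_iff)
    then have "\<bar>n * a m - m * a n\<bar> / (real m * n) \<le> (real n + m) / (real m * n)"
      by (intro divide_right_mono) auto
    moreover have "a m / m - a n / n = (n * a m - m * a n) / (real m * n)"
      "1 / m + 1 / n = (real n + m) / (real m * n)"
      using that by (auto simp: field_simps)
    ultimately show ?thesis by (simp only: abs_divide) (simp add: abs_mult)
  qed
  have "Cauchy (\<lambda>n. a n / n)"
  proof (rule CauchyI)
    fix e :: real assume "0 < e"
    then obtain M :: nat where M: "0 < M" "inverse (real M) < e / 2"
      using real_arch_inverse[of "e / 2"] by auto
    show "\<exists>M. \<forall>m\<ge>M. \<forall>n\<ge>M. norm (a m / m - a n / n) < e"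
    proof (intro exI[of _ M] allI impI)
      fix m n assume mn: "M \<le> m" "M \<le> n"
      have "1 / real m \<le> inverse (real M)" "1 / real n \<le> inverse (real M)"
        using mn M by (auto simp: inverse_eq_divide intro!: divide_left_mono)
      then show "norm (a m / m - a n / n) < e"
        using diff[of m n] mn M by simp
    qed
  qed
  then obtain \<alpha> where lim: "(\<lambda>n. a n / n) \<longlonglongrightarrow> \<alpha>"
    using Cauchy_convergent convergent_def by blast
  have one: "\<bar>a m - m * \<alpha>\<bar> \<le> 1" for m
  proof (cases "m = 0")
    case True then show ?thesis by (simp add: a_def)
  next
    case False
    have "\<bar>a m / m - \<alpha>\<bar> \<le> 1 / m + 0"
    proof (rule LIMSEQ_le)
      show "(\<lambda>n. \<bar>a m / m - a n / n\<bar>) \<longlonglongrightarrow> \<bar>a m / m - \<alpha>\<bar>"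
        by (intro tendsto_intros lim)
      show "(\<lambda>n. 1 / m + 1 / real n) \<longlonglongrightarrow> 1 / m + 0"
        by (intro tendsto_intros lim_1_over_n)
      show "\<exists>N. \<forall>n\<ge>N. \<bar>a m / m - a n / n\<bar> \<le> 1 / m + 1 / real n"
        using diff False by (intro exI[of _ 1]) auto
    qed
    then have "m * \<bar>a m / m - \<alpha>\<bar> \<le> 1"
      using False by (simp add: field_simps)
    moreover have "m * \<bar>a m / m - \<alpha>\<bar> = \<bar>m * (a m / m - \<alpha>)\<bar>"
      by (simp add: abs_mult)
    ultimately show ?thesis using False by (simp add: right_diff_distrib)
  qed
  have "\<bar>(f ^^ n) x - x - n * \<alpha>\<bar> \<le> 2" for n x
    using equivariant_displacement[OF equivariant_iter[OF f, of n], of x 0] one[of n]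
    by (simp add: a_def abs_le_iff)
  with lim show ?thesis
    by (intro that) (auto simp: a_def)
qed

text \<open>A monotone function with dense range cannot jump.\<close>

lemma equivariant_continuous:
  assumes h: "equivariant 1 h" and dense: "\<And>y \<epsilon>. 0 < \<epsilon> \<Longrightarrow> \<exists>x. \<bar>h x - y\<bar> < \<epsilon>"
  shows "continuous_on UNIV h"
proof (rule continuous_at_imp_continuous_on, rule ballI)
  fix x
  have less: "u < v" if "h u < h v" for u v
    using that equivariant_mono[OF h, of v u] by linarith
  show "isCont h x"
    unfolding continuous_at_real_range
  proof (intro allI impI)
    fix e :: real assume e: "0 < e"
    obtain u where u: "\<bar>h u - (h x - e / 2)\<bar> < e / 2" using dense[of "e / 2"] e by auto
    obtain v where v: "\<bar>h v - (h x + e / 2)\<bar> < e / 2" using dense[of "e / 2"] e by auto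
    have uv: "h x - e < h u" "h u < h x" "h x < h v" "h v < h x + e"
      using u v by linarith+
    show "\<exists>d>0. \<forall>x'. norm (x' - x) < d \<longrightarrow> \<bar>h x' - h x\<bar> < e"
    proof (intro exI[of _ "min (x - u) (v - x)"] conjI allI impI)
      show "0 < min (x - u) (v - x)" using uv less by simp
      fix x' assume "norm (x' - x) < min (x - u) (v - x)"
      then have "u \<le> x'" "x' \<le> v" by (auto simp: abs_less_iff)
      then have "h u \<le> h x'" "h x' \<le> h v" using equivariant_mono[OF h] by auto
      then show "\<bar>h x' - h x\<bar> < e" using uv by (simp add: abs_less_iff)
    qed
  qed
qed

text \<open>The semiconjugacy to the rotation is \<open>limsup (f^n x - n \<alpha>)\<close>.\<close>

lemma semiconj_exists:
  assumes f: "equivariant 1 f" and bd: "\<And>n x. \<bar>(f ^^ n) x - x - n * \<alpha>\<bar> \<le> 2" and irr: "\<alpha> \<notin> \<rat>"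
  obtains h where "semiconj \<alpha> f h"
proof -
  define b where "b x n = (f ^^ n) x - n * \<alpha>" for x n
  define s where "s x N = (SUP n\<in>{N..}. b x n)" for x N
  have b: "b x n \<le> x + 2" "x - 2 \<le> b x n" for x n
    using bd[of n x] by (auto simp: b_def abs_le_iff)
  have bdd: "bdd_above (b x ` {N..})" for x N
    using b by (intro bdd_aboveI2[of _ _ "x + 2"]) auto
  have s_up: "b x n \<le> s x N" if "N \<le> n" for x n N
    unfolding s_def using that bdd by (intro cSUP_upper) auto
  have s_least: "s x N \<le> c" if "\<And>n. N \<le> n \<Longrightarrow> b x n \<le> c" for x N c
    unfolding s_def using that by (intro cSUP_least) auto
  have dec: "decseq (s x)" for x
    by (intro decseq_SucI s_least s_up) simp
  have "x - 2 \<le> s x N" for x N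
    using b(2)[of x N] s_up[of N N x] by simp
  then have conv: "\<exists>l. s x \<longlonglongrightarrow> l" for x
    using decseq_convergent[OF dec, of "x - 2" x] by metis
  define h where "h x = lim (s x)" for x
  have h: "s x \<longlonglongrightarrow> h x" for x
    using conv[of x] unfolding h_def by (metis limI)
  have bf: "b (f x) n = b x (Suc n) + \<alpha>" for x n
    by (simp add: b_def funpow_swap1 algebra_simps)
  \<comment> \<open>Applying f shifts the sequence by one index and adds \<alpha>; the limit of the
    tail suprema forgets the shift.\<close>
  have "s (f x) N = s x (Suc N) + \<alpha>" for x N
  proof (rule antisym)
    show "s (f x) N \<le> s x (Suc N) + \<alpha>"
      by (intro s_least) (simp add: bf s_up)
    have "s x (Suc N) \<le> s (f x) N - \<alpha>"
    proof (rule s_least)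
      fix n assume "Suc N \<le> n"
      then obtain m where "n = Suc m" "N \<le> m" by (cases n) auto
      then show "b x n \<le> s (f x) N - \<alpha>" using s_up[of N m "f x"] by (simp add: bf)
    qed
    then show "s x (Suc N) + \<alpha> \<le> s (f x) N" by simp
  qed
  then have "s (f x) = (\<lambda>N. s x (Suc N) + \<alpha>)" for x by auto
  moreover have "(\<lambda>N. s x (Suc N) + \<alpha>) \<longlonglongrightarrow> h x + \<alpha>" for x
    by (rule tendsto_add[OF LIMSEQ_Suc[OF h] tendsto_const])
  ultimately have hf: "h (f x) = h x + \<alpha>" for x
    by (metis LIMSEQ_unique h)
  have b1: "b (x + 1) n = b x n + 1" for x n
    using equivariant_iter[OF f, of n] by (simp add: b_def equivariant_def)
  have "s (x + 1) N = s x N + 1" for x N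
  proof (rule antisym)
    show "s (x + 1) N \<le> s x N + 1" by (intro s_least) (simp add: b1 s_up)
    have "s x N \<le> s (x + 1) N - 1"
      by (intro s_least) (use b1 s_up[of N _ "x + 1"] in \<open>simp add: le_diff_eq\<close>)
    then show "s x N + 1 \<le> s (x + 1) N" by simp
  qed
  then have "s (x + 1) = (\<lambda>N. s x N + 1)" for x by auto
  moreover have "(\<lambda>N. s x N + 1) \<longlonglongrightarrow> h x + 1" for x
    by (rule tendsto_add[OF h tendsto_const])
  ultimately have h1: "h (x + 1) = h x + 1" for x
    by (metis LIMSEQ_unique h)
  have "h x \<le> h y" if "x \<le> y" for x y
  proof (rule LIMSEQ_le[OF h h], intro exI[of _ 0] allI impI s_least)
    fix N n :: nat assume "N \<le> n"
    have "b x n \<le> b y n"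
      using equivariant_mono[OF equivariant_iter[OF f] that, of n] by (simp add: b_def)
    also have "\<dots> \<le> s y N" by (rule s_up) fact
    finally show "b x n \<le> s y N" .
  qed
  then have eq: "equivariant 1 h"
    by (auto simp: equivariant_def h1 intro: monoI)
  have "continuous_on UNIV h"
  proof (rule equivariant_continuous[OF eq])
    fix y \<epsilon> :: real assume "0 < \<epsilon>"
    \<comment> \<open>The h-values of the integer translates of the orbit of 0 are h 0 + k \<alpha>
      - j; irrationality of \<alpha> makes them dense.\<close>
    then obtain j k where jk: "k > 0" "\<bar>of_int k * \<alpha> - of_int j - (y - h 0)\<bar> < \<epsilon>"
      using sequence_of_fractional_parts_is_dense[OF irr, of \<epsilon> "y - h 0"] by metis
    have "h ((f ^^ n) x) = h x + n * \<alpha>" for n x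
      by (induction n) (auto simp: hf algebra_simps)
    then have "h ((f ^^ nat k) 0 + of_int (- j)) = h 0 + of_int k * \<alpha> - of_int j"
      using equivariant_int[OF eq, of "(f ^^ nat k) 0" "- j"] jk(1) by simp
    then show "\<exists>x. \<bar>h x - y\<bar> < \<epsilon>"
      using jk(2) by (metis add.commute diff_add_eq diff_diff_eq2 diff_diff_eq add_diff_eq)
  qed
  with eq hf show ?thesis
    by (intro that) (auto simp: semiconj_def)
qed

section \<open>Uniqueness of the invariant measure\<close>

lemma circle_lift_equivariant: "circle_lift f \<Longrightarrow> equivariant 1 f"
  by (simp add: circle_lift_def equivariant_def strict_mono_mono)

lemma circle_map_frac:
  assumes "equivariant 1 f" shows "circle_map f (frac x) = frac (f x)"
proof -
  have "f (frac x) = f x - of_int \<lfloor>x\<rfloor>"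
    using equivariant_int[OF assms, of x "- \<lfloor>x\<rfloor>"] by (simp add: frac_def)
  then show ?thesis by (simp add: circle_map_def frac_def)
qed

lemma circle_map_iter:
  assumes "equivariant 1 f" "z \<in> {0..<1}" shows "(circle_map f ^^ i) z = frac ((f ^^ i) z)"
  using assms by (induction i) (auto simp: circle_map_frac frac_eq)

text \<open>Writes the indicator of an arc as a difference of two monotone functions of mass 1,
  which opens visit counts to \<open>koksma\<close>.\<close>

lemma frac_gt_indicator:
  assumes "0 \<le> x" "x < (1::real)"
  shows "indicat_real {x<..} (frac y) = of_int \<lceil>y - x\<rceil> - of_int \<lfloor>y\<rfloor>"
proof -
  have "y - x = (frac y - x) + of_int \<lfloor>y\<rfloor>" by (simp add: frac_def)
  then have "\<lceil>y - x\<rceil> = \<lceil>frac y - x\<rceil> + \<lfloor>y\<rfloor>"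
    by (metis ceiling_add_of_int)
  moreover have "\<lceil>t - x\<rceil> = (if x < t then 1 else 0)" if "0 \<le> t" "t < 1" for t
    using that assms by (auto simp: ceiling_eq_iff)
  from this[of "frac y"] have "\<lceil>frac y - x\<rceil> = (if x < frac y then 1 else 0)"
    by (simp add: frac_lt_1)
  ultimately show ?thesis by (simp add: indicator_def)
qed

lemma invariant_prob_iter:
  assumes "invariant_prob f \<mu>" "A \<in> sets \<mu>" and meas: "circle_map f \<in> measurable \<mu> \<mu>"
  shows "emeasure \<mu> ((circle_map f ^^ i) -` A \<inter> space \<mu>) = emeasure \<mu> A"
proof -
  have step: "emeasure \<mu> (circle_map f -` B \<inter> space \<mu>) = emeasure \<mu> B" if "B \<in> sets \<mu>" for B
    using assms that unfolding invariant_prob_def by blast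
  have m: "(circle_map f ^^ i) \<in> measurable \<mu> \<mu>" for i
    by (induction i) (auto intro: measurable_compose[OF _ meas])
  show ?thesis
  proof (induction i)
    case 0 then show ?case using sets.sets_into_space[OF assms(2)] by (simp add: Int_absorb2)
  next
    case (Suc i)
    have e: "(circle_map f ^^ Suc i) -` A \<inter> space \<mu> =
      circle_map f -` ((circle_map f ^^ i) -` A \<inter> space \<mu>) \<inter> space \<mu>"
      using measurable_space[OF meas] by (auto simp: funpow_swap1)
    show ?case
      unfolding e step[OF measurable_sets[OF m assms(2)]] by (rule Suc)
  qed
qed

lemma measurable_frac [measurable]: "frac \<in> borel_measurable (borel :: real measure)"
  unfolding frac_def[abs_def] by measurable

lemma circle_map_measurable:
  assumes "continuous_on UNIV f" "sets \<mu> = sets (restrict_space borel {0..<1::real})"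
  shows "circle_map f \<in> measurable \<mu> \<mu>"
proof -
  have [measurable]: "f \<in> borel_measurable borel"
    using assms(1) by (simp add: borel_measurable_continuous_onI)
  have "circle_map f \<in> measurable (restrict_space borel {0..<1}) (restrict_space borel {0..<1})"
    unfolding circle_map_def
    by (intro measurable_restrict_space2 measurable_restrict_space1) (auto simp: frac_lt_1)
  then show ?thesis using assms(2) measurable_cong_sets by blast
qed

text \<open>By the Denjoy-Koksma inequality, the number of visits of an orbit to an interval during
  \<open>q\<close> steps depends on the starting point only up to a bounded error.\<close>

lemma invariant_prob_unique:
  assumes f: "circle_lift f" and h: "semiconj \<alpha> f h" and irr: "\<alpha> \<notin> \<rat>"
    and \<mu>: "invariant_prob f \<mu>" and \<nu>: "invariant_prob f \<nu>"
  shows "\<mu> = \<nu>"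
proof -
  have eqf: "equivariant 1 f" using f by (rule circle_lift_equivariant)
  \<comment> \<open>M counts the visits of the orbit of 0 and is the same for all measures, while
    integrating the count from z against an invariant measure gives q times the measure of the
    interval. The error 10 is 5 for the ceiling and 5 for the floor; their linear terms
    cancel.\<close>
  have mean: "\<exists>M. \<forall>\<mu>. invariant_prob f \<mu> \<longrightarrow> \<bar>q * measure \<mu> ({x<..} \<inter> {0..<1}) - M\<bar> \<le> 10"
    if nr: "near_rational \<alpha> q p" and x: "0 \<le> x" "x < 1" for q p x
  proof (intro exI[of _ "\<Sum>i<q. indicat_real {x<..} (frac ((f ^^ i) 0))"] allI impI)
    fix \<mu> assume \<mu>: "invariant_prob f \<mu>"
    interpret prob_space \<mu> using \<mu> by (simp add: invariant_prob_def)
    have sets: "sets \<mu> = sets (restrict_space borel {0..<1})"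
      using \<mu> by (simp add: invariant_prob_def)
    have space: "space \<mu> = {0..<1}"
      using sets_eq_imp_space_eq[OF sets] by (simp add: space_restrict_space)
    have meas: "circle_map f \<in> measurable \<mu> \<mu>"
      using f sets by (intro circle_map_measurable) (auto simp: circle_lift_def)
    define A where "A = {x<..} \<inter> {0..<1::real}"
    have A: "A \<in> sets \<mu>" unfolding sets A_def by (auto simp: sets_restrict_space_iff)
    have mA: "measure \<mu> ((circle_map f ^^ i) -` A \<inter> space \<mu>) = measure \<mu> A" for i
      using invariant_prob_iter[OF \<mu> A meas] by (simp add: measure_def)
    have setsA: "(circle_map f ^^ i) -` A \<inter> space \<mu> \<in> sets \<mu>" for i
    proof -
      have "(circle_map f ^^ i) \<in> measurable \<mu> \<mu>"
        by (induction i) (auto intro: measurable_compose[OF _ meas])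
      then show ?thesis using A by (rule measurable_sets)
    qed
    define S where "S z = (\<Sum>i<q. indicat_real {x<..} (frac ((f ^^ i) z)))" for z
    define I where "I i = indicat_real ((circle_map f ^^ i) -` A \<inter> space \<mu>)" for i
    have int: "integrable \<mu> (I i)" "integral\<^sup>L \<mu> (I i) = measure \<mu> A" for i
      unfolding I_def using setsA[of i] mA[of i] by (auto simp: emeasure_eq_measure)
    have S: "S z = (\<Sum>i<q. I i z)" if "z \<in> space \<mu>" for z
      unfolding S_def I_def using that circle_map_iter[OF eqf, of z]
      by (intro sum.cong) (auto simp: indicator_def A_def space frac_lt_1)
    have W: "equivariant 1 (\<lambda>y. of_int \<lceil>y - x\<rceil>)" "equivariant 1 (\<lambda>y. of_int \<lfloor>y\<rfloor>)"
      by (auto simp: equivariant_def mono_def ceiling_mono floor_mono diff_add_eq[symmetric])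
    have "\<bar>S z - S 0\<bar> \<le> 10" for z
      unfolding S_def frac_gt_indicator[OF x] sum_subtractf
      using koksma[OF W(1) h nr, of z 0] koksma[OF W(2) h nr, of z 0] by simp
    then have bd: "(\<Sum>i<q. I i z) \<le> S 0 + 10" "S 0 - 10 \<le> (\<Sum>i<q. I i z)" if "z \<in> space \<mu>" for z
      using S[OF that] by (smt (verit))+
    have "integrable \<mu> (\<lambda>z. \<Sum>i<q. I i z)" using int by auto
    moreover have "integral\<^sup>L \<mu> (\<lambda>z. \<Sum>i<q. I i z) = q * measure \<mu> A"
      using int by (simp add: Bochner_Integration.integral_sum)
    ultimately have "q * measure \<mu> A \<le> S 0 + 10" "S 0 - 10 \<le> q * measure \<mu> A"
      using integral_le_const[of "\<lambda>z. \<Sum>i<q. I i z" "S 0 + 10"]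
        integral_ge_const[of "\<lambda>z. \<Sum>i<q. I i z" "S 0 - 10"] bd by auto
    then show "\<bar>q * measure \<mu> ({x<..} \<inter> {0..<1}) -
        (\<Sum>i<q. indicat_real {x<..} (frac ((f ^^ i) 0)))\<bar> \<le> 10"
      by (simp add: A_def S_def abs_le_iff)
  qed
  have eq: "measure \<mu> ({x<..} \<inter> {0..<1}) = measure \<nu> ({x<..} \<inter> {0..<1})" if x: "0 \<le> x" "x < 1" for x
  proof (rule ccontr)
    define d where "d = \<bar>measure \<mu> ({x<..} \<inter> {0..<1}) - measure \<nu> ({x<..} \<inter> {0..<1})\<bar>"
    assume "\<not> ?thesis"
    then have d: "0 < d" by (simp add: d_def)
    obtain Q :: nat where Q: "20 / d < Q" using reals_Archimedean2 by blast
    obtain q p where q: "near_rational \<alpha> q p" "Q < q" using near_rational_exists[OF irr] .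
    obtain M where M: "\<And>\<mu>. invariant_prob f \<mu> \<Longrightarrow> \<bar>q * measure \<mu> ({x<..} \<inter> {0..<1}) - M\<bar> \<le> 10"
      using mean[OF q(1) x] by auto
    have "q * d = \<bar>q * measure \<mu> ({x<..} \<inter> {0..<1}) - q * measure \<nu> ({x<..} \<inter> {0..<1})\<bar>"
      unfolding d_def by (simp add: abs_mult flip: right_diff_distrib)
    then have "q * d \<le> 20" using M[OF \<mu>] M[OF \<nu>] by linarith
    moreover have "20 < q * d"
      using Q q(2) d by (smt (verit) divide_less_eq mult.commute of_nat_less_iff mult_strict_right_mono)
    ultimately show False by simp
  qed
  have sets: "sets \<mu> = sets (restrict_space borel {0..<1})" "sets \<nu> = sets (restrict_space borel {0..<1})"
    using \<mu> \<nu> by (auto simp: invariant_prob_def)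
  have space: "space \<mu> = {0..<1}" "space \<nu> = {0..<1}"
    using sets[THEN sets_eq_imp_space_eq] by (simp_all add: space_restrict_space)
  have prob: "prob_space \<mu>" "prob_space \<nu>" using \<mu> \<nu> by (auto simp: invariant_prob_def)
  have id: "(\<lambda>x. x) \<in> measurable \<mu> borel" "(\<lambda>x. x) \<in> measurable \<nu> borel"
    unfolding measurable_cong_sets[OF sets(1) refl] measurable_cong_sets[OF sets(2) refl]
    by (auto intro: measurable_restrict_space1)
  have "distr \<mu> borel (\<lambda>x. x) = distr \<nu> borel (\<lambda>x. x)"
  proof (rule measure_eqI_lessThan)
    fix x :: real
    have e: "emeasure (distr \<mu> borel (\<lambda>x. x)) {x<..} = emeasure \<mu> ({x<..} \<inter> {0..<1})"
      "emeasure (distr \<nu> borel (\<lambda>x. x)) {x<..} = emeasure \<nu> ({x<..} \<inter> {0..<1})"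
      using id by (auto simp: emeasure_distr space)
    interpret \<mu>: prob_space \<mu> by fact
    interpret \<nu>: prob_space \<nu> by fact
    show "emeasure (distr \<mu> borel (\<lambda>x. x)) {x<..} < \<infinity>"
      unfolding e by (simp add: \<mu>.emeasure_eq_measure)
    consider "x < 0" | "0 \<le> x" "x < 1" | "1 \<le> x" by linarith
    then show "emeasure (distr \<mu> borel (\<lambda>x. x)) {x<..} = emeasure (distr \<nu> borel (\<lambda>x. x)) {x<..}"
    proof cases
      case 1
      then have "{x<..} \<inter> {0..<1} = {0..<1}" by auto
      then show ?thesis unfolding e
        using \<mu>.emeasure_space_1 \<nu>.emeasure_space_1 by (simp add: space)
    next
      case 2 then show ?thesis unfolding e
        using eq by (simp add: \<mu>.emeasure_eq_measure \<nu>.emeasure_eq_measure)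
    next
      case 3
      then have "{x<..} \<inter> {0..<1} = {}" by auto
      then show ?thesis unfolding e by simp
    qed
  qed auto
  note D = this
  show ?thesis
  proof (rule measure_eqI)
    show "sets \<mu> = sets \<nu>" using sets by simp
    fix A assume A: "A \<in> sets \<mu>"
    then have "A \<in> sets borel" "A \<subseteq> {0..<1}"
      unfolding sets by (auto simp: sets_restrict_space_iff)
    then have "emeasure (distr \<mu> borel (\<lambda>x. x)) A = emeasure \<mu> A"
      "emeasure (distr \<nu> borel (\<lambda>x. x)) A = emeasure \<nu> A"
      using id by (auto simp: emeasure_distr space Int_absorb2)
    then show "emeasure \<mu> A = emeasure \<nu> A" using D by simp
  qed
qed

section \<open>Existence of the invariant measure\<close>

lemma lborel_translate:
  fixes A :: "real set"
  assumes "A \<in> sets borel" shows "emeasure lborel {x. x + c \<in> A} = emeasure lborel A"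
proof -
  have "emeasure lborel A = emeasure (distr lborel borel ((+) c)) A"
    by (simp add: lborel_distr_plus)
  also have "\<dots> = emeasure lborel ((+) c -` A)"
    using assms by (simp add: emeasure_distr)
  also have "(+) c -` A = {x. x + c \<in> A}" by (auto simp: add.commute)
  finally show ?thesis by simp
qed

lemma periodic_int:
  assumes "\<And>x::real. x + 1 \<in> S \<longleftrightarrow> x \<in> S" shows "x + of_int k \<in> S \<longleftrightarrow> x \<in> S"
proof (induction k rule: int_induct[where k = 0])
  case (step1 i)
  then show ?case using assms[of "x + of_int i"] by (simp add: add.assoc)
next
  case (step2 i)
  then show ?case using assms[of "x + of_int (i - 1)"] by (simp add: algebra_simps)
qed simp

text \<open>The window is cut at the integer in (s, s + 1] and both pieces are moved back into [0,
  1). N is general because densities of periodic functions are treated in the same way as Lebesgue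
  measure.\<close>

lemma emeasure_periodic:
  fixes S :: "real set"
  assumes S: "S \<in> sets borel" and per: "\<And>x. x + 1 \<in> S \<longleftrightarrow> x \<in> S"
    and N: "sets N = sets borel" and inv: "\<And>A (k::int). A \<in> sets borel \<Longrightarrow> emeasure N {x. x + k \<in> A} = emeasure N A"
  shows "emeasure N (S \<inter> {s..<s + 1}) = emeasure N (S \<inter> {0..<1})"
proof -
  define n where "n = \<lfloor>s\<rfloor>"
  have n: "n \<le> s" "s < n + 1" unfolding n_def by linarith+
  have m: "S \<inter> {u..<v} \<in> sets N" for u v using S N by auto
  have "emeasure N (S \<inter> {s..<n + 1}) = emeasure N {x. x + of_int n \<in> S \<inter> {s..<n + 1}}"
    using inv[of "S \<inter> {s..<n + 1}" n] S by simp
  also have "{x. x + of_int n \<in> S \<inter> {s..<n + 1}} = S \<inter> {s - n..<1}"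
    using periodic_int[OF per] by auto
  finally have 1: "emeasure N (S \<inter> {s..<n + 1}) = emeasure N (S \<inter> {s - n..<1})" .
  have "emeasure N (S \<inter> {n + 1..<s + 1}) = emeasure N {x. x + of_int (n + 1) \<in> S \<inter> {n + 1..<s + 1}}"
    using inv[of "S \<inter> {n + 1..<s + 1}" "n + 1"] S by simp
  also have "{x. x + of_int (n + 1) \<in> S \<inter> {n + 1..<s + 1}} = S \<inter> {0..<s - n}"
    using periodic_int[OF per, of _ "n + 1"] by (auto simp: algebra_simps)
  finally have 2: "emeasure N (S \<inter> {n + 1..<s + 1}) = emeasure N (S \<inter> {0..<s - n})" .
  have add: "emeasure N (S \<inter> {u..<v} \<union> S \<inter> {v..<w}) = emeasure N (S \<inter> {u..<v}) + emeasure N (S \<inter> {v..<w})" for u v w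
    by (intro plus_emeasure[symmetric] m) auto
  have "S \<inter> {s..<s + 1} = S \<inter> {s..<n + 1} \<union> S \<inter> {n + 1..<s + 1}"
    "S \<inter> {0..<1} = S \<inter> {0..<s - n} \<union> S \<inter> {s - n..<1}" using n by auto
  then show ?thesis using 1 2 by (simp only: add add.commute)
qed

definition plateau_values :: "(real \<Rightarrow> real) \<Rightarrow> real set" where
  "plateau_values h = {y. \<exists>x x'. x < x' \<and> h x = y \<and> h x' = y}"

text \<open>Every plateau contains a rational point.\<close>

lemma countable_plateau_values:
  assumes "mono h" shows "countable (plateau_values h)"
proof -
  have "plateau_values h \<subseteq> h ` \<rat>"
  proof
    fix y assume "y \<in> plateau_values h"
    then obtain x x' where x: "x < x'" "h x = y" "h x' = y" by (auto simp: plateau_values_def)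
    obtain r where r: "r \<in> \<rat>" "x < r" "r < x'" using Rats_dense_in_real[OF x(1)] by auto
    then have "h r = y" using monoD[OF assms, of x r] monoD[OF assms, of r x'] x by auto
    then show "y \<in> h ` \<rat>" using r by auto
  qed
  then show ?thesis using countable_rat countable_subset by blast
qed

lemma section_conj:
  assumes "semiconj \<alpha> f h" "y + \<alpha> \<notin> plateau_values h"
  shows "f (section_of h y) = section_of h (y + \<alpha>)"
proof -
  have "h (f (section_of h y)) = y + \<alpha>" "h (section_of h (y + \<alpha>)) = y + \<alpha>"
    using assms(1) section_of(1)[of h] by (auto simp: semiconj_def)
  then show ?thesis using assms(2) unfolding plateau_values_def
    by (metis (mono_tags, lifting) linorder_neqE_linordered_idom mem_Collect_eq)
qed

text \<open>This is the measure with distribution function h, written as the image of Lebesgue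
  measure under a right inverse of h. The arbitrary choice on plateaus concerns only countably many
  y.\<close>

definition circle_invariant :: "(real \<Rightarrow> real) \<Rightarrow> real measure" where
  "circle_invariant h = distr (restrict_space lborel {0..<1}) (restrict_space borel {0..<1})
     (\<lambda>y. frac (section_of h y))"

lemma section_measurable:
  "equivariant 1 h \<Longrightarrow> continuous_on UNIV h \<Longrightarrow> section_of h \<in> borel_measurable borel"
  using section_of(4) by (intro borel_measurable_mono) (auto simp: equivariant_def)

lemma emeasure_circle_invariant:
  assumes "equivariant 1 h" "continuous_on UNIV h" "A \<in> sets (restrict_space borel {0..<1})"
  shows "emeasure (circle_invariant h) A = emeasure lborel {y \<in> {0..<1}. frac (section_of h y) \<in> A}"
proof -
  note [measurable] = section_measurable[OF assms(1,2)]
  have m: "(\<lambda>y. frac (section_of h y)) \<in> measurable (restrict_space lborel {0..<1}) (restrict_space borel {0..<1})"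
    by (intro measurable_restrict_space2 measurable_restrict_space1) (auto simp: frac_lt_1)
  have "(\<lambda>y. frac (section_of h y)) -` A \<inter> {0..<1} = {y \<in> {0..<1}. frac (section_of h y) \<in> A}"
    by auto
  then show ?thesis
    unfolding circle_invariant_def emeasure_distr[OF m assms(3)]
    by (simp add: space_restrict_space) (subst emeasure_restrict_space, auto)
qed

text \<open>In the coordinate y the map acts as the rotation by \<alpha>, except where y + \<alpha>
  is one of the countably many plateau values; rotations preserve the Lebesgue measure of periodic
  sets.\<close>

lemma invariant_prob_circle_invariant:
  assumes f: "circle_lift f" and h: "semiconj \<alpha> f h"
  shows "invariant_prob f (circle_invariant h)"
proof -
  have h': "equivariant 1 h" "continuous_on UNIV h" using h by (auto simp: semiconj_def)
  note sec = section_of[OF h'] 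
  note [measurable] = section_measurable[OF h']
  have sets: "sets (circle_invariant h) = sets (restrict_space borel {0..<1})"
    by (simp add: circle_invariant_def)
  have space: "space (circle_invariant h) = {0..<1}"
    by (simp add: circle_invariant_def space_restrict_space)
  have [measurable]: "f \<in> borel_measurable borel"
    using f by (simp add: circle_lift_def borel_measurable_continuous_onI)
  have eqf: "equivariant 1 f" using f by (rule circle_lift_equivariant)
  note em = emeasure_circle_invariant[OF h']
  have "prob_space (circle_invariant h)"
  proof (rule prob_spaceI)
    have "{y \<in> {0..<1}. frac (section_of h y) \<in> {0..<1}} = {0..<1}" by (auto simp: frac_lt_1)
    then show "emeasure (circle_invariant h) (space (circle_invariant h)) = 1"
      unfolding space using em[of "{0..<1}"] by (simp add: sets_restrict_space_iff)
  qed
  moreover have "emeasure (circle_invariant h) (circle_map f -` A \<inter> {0..<1}) = emeasure (circle_invariant h) A"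
    if A: "A \<in> sets (restrict_space borel {0..<1})" for A
  proof -
    define S where "S = {y. frac (section_of h y) \<in> A}"
    have A': "A \<in> sets borel" using A by (auto simp: sets_restrict_space_iff)
    have S: "S \<in> sets borel"
      using A' measurable_sets[of "\<lambda>y. frac (section_of h y)" borel borel A]
      by (auto simp: S_def vimage_def)
    have per: "y + 1 \<in> S \<longleftrightarrow> y \<in> S" for y by (simp add: S_def sec(2) frac_1_eq)
    have T: "circle_map f -` A \<inter> {0..<1} \<in> sets (restrict_space borel {0..<1})"
      using measurable_sets[OF circle_map_measurable[of f "restrict_space borel {0..<1}"] A] f
      by (simp add: space_restrict_space circle_lift_def)
    have "emeasure (circle_invariant h) (circle_map f -` A \<inter> {0..<1}) =
        emeasure lborel {y \<in> {0..<1}. frac (f (section_of h y)) \<in> A}"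
      unfolding em[OF T] by (intro arg_cong[where f = "emeasure lborel"])
        (auto simp: circle_map_frac[OF eqf] frac_lt_1)
    also have "\<dots> = emeasure lborel {y \<in> {0..<1}. y + \<alpha> \<in> S}"
    proof (rule emeasure_eq_AE)
      have "countable ((\<lambda>y. y - \<alpha>) ` plateau_values h)"
        using countable_plateau_values h'(1) by (auto simp: equivariant_def)
      then have "AE y in lborel. y \<notin> (\<lambda>y. y - \<alpha>) ` plateau_values h"
        by (intro AE_not_in countable_imp_null_set_lborel)
      then show "AE y in lborel. y \<in> {y \<in> {0..<1}. frac (f (section_of h y)) \<in> A} \<longleftrightarrow>
          y \<in> {y \<in> {0..<1}. y + \<alpha> \<in> S}"
      proof eventually_elim
        case (elim y)
        then have "y + \<alpha> \<notin> plateau_values h" by (metis add_diff_cancel_right' image_eqI)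
        then show ?case using section_conj[OF h, of y] by (simp add: S_def)
      qed
      have "(\<lambda>y. frac (f (section_of h y))) -` A \<inter> space lborel \<in> sets lborel"
        by (rule measurable_sets) (use A' in auto)
      then show "{y \<in> {0..<1}. frac (f (section_of h y)) \<in> A} \<in> sets lborel"
        by (simp add: vimage_def Collect_conj_eq)
      have "(\<lambda>y. y + \<alpha>) -` S \<inter> space lborel \<in> sets lborel"
        by (rule measurable_sets) (use S in auto)
      then show "{y \<in> {0..<1}. y + \<alpha> \<in> S} \<in> sets lborel"
        by (simp add: vimage_def Collect_conj_eq)
    qed
    also have "{y \<in> {0..<1}. y + \<alpha> \<in> S} = {y. y + \<alpha> \<in> S \<inter> {\<alpha>..<\<alpha> + 1}}" by auto
    also have "emeasure lborel \<dots> = emeasure lborel (S \<inter> {\<alpha>..<\<alpha> + 1})"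
      using S by (intro lborel_translate) auto
    also have "\<dots> = emeasure lborel (S \<inter> {0..<1})"
      by (rule emeasure_periodic[OF S per]) (auto intro: lborel_translate)
    also have "S \<inter> {0..<1} = {y \<in> {0..<1}. frac (section_of h y) \<in> A}" by (auto simp: S_def)
    finally show ?thesis using em[OF A] by simp
  qed
  ultimately show ?thesis
    unfolding invariant_prob_def space sets by auto
qed

section \<open>Absolutely continuous functions\<close>

text \<open>Intervals are encoded by their end points and may share these, so the half-open cells
  are disjoint. With degenerate pairs excluded, one pair cannot lie in two different cells, which
  lets sums over unions and images of families split.\<close>

definition separated :: "(real \<times> real) set \<Rightarrow> bool" where
  "separated S \<longleftrightarrow> finite S \<and> (\<forall>p\<in>S. fst p < snd p) \<and>
     (\<forall>p\<in>S. \<forall>p'\<in>S. p \<noteq> p' \<longrightarrow> snd p \<le> fst p' \<or> snd p' \<le> fst p)"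

definition increment :: "(real \<Rightarrow> real) \<Rightarrow> (real \<times> real) set \<Rightarrow> real" where
  "increment F S = (\<Sum>p\<in>S. F (snd p) - F (fst p))"

text \<open>Equivalent to the usual condition on sums of absolute values: apply it to the pairs with
  positive and with negative increment separately. The signed sum is additive in F and compatible
  with \<open>push_pairs\<close>.\<close>

definition abs_continuous :: "(real \<Rightarrow> real) \<Rightarrow> bool" where
  "abs_continuous F \<longleftrightarrow> (\<forall>\<epsilon>>0. \<exists>\<delta>>0. \<forall>S. separated S \<and> increment (\<lambda>x. x) S < \<delta> \<longrightarrow> \<bar>increment F S\<bar> \<le> \<epsilon>)"

lemma separated_empty [simp]: "separated {}"
  by (simp add: separated_def)

lemma separated_finite: "separated S \<Longrightarrow> finite S"
  by (simp add: separated_def)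

lemma separated_less: "separated S \<Longrightarrow> p \<in> S \<Longrightarrow> fst p < snd p"
  unfolding separated_def by blast

lemma separated_le: "separated S \<Longrightarrow> p \<in> S \<Longrightarrow> fst p \<le> snd p"
  by (rule less_imp_le) (rule separated_less)

lemma separated_apart:
  "separated S \<Longrightarrow> p \<in> S \<Longrightarrow> p' \<in> S \<Longrightarrow> p \<noteq> p' \<Longrightarrow> snd p \<le> fst p' \<or> snd p' \<le> fst p"
  unfolding separated_def by blast

lemma increment_empty [simp]: "increment F {} = 0"
  by (simp add: increment_def)

lemma increment_diff: "increment (\<lambda>x. F x - G x) S = increment F S - increment G S"
  by (simp add: increment_def sum_subtractf)

text \<open>Pairs collapsed by a monotone \<phi> are dropped, which keeps the family nondegenerate;
  they carry no increment.\<close>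

definition push_pairs :: "(real \<Rightarrow> real) \<Rightarrow> (real \<times> real) set \<Rightarrow> (real \<times> real) set" where
  "push_pairs \<phi> S = (\<lambda>p. (\<phi> (fst p), \<phi> (snd p))) ` {p \<in> S. \<phi> (fst p) < \<phi> (snd p)}"

lemma push_pairs:
  assumes S: "separated S" and \<phi>: "mono \<phi>"
  shows "separated (push_pairs \<phi> S)" "increment F (push_pairs \<phi> S) = increment (\<lambda>x. F (\<phi> x)) S"
proof -
  let ?g = "\<lambda>p. (\<phi> (fst p), \<phi> (snd p))" and ?S = "{p \<in> S. \<phi> (fst p) < \<phi> (snd p)}"
  have fin: "finite S" using S by (simp add: separated_def)
  have sep: "\<phi> (snd p) \<le> \<phi> (fst p') \<or> \<phi> (snd p') \<le> \<phi> (fst p)" if "p \<in> S" "p' \<in> S" "p \<noteq> p'" for p p'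
    using S that monoD[OF \<phi>] unfolding separated_def by blast
  have inj: "inj_on ?g ?S"
  proof (rule inj_onI, rule ccontr)
    fix p p' assume p: "p \<in> ?S" "p' \<in> ?S" "?g p = ?g p'" "p \<noteq> p'"
    then show False using sep[of p p'] by auto
  qed
  show "separated (push_pairs \<phi> S)"
    unfolding separated_def push_pairs_def using fin sep by fastforce
  have "increment F (push_pairs \<phi> S) = (\<Sum>p\<in>?S. F (\<phi> (snd p)) - F (\<phi> (fst p)))"
    unfolding increment_def push_pairs_def using inj by (subst sum.reindex) auto
  also have "\<dots> = (\<Sum>p\<in>S. F (\<phi> (snd p)) - F (\<phi> (fst p)))"
  proof (rule sum.mono_neutral_left[OF fin], blast, rule ballI)
    fix p assume p: "p \<in> S - ?S"
    then have "fst p < snd p" using S by (auto simp: separated_def)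
    then have "\<phi> (fst p) = \<phi> (snd p)" using p monoD[OF \<phi>, of "fst p" "snd p"] by auto
    then show "F (\<phi> (snd p)) - F (\<phi> (fst p)) = 0" by simp
  qed
  finally show "increment F (push_pairs \<phi> S) = increment (\<lambda>x. F (\<phi> x)) S"
    by (simp add: increment_def)
qed

text \<open>Cuts a family at x by pushing it along min and max with x; F (min t x) + F (max t x) = F
  t + F x makes the increments add up.\<close>

lemma increment_split:
  assumes S: "separated S"
  obtains S1 S2 where "separated S1" "separated S2" "increment F S = increment F S1 + increment F S2"
    "\<And>p. p \<in> S1 \<Longrightarrow> snd p \<le> x" "\<And>p. p \<in> S2 \<Longrightarrow> x \<le> fst p"
    "\<And>p y. p \<in> S2 \<Longrightarrow> (\<And>p. p \<in> S \<Longrightarrow> snd p \<le> y) \<Longrightarrow> snd p \<le> y"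
proof
  have mono: "mono (\<lambda>t::real. min t x)" "mono (\<lambda>t::real. max t x)"
    by (auto simp: mono_def)
  show "separated (push_pairs (\<lambda>t. min t x) S)" "separated (push_pairs (\<lambda>t. max t x) S)"
    using push_pairs(1)[OF S] mono by auto
  have "F (min t x) + F (max t x) = F t + F x" for t
    by (auto simp: min_def max_def)
  then have sp: "F t - F s = (F (min t x) - F (min s x)) + (F (max t x) - F (max s x))" for s t
    by (smt (verit))
  show "increment F S = increment F (push_pairs (\<lambda>t. min t x) S) + increment F (push_pairs (\<lambda>t. max t x) S)"
    unfolding push_pairs(2)[OF S mono(1)] push_pairs(2)[OF S mono(2)]
    unfolding increment_def sum.distrib[symmetric] by (intro sum.cong refl sp)
qed (auto simp: push_pairs_def max_def split: if_splits)

lemma emeasure_separated: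
  assumes S: "separated S"
  shows "emeasure lborel (\<Union>p\<in>S. {fst p<..snd p}) = ennreal (increment (\<lambda>x. x) S)"
proof -
  have "disjoint_family_on (\<lambda>p. {fst p<..snd p}) S"
    using S unfolding separated_def disjoint_family_on_def by fastforce
  then have "emeasure lborel (\<Union>p\<in>S. {fst p<..snd p}) = (\<Sum>p\<in>S. emeasure lborel {fst p<..snd p})"
    using S by (intro sum_emeasure[symmetric]) (auto simp: separated_def)
  also have "\<dots> = (\<Sum>p\<in>S. ennreal (snd p - fst p))"
    using S by (intro sum.cong) (auto simp: separated_def less_imp_le)
  also have "\<dots> = ennreal (increment (\<lambda>x. x) S)"
    unfolding increment_def using S by (intro sum_ennreal) (auto simp: separated_def less_imp_le)
  finally show ?thesis .
qed

lemma increment_id_nonneg: "separated S \<Longrightarrow> 0 \<le> increment (\<lambda>x. x) S"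
  unfolding increment_def by (rule sum_nonneg) (auto simp: separated_def less_imp_le)

lemma increment_le_length:
  assumes S: "separated S" and sub: "\<And>p. p \<in> S \<Longrightarrow> a \<le> fst p \<and> snd p \<le> b" and "a \<le> b"
  shows "increment (\<lambda>x. x) S \<le> b - a"
proof -
  have "(\<Union>p\<in>S. {fst p<..snd p}) \<subseteq> {a<..b}"
    using sub by fastforce
  then have "emeasure lborel (\<Union>p\<in>S. {fst p<..snd p}) \<le> emeasure lborel {a<..b}"
    by (rule emeasure_mono) simp
  then show ?thesis unfolding emeasure_separated[OF S] using \<open>a \<le> b\<close> by simp
qed

text \<open>Jordan decomposition: P x is the supremum of the increments of F over families to the
  left of x, the positive variation. Absolute continuity passes to P because each increment of P
  over a pair is nearly an increment of F over a family inside that pair.\<close>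

lemma positive_variation:
  assumes F: "abs_continuous F" and uv: "u \<le> v"
    and left: "\<And>x. x \<le> u \<Longrightarrow> F x = F u" and right: "\<And>x. v \<le> x \<Longrightarrow> F x = F v"
  obtains P where "mono P" "mono (\<lambda>x. P x - F x)" "abs_continuous P"
    "\<And>x. x \<le> u \<Longrightarrow> P x = 0" "\<And>x. v \<le> x \<Longrightarrow> P x = P v"
proof -
  define A where "A x = {increment F S |S. separated S \<and> (\<forall>p\<in>S. snd p \<le> x)}" for x
  define P where "P x = Sup (A x)" for x
  have zero: "0 \<in> A x" for x
    unfolding A_def by (rule CollectI, rule exI[of _ "{}"]) simp
  obtain \<delta> where \<delta>: "\<delta> > 0" "\<And>S. separated S \<Longrightarrow> increment (\<lambda>x. x) S < \<delta> \<Longrightarrow> \<bar>increment F S\<bar> \<le> 1"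
    using F unfolding abs_continuous_def by (meson zero_less_one)
  have low: "increment F S = 0" if "separated S" "\<And>p. p \<in> S \<Longrightarrow> snd p \<le> u" for S
    unfolding increment_def
  proof (rule sum.neutral, rule ballI)
    fix p assume "p \<in> S"
    then have "fst p < snd p" "snd p \<le> u" using that(2)[of p] that(1) unfolding separated_def by blast+
    then show "F (snd p) - F (fst p) = 0" using left[of "fst p"] left[of "snd p"] by simp
  qed
  have high: "increment F S = 0" if "separated S" "\<And>p. p \<in> S \<Longrightarrow> v \<le> fst p" for S
    unfolding increment_def
  proof (rule sum.neutral, rule ballI)
    fix p assume "p \<in> S"
    then have "fst p < snd p" "v \<le> fst p" using that(2)[of p] that(1) unfolding separated_def by blast+
    then show "F (snd p) - F (fst p) = 0" using right[of "fst p"] right[of "snd p"] by simp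
  qed
  \<comment> \<open>Finiteness of the supremum: each slice has length \<delta>/2, strictly below
    \<delta>, and so contributes at most 1; left of u nothing is contributed.\<close>
  have steps: "increment F S \<le> real k" if "separated S" "\<And>p. p \<in> S \<Longrightarrow> snd p \<le> u + k * (\<delta> / 2)" for k S
    using that
  proof (induction k arbitrary: S)
    case 0 then show ?case using low[of S] by simp
  next
    case (Suc k)
    obtain S1 S2 where S: "separated S1" "separated S2" "increment F S = increment F S1 + increment F S2"
      "\<And>p. p \<in> S1 \<Longrightarrow> snd p \<le> u + k * (\<delta> / 2)" "\<And>p. p \<in> S2 \<Longrightarrow> u + k * (\<delta> / 2) \<le> fst p"
      "\<And>p. p \<in> S2 \<Longrightarrow> snd p \<le> u + Suc k * (\<delta> / 2)"
      using increment_split[OF Suc.prems(1), of F "u + k * (\<delta> / 2)"] Suc.prems(2) by metis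
    have "increment (\<lambda>x. x) S2 \<le> (u + Suc k * (\<delta> / 2)) - (u + k * (\<delta> / 2))"
      using \<delta>(1) S(2,5,6) by (intro increment_le_length) (auto simp: algebra_simps)
    also have "\<dots> < \<delta>" using \<delta>(1) by (simp add: algebra_simps)
    finally have "\<bar>increment F S2\<bar> \<le> 1" using \<delta>(2) S(2) by blast
    then show ?case using Suc.IH[OF S(1,4)] S(3) by simp
  qed
  have bdd: "bdd_above (A x)" for x
  proof -
    obtain k :: nat where "(x - u) / (\<delta> / 2) \<le> k" using real_arch_simple by blast
    then have "x \<le> u + k * (\<delta> / 2)" using \<delta>(1) by (simp add: field_simps)
    then have "increment F S \<le> k" if "separated S" "\<forall>p\<in>S. snd p \<le> x" for S
      using steps[OF that(1), of k] that(2) by force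
    then show ?thesis unfolding A_def by (intro bdd_aboveI[of _ "real k"]) auto
  qed
  have up: "increment F S \<le> P x" if "separated S" "\<And>p. p \<in> S \<Longrightarrow> snd p \<le> x" for S x
    unfolding P_def by (rule cSup_upper[OF _ bdd]) (use that in \<open>auto simp: A_def\<close>)
  have least: "P x \<le> c" if "\<And>S. separated S \<Longrightarrow> (\<And>p. p \<in> S \<Longrightarrow> snd p \<le> x) \<Longrightarrow> increment F S \<le> c" for x c
    unfolding P_def by (rule cSup_least) (use zero[of x] that in \<open>auto simp: A_def\<close>)
  \<comment> \<open>A nearly optimal family for y is cut at x; its left part contributes at most P
    x.\<close>
  have approx: "\<exists>S. separated S \<and> (\<forall>p\<in>S. x \<le> fst p \<and> snd p \<le> y) \<and> P y - P x - \<eta> < increment F S"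
    if "0 < \<eta>" for x y \<eta>
  proof -
    have "\<exists>a\<in>A y. P y - \<eta> < a"
      unfolding P_def using that zero[of y] bdd[of y] by (intro less_cSupD) auto
    then obtain S where S: "separated S" "\<And>p. p \<in> S \<Longrightarrow> snd p \<le> y" "P y - \<eta> < increment F S"
      unfolding A_def by blast
    obtain S1 S2 where S': "separated S1" "separated S2" "increment F S = increment F S1 + increment F S2"
      "\<And>p. p \<in> S1 \<Longrightarrow> snd p \<le> x" "\<And>p. p \<in> S2 \<Longrightarrow> x \<le> fst p" "\<And>p. p \<in> S2 \<Longrightarrow> snd p \<le> y"
      using increment_split[OF S(1), of F x] S(2) by metis
    then show ?thesis using up[OF S'(1), of x] S(3) by (intro exI[of _ S2]) auto
  qed
  have F_le: "P x + F y - F x \<le> P y" if xy: "x \<le> y" for x y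
  proof (cases "x = y")
    case False
    have "P x \<le> P y - (F y - F x)"
    proof (rule least)
      fix S assume S: "separated S" "\<And>p. p \<in> S \<Longrightarrow> snd p \<le> x"
      have new: "(x, y) \<notin> S" using S(2)[of "(x, y)"] xy False by auto
      have "separated (insert (x, y) S)"
        using S xy False unfolding separated_def by auto
      moreover have "snd p \<le> y" if "p \<in> insert (x, y) S" for p
        using that S(2) xy by fastforce
      ultimately have "increment F (insert (x, y) S) \<le> P y" by (rule up)
      then show "increment F S \<le> P y - (F y - F x)"
        using new S(1) by (simp add: increment_def separated_def)
    qed
    then show ?thesis by simp
  qed simp
  show ?thesis
  proof
    show "mono P"
    proof (rule monoI, rule least)
      fix x y S assume "x \<le> y" "separated S" "\<And>p. p \<in> S \<Longrightarrow> snd p \<le> (x::real)"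
      then show "increment F S \<le> P y" by (intro up) (auto intro: order_trans)
    qed
    then have mP: "P x \<le> P y" if "x \<le> y" for x y using that by (rule monoD)
    show "mono (\<lambda>x. P x - F x)"
      by (rule monoI) (use F_le in \<open>simp add: algebra_simps\<close>)
    show "P x = 0" if "x \<le> u" for x
    proof (rule antisym)
      show "P x \<le> 0" by (rule least) (use low that in force)
      show "0 \<le> P x" using up[of "{}"] by simp
    qed
    show "P x = P v" if "v \<le> x" for x
    proof (rule antisym)
      show "P x \<le> P v"
      proof (rule field_le_epsilon)
        fix e :: real assume "0 < e"
        then obtain S where "separated S" "\<forall>p\<in>S. v \<le> fst p \<and> snd p \<le> x" "P x - P v - e < increment F S"
          using approx[of e v x] by blast
        moreover from this have "increment F S = 0" by (intro high) auto
        ultimately show "P x \<le> P v + e" by simp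
      qed
    qed (use mP that in auto)
    show "abs_continuous P"
      unfolding abs_continuous_def
    proof (intro allI impI)
      fix \<epsilon> :: real assume \<epsilon>: "0 < \<epsilon>"
      obtain d where d: "d > 0" "\<And>S. separated S \<Longrightarrow> increment (\<lambda>x. x) S < d \<Longrightarrow> \<bar>increment F S\<bar> \<le> \<epsilon>"
        using F \<epsilon> unfolding abs_continuous_def by meson
      show "\<exists>\<delta>>0. \<forall>S. separated S \<and> increment (\<lambda>x. x) S < \<delta> \<longrightarrow> \<bar>increment P S\<bar> \<le> \<epsilon>"
      proof (intro exI[of _ d] conjI allI impI d(1))
        fix T assume T: "separated T \<and> increment (\<lambda>x. x) T < d"
        have fin: "finite T" using T by (simp add: separated_def)
        have "increment P T \<le> \<epsilon>"
        proof (rule field_le_epsilon)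
          fix e :: real assume e: "0 < e"
          define \<eta> where "\<eta> = e / (card T + 1)"
          have \<eta>: "0 < \<eta>" "card T * \<eta> \<le> e"
            using e by (auto simp: \<eta>_def field_simps)
          have "\<forall>p. \<exists>S. separated S \<and> (\<forall>r\<in>S. fst p \<le> fst r \<and> snd r \<le> snd p) \<and>
              P (snd p) - P (fst p) - \<eta> < increment F S"
            using approx[OF \<eta>(1)] by blast
          then obtain S where S: "\<And>p. separated (S p)" "\<And>p r. r \<in> S p \<Longrightarrow> fst p \<le> fst r \<and> snd r \<le> snd p"
            "\<And>p. P (snd p) - P (fst p) - \<eta> < increment F (S p)"
            by metis
          \<comment> \<open>U refines T, so its total length does not exceed that of T and the
            modulus d of F applies to it.\<close>
          define U where "U = (\<Union>p\<in>T. S p)"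
          have order: "fst r < snd r" if "r \<in> S p" for r p by (rule separated_less[OF S(1) that])
          have apart: "snd p \<le> fst p' \<or> snd p' \<le> fst p" if "p \<in> T" "p' \<in> T" "p \<noteq> p'" for p p'
            using T separated_apart that by blast
          have disj: "S p \<inter> S p' = {}" if "p \<in> T" "p' \<in> T" "p \<noteq> p'" for p p'
          proof (rule ccontr)
            assume "S p \<inter> S p' \<noteq> {}"
            then obtain r where r: "r \<in> S p" "r \<in> S p'" by auto
            show False using apart[OF that] order[OF r(1)] S(2)[OF r(1)] S(2)[OF r(2)] by auto
          qed
          have sum: "increment G U = (\<Sum>p\<in>T. increment G (S p))" for G
            unfolding increment_def U_def using fin S(1) disj
            by (intro sum.UNION_disjoint) (auto intro: separated_finite)
          have "separated U"
            unfolding separated_def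
          proof (intro conjI ballI impI)
            show "finite U" unfolding U_def using fin S(1) by (auto intro: separated_finite)
            show "fst r < snd r" if "r \<in> U" for r using that order by (auto simp: U_def)
            fix r r' assume r: "r \<in> U" "r' \<in> U" "r \<noteq> r'"
            then obtain p p' where p: "p \<in> T" "p' \<in> T" "r \<in> S p" "r' \<in> S p'" by (auto simp: U_def)
            show "snd r \<le> fst r' \<or> snd r' \<le> fst r"
            proof (cases "p = p'")
              case True then show ?thesis using separated_apart[OF S(1)[of p]] p r by blast
            next
              case False then show ?thesis using apart[OF p(1,2) False] S(2)[OF p(3)] S(2)[OF p(4)] by auto
            qed
          qed
          moreover have "increment (\<lambda>x. x) U \<le> increment (\<lambda>x. x) T"
            unfolding sum increment_def[of _ T]
          proof (rule sum_mono)
            fix p assume "p \<in> T"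
            then have "fst p \<le> snd p" using T separated_le by blast
            then show "increment (\<lambda>x. x) (S p) \<le> snd p - fst p"
              using S(1,2) by (intro increment_le_length) auto
          qed
          ultimately have "increment F U \<le> \<epsilon>" using d(2)[of U] T by auto
          moreover have "increment P T \<le> (\<Sum>p\<in>T. increment F (S p) + \<eta>)"
            unfolding increment_def[of P]
          proof (rule sum_mono)
            fix p show "P (snd p) - P (fst p) \<le> increment F (S p) + \<eta>" using S(3)[of p] by linarith
          qed
          then have "increment P T \<le> increment F U + card T * \<eta>"
            by (simp add: sum sum.distrib)
          ultimately show "increment P T \<le> \<epsilon> + e" using \<eta>(2) by simp
        qed
        moreover have "0 \<le> increment P T"
          unfolding increment_def by (rule sum_nonneg) (use T mP separated_le in force)
        ultimately show "\<bar>increment P T\<bar> \<le> \<epsilon>" by simp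
      qed
    qed
  qed
qed

section \<open>Densities of absolutely continuous functions\<close>

lemma abs_continuous_isCont:
  assumes "abs_continuous F" shows "isCont F x"
  unfolding continuous_at_real_range
proof (intro allI impI)
  fix e :: real assume e: "0 < e"
  then obtain d where d: "d > 0" "\<And>S. separated S \<Longrightarrow> increment (\<lambda>x. x) S < d \<Longrightarrow> \<bar>increment F S\<bar> \<le> e / 2"
    using assms unfolding abs_continuous_def by (meson half_gt_zero)
  have pair: "\<bar>F t - F s\<bar> < e" if "s < t" "t - s < d" for s t
    using d(2)[of "{(s, t)}"] that e by (simp add: separated_def increment_def)
  show "\<exists>\<delta>>0. \<forall>x'. norm (x' - x) < \<delta> \<longrightarrow> \<bar>F x' - F x\<bar> < e"
  proof (intro exI[of _ d] conjI allI impI d(1))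
    fix x' assume "norm (x' - x) < d"
    then show "\<bar>F x' - F x\<bar> < e"
      using pair[of x x'] pair[of x' x] e by (cases x x' rule: linorder_cases) (auto simp: abs_minus_commute)
  qed
qed

text \<open>The grid has half the mesh by which K can be enlarged inside U. Taking the grid cells
  that meet K yields a nonoverlapping cover, as \<open>separated\<close> requires.\<close>

lemma compact_cells:
  fixes K U :: "real set"
  assumes K: "compact K" and U: "open U" "K \<subseteq> U"
  obtains T where "separated T" "K \<subseteq> (\<Union>p\<in>T. {fst p<..snd p})" "(\<Union>p\<in>T. {fst p<..snd p}) \<subseteq> U"
proof -
  obtain e where e: "e > 0" "(\<Union>x\<in>K. ball x e) \<subseteq> U"
    using compact_subset_open_imp_ball_epsilon_subset[OF K U] by metis
  define \<eta> where "\<eta> = e / 2"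
  have \<eta>: "0 < \<eta>" "\<eta> < e" using e by (auto simp: \<eta>_def)
  define J where "J = (\<lambda>x. \<lceil>x / \<eta>\<rceil> - 1) ` K"
  define T where "T = (\<lambda>j. (of_int j * \<eta>, of_int (j + 1) * \<eta>)) ` J"
  obtain B where B: "\<And>x. x \<in> K \<Longrightarrow> \<bar>x\<bar> \<le> B" using compact_imp_bounded[OF K] bounded_real by metis
  have "J \<subseteq> {\<lceil>- B / \<eta>\<rceil> - 1..\<lceil>B / \<eta>\<rceil> - 1}"
  proof
    fix j assume "j \<in> J"
    then obtain x where x: "x \<in> K" "j = \<lceil>x / \<eta>\<rceil> - 1" by (auto simp: J_def)
    have "- B \<le> x" "x \<le> B" using B[OF x(1)] by auto
    then have "- B / \<eta> \<le> x / \<eta>" "x / \<eta> \<le> B / \<eta>" using \<eta> by (simp_all only: divide_right_mono less_imp_le)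
    from this[THEN ceiling_mono] show "j \<in> {\<lceil>- B / \<eta>\<rceil> - 1..\<lceil>B / \<eta>\<rceil> - 1}" unfolding x by simp
  qed
  then have finJ: "finite J" using finite_subset by blast
  have sepT: "separated T"
    unfolding separated_def
  proof (intro conjI ballI impI)
    show "finite T" using finJ by (simp add: T_def)
    show "fst p < snd p" if "p \<in> T" for p using that \<eta> by (auto simp: T_def algebra_simps)
    fix p p' assume "p \<in> T" "p' \<in> T" "p \<noteq> p'"
    then obtain j j' where j: "p = (of_int j * \<eta>, of_int (j + 1) * \<eta>)"
      "p' = (of_int j' * \<eta>, of_int (j' + 1) * \<eta>)" "j \<noteq> j'" by (auto simp: T_def)
    then have "j + 1 \<le> j' \<or> j' + 1 \<le> j" by auto
    then have "real_of_int (j + 1) \<le> of_int j' \<or> real_of_int (j' + 1) \<le> of_int j" by linarith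
    then show "snd p \<le> fst p' \<or> snd p' \<le> fst p" using \<eta> unfolding j by (auto intro: mult_right_mono)
  qed
  have cell: "x \<in> {of_int j * \<eta><..of_int (j + 1) * \<eta>}" if "j = \<lceil>x / \<eta>\<rceil> - 1" for x j
  proof -
    have "of_int j < x / \<eta>" "x / \<eta> \<le> of_int (j + 1)" unfolding that by linarith+
    then show ?thesis using \<eta> by (simp add: field_simps)
  qed
  have KT: "K \<subseteq> (\<Union>p\<in>T. {fst p<..snd p})"
    using cell unfolding T_def J_def by fastforce
  have TU: "(\<Union>p\<in>T. {fst p<..snd p}) \<subseteq> U"
  proof
    fix y assume "y \<in> (\<Union>p\<in>T. {fst p<..snd p})"
    then obtain x where x: "x \<in> K" "y \<in> {of_int (\<lceil>x / \<eta>\<rceil> - 1) * \<eta><..of_int (\<lceil>x / \<eta>\<rceil> - 1 + 1) * \<eta>}"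
      by (auto simp: T_def J_def)
    then have "\<bar>x - y\<bar> \<le> \<eta>" using cell[OF refl, of x] by (auto simp: algebra_simps abs_le_iff)
    then have "y \<in> ball x e" using \<eta> by (auto simp: dist_real_def)
    then show "y \<in> U" using e(2) x(1) by blast
  qed
  show ?thesis by (rule that[OF sepT KT TU])
qed

text \<open>The Stieltjes measure of G has Lebesgue null sets as null sets, and the density is its
  Radon-Nikodym derivative. Constancy of G outside [u, v] makes this measure finite, hence inner
  regular.\<close>

lemma mono_abs_continuous_density:
  assumes G: "abs_continuous G" and m: "mono G" and uv: "u \<le> v"
    and left: "\<And>x. x \<le> u \<Longrightarrow> G x = G u" and right: "\<And>x. v \<le> x \<Longrightarrow> G x = G v"
  obtains \<phi> where "integrable lborel \<phi>"
    "\<And>x y. x \<le> y \<Longrightarrow> (\<integral>t. indicator {x<..y} t * \<phi> t \<partial>lborel) = G y - G x"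
proof -
  define \<nu> where "\<nu> = interval_measure G"
  have em: "emeasure \<nu> {x<..y} = ennreal (G y - G x)" if "x \<le> y" for x y
    unfolding \<nu>_def using that m abs_continuous_isCont[OF G]
    by (intro emeasure_interval_measure_Ioc) (auto simp: monoD continuous_at_imp_continuous_at_within)
  have sets: "sets \<nu> = sets borel" by (simp add: \<nu>_def)
  have space: "space \<nu> = UNIV" by (simp add: \<nu>_def)
  have fin: "emeasure \<nu> UNIV \<le> ennreal (G v - G u)"
  proof -
    have U: "UNIV = (\<Union>n::nat. {- real n<..real n})"
    proof (rule UNIV_eq_I)
      fix x :: real
      obtain n :: nat where "\<bar>x\<bar> < n" using reals_Archimedean2 by blast
      then have "x \<in> {- real n<..real n}" by (simp add: abs_less_iff)
      then show "x \<in> (\<Union>n::nat. {- real n<..real n})" by blast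
    qed
    have inc: "{- real n<..real n} \<subseteq> {- real (Suc n)<..real (Suc n)}" for n
      by (rule subsetI) simp
    have range: "range (\<lambda>n. {- real n<..real n}) \<subseteq> sets \<nu>"
      by (auto simp: sets)
    have i: "incseq (\<lambda>n. {- real n<..real n})" by (rule incseq_SucI) (rule inc)
    have "(SUP n. emeasure \<nu> {- real n<..real n}) = emeasure \<nu> (\<Union>n. {- real n<..real n})"
      by (rule SUP_emeasure_incseq[OF range i])
    moreover have "emeasure \<nu> {- real n<..real n} \<le> ennreal (G v - G u)" for n
    proof -
      have "G (real n) \<le> G v"
        using monoD[OF m, of "real n" v] right[of "real n"] by linarith
      moreover have "G u \<le> G (- real n)"
        using monoD[OF m, of u "- real n"] left[of "- real n"] by linarith
      ultimately have "G (real n) - G (- real n) \<le> G v - G u" by simp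
      then show ?thesis using em[of "- real n" "real n"] by (simp add: ennreal_leI)
    qed
    ultimately show ?thesis unfolding U by (metis (no_types, lifting) SUP_least)
  qed
  have ac: "absolutely_continuous lborel \<nu>"
    unfolding absolutely_continuous_def
  proof (rule subsetI)
    fix N :: "real set" assume N: "N \<in> null_sets lborel"
    have NB: "N \<in> sets borel" using N by auto
    \<comment> \<open>By inner regularity compact subsets suffice, and these are covered by finitely
      many cells of small total length, which is the situation that \<open>abs_continuous\<close>
      controls.\<close>
    have cmp: "emeasure \<nu> K = 0" if K: "compact K" "K \<subseteq> N" for K
    proof -
      have "emeasure \<nu> K \<le> 0 + ennreal \<epsilon>" if \<epsilon>: "0 < \<epsilon>" for \<epsilon>
      proof -
        obtain d where d: "d > 0" "\<And>S. separated S \<Longrightarrow> increment (\<lambda>x. x) S < d \<Longrightarrow> \<bar>increment G S\<bar> \<le> \<epsilon>"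
          using G \<epsilon> unfolding abs_continuous_def by meson
        have K0: "emeasure lborel K = 0"
          using N K by (metis emeasure_mono null_setsD1 null_setsD2 le_zero_eq)
        obtain U where U: "open U" "K \<subseteq> U" "emeasure lborel (U - K) < ennreal d"
          using outer_regular_lborel[of K d] d(1) K(1) by (auto simp: borel_compact)
        have "K \<in> null_sets lborel" using K0 K(1) by (auto simp: borel_compact)
        then have "emeasure lborel (U - K) = emeasure lborel U"
          by (rule emeasure_Diff_null_set) (simp add: U(1))
        then have Ud: "emeasure lborel U < ennreal d" using U(3) by simp
        obtain T where sepT: "separated T" and KT: "K \<subseteq> (\<Union>p\<in>T. {fst p<..snd p})"
          and TU: "(\<Union>p\<in>T. {fst p<..snd p}) \<subseteq> U"
          using compact_cells[OF K(1) U(1,2)] .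
        have "ennreal (increment (\<lambda>x. x) T) \<le> emeasure lborel U"
          unfolding emeasure_separated[OF sepT, symmetric] using TU U(1) by (intro emeasure_mono) auto
        then have "ennreal (increment (\<lambda>x. x) T) < ennreal d" using Ud by simp
        then have "increment (\<lambda>x. x) T < d" using d(1) by (simp add: ennreal_less_iff increment_id_nonneg[OF sepT])
        then have G\<epsilon>: "increment G T \<le> \<epsilon>" using d(2)[OF sepT] by auto
        have "emeasure \<nu> K \<le> emeasure \<nu> (\<Union>p\<in>T. {fst p<..snd p})"
          using KT sets separated_finite[OF sepT] by (intro emeasure_mono) auto
        also have "\<dots> \<le> (\<Sum>p\<in>T. emeasure \<nu> {fst p<..snd p})"
          by (rule emeasure_subadditive_finite[OF separated_finite[OF sepT]]) (auto simp: sets)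
        also have "\<dots> = (\<Sum>p\<in>T. ennreal (G (snd p) - G (fst p)))"
          using separated_le[OF sepT] em by (intro sum.cong) auto
        also have "\<dots> = ennreal (increment G T)"
          unfolding increment_def using separated_le[OF sepT] m
          by (intro sum_ennreal) (auto simp: monoD)
        also have "\<dots> \<le> 0 + ennreal \<epsilon>" using G\<epsilon> by (simp add: ennreal_leI)
        finally show ?thesis .
      qed
      then have "emeasure \<nu> K \<le> 0" by (rule ennreal_le_epsilon)
      then show ?thesis by simp
    qed
    have "emeasure \<nu> N = (SUP K\<in>{K. K \<subseteq> N \<and> compact K}. emeasure \<nu> K)"
      using NB sets fin space by (intro inner_regular) (auto simp: top_unique)
    also have "\<dots> \<le> 0" by (rule SUP_least) (simp add: cmp)
    finally show "N \<in> null_sets \<nu>" using NB sets by auto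
  qed
  obtain r where r: "r \<in> borel_measurable lborel" "density lborel r = \<nu>"
    using sigma_finite_measure.Radon_Nikodym[OF sigma_finite_lborel ac] sets by auto
  have [measurable]: "r \<in> borel_measurable borel" using r(1) by simp
  have rA: "(\<integral>\<^sup>+t. r t * indicator A t \<partial>lborel) = emeasure \<nu> A" if "A \<in> sets borel" for A
    using that unfolding r(2)[symmetric] by (simp add: emeasure_density)
  have "(\<integral>\<^sup>+t. r t \<partial>lborel) = emeasure \<nu> UNIV" using rA[of UNIV] by simp
  then have fin': "(\<integral>\<^sup>+t. r t \<partial>lborel) < \<infinity>" using fin by (auto simp: top.not_eq_extremum intro: le_less_trans)
  then have AE: "AE t in lborel. r t \<noteq> \<infinity>" by (intro nn_integral_PInf_AE) auto
  then have AE': "AE t in lborel. ennreal (enn2real (r t)) = r t"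
    by eventually_elim (simp add: top.not_eq_extremum)
  show ?thesis
  proof
    have "(\<integral>\<^sup>+t. ennreal (enn2real (r t)) \<partial>lborel) = (\<integral>\<^sup>+t. r t \<partial>lborel)"
      using AE' by (intro nn_integral_cong_AE)
    then show "integrable lborel (\<lambda>t. enn2real (r t))"
      using fin' by (intro integrableI_nonneg) auto
    fix x y :: real assume xy: "x \<le> y"
    have "(\<integral>\<^sup>+t. ennreal (indicator {x<..y} t * enn2real (r t)) \<partial>lborel) = (\<integral>\<^sup>+t. r t * indicator {x<..y} t \<partial>lborel)"
      using AE' by (intro nn_integral_cong_AE) (auto simp: indicator_def)
    also have "\<dots> = ennreal (G y - G x)" using rA em[OF xy] by simp
    finally show "(\<integral>t. indicator {x<..y} t * enn2real (r t) \<partial>lborel) = G y - G x"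
      using monoD[OF m xy] by (subst integral_eq_nn_integral) auto
  qed
qed

text \<open>F = P - (P - F) with both terms monotone and absolutely continuous.\<close>

theorem abs_continuous_density:
  assumes F: "abs_continuous F" and uv: "u \<le> v"
    and left: "\<And>x. x \<le> u \<Longrightarrow> F x = F u" and right: "\<And>x. v \<le> x \<Longrightarrow> F x = F v"
  obtains \<phi> where "integrable lborel \<phi>"
    "\<And>x y. x \<le> y \<Longrightarrow> (\<integral>t. indicator {x<..y} t * \<phi> t \<partial>lborel) = F y - F x"
proof -
  obtain P where P: "mono P" "mono (\<lambda>x. P x - F x)" "abs_continuous P"
    "\<And>x. x \<le> u \<Longrightarrow> P x = 0" "\<And>x. v \<le> x \<Longrightarrow> P x = P v"
    using positive_variation[OF F uv left right] by metis
  have "abs_continuous (\<lambda>x. P x - F x)"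
    unfolding abs_continuous_def
  proof (intro allI impI)
    fix e :: real assume "0 < e"
    then have e: "0 < e / 2" by simp
    obtain d where d: "d > 0" "\<And>S. separated S \<Longrightarrow> increment (\<lambda>x. x) S < d \<Longrightarrow> \<bar>increment F S\<bar> \<le> e / 2"
      using F e unfolding abs_continuous_def by meson
    obtain d' where d': "d' > 0" "\<And>S. separated S \<Longrightarrow> increment (\<lambda>x. x) S < d' \<Longrightarrow> \<bar>increment P S\<bar> \<le> e / 2"
      using P(3) e unfolding abs_continuous_def by meson
    show "\<exists>\<delta>>0. \<forall>S. separated S \<and> increment (\<lambda>x. x) S < \<delta> \<longrightarrow> \<bar>increment (\<lambda>x. P x - F x) S\<bar> \<le> e"
    proof (intro exI[of _ "min d d'"] conjI allI impI)
      fix S assume "separated S \<and> increment (\<lambda>x. x) S < min d d'"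
      then have "\<bar>increment F S\<bar> \<le> e / 2" "\<bar>increment P S\<bar> \<le> e / 2" using d d' by auto
      then show "\<bar>increment (\<lambda>x. P x - F x) S\<bar> \<le> e" unfolding increment_diff by linarith
    qed (use d d' in auto)
  qed
  note N = this
  obtain \<phi> where \<phi>: "integrable lborel \<phi>"
    "\<And>x y. x \<le> y \<Longrightarrow> (\<integral>t. indicator {x<..y} t * \<phi> t \<partial>lborel) = P y - P x"
    using mono_abs_continuous_density[OF P(3,1) uv] P(4,5) uv by (metis order_refl)
  have "P x - F x = P u - F u" if "x \<le> u" for x using left[OF that] P(4) that by simp
  moreover have "P x - F x = P v - F v" if "v \<le> x" for x using right[OF that] P(5)[OF that] by simp
  ultimately obtain \<psi> where \<psi>: "integrable lborel \<psi>"
    "\<And>x y. x \<le> y \<Longrightarrow> (\<integral>t. indicator {x<..y} t * \<psi> t \<partial>lborel) = (P y - F y) - (P x - F x)"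
    using mono_abs_continuous_density[OF N P(2) uv] by blast
  show ?thesis
  proof
    show "integrable lborel (\<lambda>t. \<phi> t - \<psi> t)" using \<phi> \<psi> by auto
    fix x y :: real assume xy: "x \<le> y"
    have "integrable lborel (\<lambda>t. indicator {x<..y} t * \<phi> t)" "integrable lborel (\<lambda>t. indicator {x<..y} t * \<psi> t)"
      using \<phi>(1) \<psi>(1) by (auto intro: integrable_real_mult_indicator simp: mult.commute)
    then show "(\<integral>t. indicator {x<..y} t * (\<phi> t - \<psi> t) \<partial>lborel) = F y - F x"
      using \<phi>(2)[OF xy] \<psi>(2)[OF xy] by (simp add: right_diff_distrib)
  qed
qed

section \<open>Ergodicity of Lebesgue measure\<close>

lemma periodic_null:
  fixes S :: "real set"
  assumes S: "S \<in> sets borel" and per: "\<And>x. x + 1 \<in> S \<longleftrightarrow> x \<in> S"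
    and null: "emeasure lborel (S \<inter> {0..<1}) = 0"
  shows "emeasure lborel S = 0"
proof -
  have "S \<inter> {of_int k..<of_int k + 1} \<in> null_sets lborel" for k :: int
  proof (rule null_setsI)
    have "emeasure lborel (S \<inter> {of_int k..<of_int k + 1}) = emeasure lborel (S \<inter> {0..<1})"
      by (rule emeasure_periodic[OF S per]) (auto intro: lborel_translate)
    then show "emeasure lborel (S \<inter> {of_int k..<of_int k + 1}) = 0" using null by simp
  qed (use S in auto)
  then have "(\<Union>k::int. S \<inter> {of_int k..<of_int k + 1}) \<in> null_sets lborel"
    by (intro null_sets_UN') auto
  moreover have "(\<Union>k::int. S \<inter> {of_int k..<of_int k + 1}) = S"
  proof (rule antisym; rule subsetI)
    fix x assume "x \<in> S"
    then have "x \<in> S \<inter> {of_int \<lfloor>x\<rfloor>..<of_int \<lfloor>x\<rfloor> + 1}" by auto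
    then show "x \<in> (\<Union>k::int. S \<inter> {of_int k..<of_int k + 1})" by blast
  qed auto
  ultimately show ?thesis by (simp add: null_sets_def)
qed

text \<open>Based at 0, with a sign, because half-lines may have infinite mass under a periodic
  measure.\<close>

definition signed_cdf :: "real measure \<Rightarrow> real \<Rightarrow> real" where
  "signed_cdf N y = (if 0 \<le> y then measure N {0..<y} else - measure N {y..<0})"

lemma signed_cdf:
  assumes N: "sets N = sets borel" and fin: "\<And>a b. emeasure N {a..<b} \<noteq> \<infinity>" and "a \<le> b"
  shows "measure N {a..<b} = signed_cdf N b - signed_cdf N a"
proof -
  have add: "measure N {x..<z} = measure N {x..<y} + measure N {y..<z}" if "x \<le> y" "y \<le> z" for x y z
  proof -
    have "{x..<z} = {x..<y} \<union> {y..<z}" using that by auto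
    then show ?thesis using N fin by (simp add: measure_Union)
  qed
  show ?thesis
    using add[of 0 a b] add[of a 0 b] add[of a b 0] \<open>a \<le> b\<close> by (auto simp: signed_cdf_def)
qed

lemma equivariant_signed_cdf:
  assumes N: "sets N = sets borel" and fin: "\<And>a b. emeasure N {a..<b} \<noteq> \<infinity>"
    and inv: "\<And>a b. measure N {a + 1..<b + 1} = measure N {a..<b}"
  shows "equivariant (measure N {0..<1}) (signed_cdf N)"
  unfolding equivariant_def
proof (intro conjI allI monoI)
  fix x y :: real assume "x \<le> y"
  then show "signed_cdf N x \<le> signed_cdf N y"
    using signed_cdf[OF N fin, of x y] measure_nonneg[of N "{x..<y}"] by linarith
next
  fix x
  have d: "signed_cdf N (y + 1) - signed_cdf N (x + 1) = signed_cdf N y - signed_cdf N x" if "x \<le> y" for x y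
    using signed_cdf[OF N fin, of x y] signed_cdf[OF N fin, of "x + 1" "y + 1"] inv[of x y] that by simp
  have "signed_cdf N 0 = 0" "signed_cdf N 1 = measure N {0..<1}" by (simp_all add: signed_cdf_def)
  then show "signed_cdf N (x + 1) = signed_cdf N x + measure N {0..<1}"
    using d[of 0 x] d[of x 0] by (cases "0 \<le> x") auto
qed

section \<open>Jacobians of iterates and their distortion\<close>

definition orbit_weight :: "(real \<Rightarrow> real) \<Rightarrow> (real \<Rightarrow> real) \<Rightarrow> nat \<Rightarrow> real \<Rightarrow> real" where
  "orbit_weight f D n x = (\<Prod>i<n. D ((f ^^ i) x))"

text \<open>The derivative enters through the change of variables formula alone, so D may take any
  positive values at break points. By the chain rule \<open>orbit_weight f D n\<close> is then a
  Jacobian of \<open>f ^^ n\<close>.\<close>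

definition lebesgue_jacobian :: "(real \<Rightarrow> real) \<Rightarrow> (real \<Rightarrow> real) \<Rightarrow> bool" where
  "lebesgue_jacobian f D \<longleftrightarrow> f \<in> borel_measurable borel \<and> D \<in> borel_measurable borel \<and> (\<forall>x. 0 < D x) \<and>
     (\<forall>u\<in>borel_measurable borel. (\<integral>\<^sup>+x. u (f x) * ennreal (D x) \<partial>lborel) = (\<integral>\<^sup>+x. u x \<partial>lborel))"

lemma measurable_funpow:
  fixes f :: "'a \<Rightarrow> 'a"
  assumes "f \<in> measurable M M" shows "(f ^^ n) \<in> measurable M M"
  by (induction n) (auto intro: measurable_compose[OF _ assms])

lemma orbit_weight:
  assumes "lebesgue_jacobian f D"
  shows "orbit_weight f D n \<in> borel_measurable borel" "0 < orbit_weight f D n x"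
    "u \<in> borel_measurable borel \<Longrightarrow>
      (\<integral>\<^sup>+x. u ((f ^^ n) x) * ennreal (orbit_weight f D n x) \<partial>lborel) = (\<integral>\<^sup>+x. u x \<partial>lborel)"
proof -
  have [measurable]: "f \<in> borel_measurable borel" "D \<in> borel_measurable borel" and pos: "\<And>x. 0 < D x"
    and cv: "\<And>u. u \<in> borel_measurable borel \<Longrightarrow> (\<integral>\<^sup>+x. u (f x) * ennreal (D x) \<partial>lborel) = (\<integral>\<^sup>+x. u x \<partial>lborel)"
    using assms by (auto simp: lebesgue_jacobian_def)
  have [measurable]: "(f ^^ i) \<in> borel_measurable borel" for i
    by (rule measurable_funpow) simp
  show w[measurable]: "orbit_weight f D n \<in> borel_measurable borel" for n
    unfolding orbit_weight_def[abs_def] by measurable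
  show wpos: "0 < orbit_weight f D n x" for n x
    unfolding orbit_weight_def using pos by (intro prod_pos) auto
  show "u \<in> borel_measurable borel \<Longrightarrow>
      (\<integral>\<^sup>+x. u ((f ^^ n) x) * ennreal (orbit_weight f D n x) \<partial>lborel) = (\<integral>\<^sup>+x. u x \<partial>lborel)"
  proof (induction n)
    case 0 then show ?case by (simp add: orbit_weight_def)
  next
    case (Suc n)
    note [measurable] = Suc.prems
    have "orbit_weight f D (Suc n) x = orbit_weight f D n (f x) * D x" for x
      unfolding orbit_weight_def prod.lessThan_Suc_shift by (simp add: funpow_swap1 mult.commute)
    then have "(\<integral>\<^sup>+x. u ((f ^^ Suc n) x) * ennreal (orbit_weight f D (Suc n) x) \<partial>lborel) =
       (\<integral>\<^sup>+x. (u ((f ^^ n) (f x)) * ennreal (orbit_weight f D n (f x))) * ennreal (D x) \<partial>lborel)"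
      using wpos pos by (intro nn_integral_cong) (simp add: funpow_swap1 ennreal_mult' mult.assoc less_imp_le)
    also have "\<dots> = (\<integral>\<^sup>+x. u ((f ^^ n) x) * ennreal (orbit_weight f D n x) \<partial>lborel)"
      by (rule cv) measurable
    finally show ?case using Suc by simp
  qed
qed

lemma ln_orbit_weight:
  "(\<And>x. 0 < D x) \<Longrightarrow> ln (orbit_weight f D n x) = (\<Sum>i<n. ln (D ((f ^^ i) x)))"
  unfolding orbit_weight_def by (rule ln_prod) (auto, metis less_irrefl)

text \<open>The oscillation of ln D over the images of [x0, x1] is bounded by the increments of B
  over them, and their sum is C V + 5 V by \<open>koksma\<close>, whether or not the images overlap.
  Fewer than q steps only shorten a sum of nonnegative terms.\<close>

lemma orbit_weight_distortion:
  assumes f: "mono f" and h: "semiconj \<alpha> f h" and nr: "near_rational \<alpha> q p" and n: "n \<le> q"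
    and pos: "\<And>x. 0 < D x" and B: "equivariant V B"
    and var: "\<And>x y. x \<le> y \<Longrightarrow> \<bar>ln (D x) - ln (D y)\<bar> \<le> B y - B x"
    and x: "x0 \<le> x" "x \<le> x1" and t: "q * (h x1 - h x0) \<le> C"
  shows "\<bar>ln (orbit_weight f D n x) - ln (orbit_weight f D n x0)\<bar> \<le> (C + 5) * V"
proof -
  have fi: "mono (f ^^ i)" for i using f by (induction i) (auto simp: mono_def)
  have le: "(f ^^ i) x0 \<le> (f ^^ i) x" "(f ^^ i) x \<le> (f ^^ i) x1" for i
    using monoD[OF fi x(1)] monoD[OF fi x(2)] .
  have Bm: "B ((f ^^ i) x0) \<le> B ((f ^^ i) x)" "B ((f ^^ i) x) \<le> B ((f ^^ i) x1)" for i
    using le equivariant_mono[OF B] by auto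
  have "\<bar>ln (orbit_weight f D n x) - ln (orbit_weight f D n x0)\<bar> =
      \<bar>\<Sum>i<n. ln (D ((f ^^ i) x)) - ln (D ((f ^^ i) x0))\<bar>"
    using pos by (simp add: ln_orbit_weight sum_subtractf)
  also have "\<dots> \<le> (\<Sum>i<n. B ((f ^^ i) x1) - B ((f ^^ i) x0))"
  proof (rule order_trans[OF sum_abs], rule sum_mono)
    fix i
    show "\<bar>ln (D ((f ^^ i) x)) - ln (D ((f ^^ i) x0))\<bar> \<le> B ((f ^^ i) x1) - B ((f ^^ i) x0)"
      using var[OF le(1)[of i]] Bm[of i] by linarith
  qed
  also have "\<dots> \<le> (\<Sum>i<q. B ((f ^^ i) x1) - B ((f ^^ i) x0))"
    using n Bm by (intro sum_mono2) (auto intro: order_trans)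
  also have "\<dots> \<le> q * V * (h x1 - h x0) + 5 * V"
    using koksma[OF B h nr, of x1 x0] by (simp add: sum_subtractf)
  also have "\<dots> = V * (q * (h x1 - h x0)) + 5 * V" by simp
  also have "\<dots> \<le> V * C + 5 * V" using t equivariant_nonneg[OF B] by (simp add: mult_left_mono)
  finally show ?thesis by (simp add: algebra_simps)
qed

lemma restricted_cdf:
  fixes E :: "real set"
  assumes E: "E \<in> sets borel" and per: "\<And>x. x + 1 \<in> E \<longleftrightarrow> x \<in> E"
  obtains W where "equivariant (measure lborel (E \<inter> {0..<1})) W"
    "\<And>a b. a \<le> b \<Longrightarrow> measure lborel (E \<inter> {a..<b}) = W b - W a"
proof -
  define N where "N = density lborel (indicator E)"
  have N: "sets N = sets borel" by (simp add: N_def)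
  have em: "emeasure N {a..<b} = emeasure lborel (E \<inter> {a..<b})" for a b
    unfolding N_def using E by (subst emeasure_restricted) auto
  have fin: "emeasure N {a..<b} \<noteq> \<infinity>" for a b
  proof -
    have "emeasure lborel (E \<inter> {a..<b}) \<le> emeasure lborel {a..<max a b}"
      by (intro emeasure_mono) auto
    also have "\<dots> < \<infinity>" by simp
    finally show ?thesis unfolding em by simp
  qed
  have m: "measure N {a..<b} = measure lborel (E \<inter> {a..<b})" for a b
    by (simp add: measure_def em)
  have "measure N {a + 1..<b + 1} = measure N {a..<b}" for a b
  proof -
    have "emeasure lborel (E \<inter> {a + 1..<b + 1}) = emeasure lborel {x. x + 1 \<in> E \<inter> {a + 1..<b + 1}}"
      using E by (intro lborel_translate[symmetric]) auto
    also have "{x. x + 1 \<in> E \<inter> {a + 1..<b + 1}} = E \<inter> {a..<b}" using per by auto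
    finally show ?thesis unfolding m by (simp add: measure_def)
  qed
  from equivariant_signed_cdf[OF N fin this] signed_cdf[OF N fin] show ?thesis
    unfolding m by (rule that)
qed

text \<open>Takes the place of the Lebesgue density theorem: as \<open>h\<close> is injective off \<open>E\<close>, the cells of
  \<open>h\<close>-length \<open>c/q\<close> that meet a compact set \<open>K \<subseteq> - E\<close> shrink to \<open>K\<close>.\<close>

lemma dense_cell:
  assumes h: "equivariant 1 h" "continuous_on UNIV h" and E: "E \<in> sets borel"
    and per: "\<And>x. x + 1 \<in> E \<longleftrightarrow> x \<in> E"
    and plat: "\<And>x y. x \<notin> E \<Longrightarrow> h x = h y \<Longrightarrow> x = y" and pos: "emeasure lborel (- E) \<noteq> 0" and \<epsilon>: "0 < \<epsilon>"
    and c: "0 < c"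
  obtains Q :: nat where "\<And>q. Q < q \<Longrightarrow> \<exists>x0 x1. x0 < x1 \<and> h x1 - h x0 = c / q \<and>
    measure lborel (E \<inter> {x0..<x1}) \<le> \<epsilon> * (x1 - x0)"
proof -
  define g where "g = section_of h"
  note g = section_of[OF h, folded g_def]
  have less: "x < y" if "h x < h y" for x y
    using that equivariant_mono[OF h(1), of y x] by linarith
  have "emeasure lborel (- E \<inter> {0..<1}) \<noteq> 0"
    using periodic_null[of "- E"] E per pos by auto
  \<comment> \<open>Lebesgue measure is cut down to one period because inner regularity is applied
    to a finite measure.\<close>
  moreover define M where "M = density lborel (indicator {0..<1::real})"
  have M: "emeasure M A = emeasure lborel ({0..<1} \<inter> A)" if "A \<in> sets borel" for A
    unfolding M_def using that by (subst emeasure_restricted) auto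
  ultimately have "emeasure M (- E) \<noteq> 0" using E by (simp add: Int_commute)
  moreover have "emeasure M (- E) = (SUP K\<in>{K. K \<subseteq> - E \<and> compact K}. emeasure M K)"
  proof (rule inner_regular)
    have "emeasure M (space M) = 1" using M[of UNIV] by (simp add: M_def)
    then show "emeasure M (space M) \<noteq> \<infinity>" by simp
  qed (use E in \<open>auto simp: M_def\<close>)
  ultimately obtain K' where K': "K' \<subseteq> - E" "compact K'" "emeasure M K' \<noteq> 0"
    by (metis (no_types, lifting) SUP_bot_conv(2) bot_ennreal mem_Collect_eq)
  define K where "K = K' \<inter> {0..1}"
  have K: "compact K" "K \<subseteq> - E" "K \<subseteq> {0..1}"
    using K' by (auto simp: K_def compact_Int_closed)
  have KB: "K \<in> sets borel" using K(1) by (rule borel_compact)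
  have "emeasure M K' \<le> emeasure lborel K"
    using M[of K'] K'(2) KB by (auto simp: K_def borel_compact intro!: emeasure_mono)
  then have Kne0: "emeasure lborel K \<noteq> 0" using K'(3) by (metis le_zero_eq)
  have "emeasure lborel K \<le> emeasure lborel {0..1::real}" using K by (intro emeasure_mono) auto
  then have Kfin: "emeasure lborel K < \<infinity>" by (auto intro: le_less_trans)
  then have Kpos: "0 < measure lborel K"
    using Kne0 by (simp add: measure_def enn2real_positive_iff top.not_eq_extremum zero_less_iff_neq_zero)
  have hK: "compact (h ` K)" using K(1) h(2) continuous_on_subset by (blast intro: compact_continuous_image)
  have Kne: "h ` K \<noteq> {}" using Kpos by auto
  \<comment> \<open>Neighbourhoods of K in h-distance; they shrink to K because h is injective at
    the points of K. A cell of h-length below 1 that meets K, a subset of [0, 1], stays inside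
    [-2, 3], and this bounded window keeps the measures finite.\<close>
  define C where "C m = {x \<in> {-2..3}. infdist (h x) (h ` K) \<le> c / real (Suc m)}" for m
  have hm[measurable]: "h \<in> borel_measurable borel" using h(2) by (rule borel_measurable_continuous_onI)
  have CB: "C m \<in> sets borel" for m
  proof -
    have "closed {x. infdist (h x) (h ` K) \<le> c / real (Suc m)}"
      using h(2) by (intro closed_Collect_le continuous_intros)
    then have "closed ({-2..3} \<inter> {x. infdist (h x) (h ` K) \<le> c / real (Suc m)})" by auto
    moreover have "C m = {-2..3} \<inter> {x. infdist (h x) (h ` K) \<le> c / real (Suc m)}" by (auto simp: C_def)
    ultimately show ?thesis by (metis borel_closed)
  qed
  have Cfin: "emeasure lborel (C m) < \<infinity>" for m
  proof -
    have "emeasure lborel (C m) \<le> emeasure lborel {-2..3::real}" using CB by (intro emeasure_mono) (auto simp: C_def)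
    then show ?thesis by (auto intro: le_less_trans)
  qed
  have Cint: "(\<Inter>m. C m) = K"
  proof (rule antisym; rule subsetI)
    fix x assume x: "x \<in> (\<Inter>m. C m)"
    have "infdist (h x) (h ` K) \<le> 0"
    proof (rule LIMSEQ_le_const)
      show "(\<lambda>m. c / real (Suc m)) \<longlonglongrightarrow> 0"
        using tendsto_mult_right_zero[OF LIMSEQ_inverse_real_of_nat, of c] by (simp add: divide_inverse)
      show "\<exists>N. \<forall>n\<ge>N. infdist (h x) (h ` K) \<le> c / real (Suc n)" using x by (auto simp: C_def)
    qed
    then have "infdist (h x) (h ` K) = 0" using infdist_nonneg[of "h x" "h ` K"] by linarith
    then have "h x \<in> h ` K" using in_closed_iff_infdist_zero[OF compact_imp_closed[OF hK] Kne] by simp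
    then obtain k where "k \<in> K" "h k = h x" by auto
    then show "x \<in> K" using plat[of k x] K(2) by auto
  next
    fix x assume x: "x \<in> K"
    then have "infdist (h x) (h ` K) = 0" by simp
    then show "x \<in> (\<Inter>m. C m)" using x K(3) c by (auto simp: C_def)
  qed
  have Cdec: "decseq C"
  proof (rule decseq_SucI, rule subsetI)
    fix n x assume x: "x \<in> C (Suc n)"
    have "c / real (Suc (Suc n)) \<le> c / real (Suc n)" using c by (intro divide_left_mono) auto
    then show "x \<in> C n" using x by (auto simp: C_def)
  qed
  have "(\<lambda>m. measure lborel (C m)) \<longlonglongrightarrow> measure lborel (\<Inter>m. C m)"
    using CB Cfin Cdec by (intro Lim_measure_decseq) (auto simp: less_top[symmetric])
  then have "(\<lambda>m. measure lborel (C m)) \<longlonglongrightarrow> measure lborel K" by (simp only: Cint)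
  moreover have "measure lborel K < measure lborel K + \<epsilon> * measure lborel K" using \<epsilon> Kpos by simp
  ultimately have "eventually (\<lambda>m. measure lborel (C m) < measure lborel K + \<epsilon> * measure lborel K) sequentially"
    by (rule order_tendstoD(2))
  then obtain m0 where m0: "\<And>m. m0 \<le> m \<Longrightarrow> measure lborel (C m) < measure lborel K + \<epsilon> * measure lborel K"
    by (auto simp: eventually_sequentially)
  obtain m1 :: nat where m1: "c < m1" using reals_Archimedean2 by blast
  show ?thesis
  proof (rule that[of "m0 + m1"])
    fix q :: nat assume q: "m0 + m1 < q"
    define t where "t j = c * of_int j / q" for j :: int
    have q0: "0 < real q" "c / q < 1" using q m1 by auto
    have t1: "t (j + 1) = t j + c / q" for j by (simp add: t_def add_divide_distrib algebra_simps)
    have tmono: "t i \<le> t j" if "i \<le> j" for i j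
      using that c q0 by (auto simp: t_def intro!: divide_right_mono mult_left_mono)
    define I where "I j = {g (t j)..<g (t (j + 1))}" for j
    have gt: "g (t j) < g (t (j + 1))" for j using g(3)[of "t j" "t (j + 1)"] c q0 by (simp add: t1)
    have gmono: "g (t i) \<le> g (t j)" if "i \<le> j" for i j
      using equivariant_mono[OF g(4) tmono[OF that]] .
    define J where "J = (\<lambda>x. \<lfloor>q * h x / c\<rfloor>) ` K"
    obtain l where l: "\<And>x. x \<in> K \<Longrightarrow> \<bar>h x\<bar> \<le> l" using compact_imp_bounded[OF hK] unfolding bounded_real by auto
    have "J \<subseteq> {\<lfloor>q * - l / c\<rfloor>..\<lfloor>q * l / c\<rfloor>}"
    proof
      fix j assume "j \<in> J"
      then obtain x where x: "x \<in> K" "j = \<lfloor>q * h x / c\<rfloor>" by (auto simp: J_def)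
      have "- l \<le> h x" "h x \<le> l" using l[OF x(1)] by auto
      then have "q * - l \<le> q * h x" "q * h x \<le> q * l"
        using q0(1) by (auto simp only: mult_left_mono less_imp_le)
      then have "\<lfloor>q * - l / c\<rfloor> \<le> \<lfloor>q * h x / c\<rfloor>" "\<lfloor>q * h x / c\<rfloor> \<le> \<lfloor>q * l / c\<rfloor>"
        using c by (auto simp only: floor_mono divide_right_mono less_imp_le)
      then show "j \<in> {\<lfloor>q * - l / c\<rfloor>..\<lfloor>q * l / c\<rfloor>}" using x(2) by (simp only: atLeastAtMost_iff)
    qed
    then have fin: "finite J" using finite_subset by blast
    \<comment> \<open>The delicate case is a grid value h x = t j: injectivity of h at x then
      identifies x with the chosen preimage g (t j).\<close>
    have xI: "x \<in> I \<lfloor>q * h x / c\<rfloor>" if x: "x \<in> K" for x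
    proof -
      define j where "j = \<lfloor>q * h x / c\<rfloor>"
      have "j \<le> q * h x / c" "q * h x / c < j + 1" unfolding j_def by linarith+
      then have j: "t j \<le> h x" "h x < t (j + 1)" using c q0 by (auto simp: t_def field_simps)
      have "g (t j) \<le> x"
      proof (cases "t j = h x")
        case True then show ?thesis using plat[of x "g (t j)"] x K(2) g(1) by auto
      next
        case False then have "h (g (t j)) < h x" using j g(1) by simp
        then show ?thesis using less by fastforce
      qed
      moreover have "x < g (t (j + 1))" by (rule less) (use j g(1) in simp)
      ultimately show ?thesis unfolding I_def j_def by simp
    qed
    define U where "U = (\<Union>j\<in>J. I j)"
    have KU: "K \<subseteq> U" using xI by (auto simp: U_def J_def)
    have UC: "U \<subseteq> C m0"
    proof
      fix y assume "y \<in> U"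
      then obtain x where x: "x \<in> K" "y \<in> I \<lfloor>q * h x / c\<rfloor>" by (auto simp: U_def J_def)
      define j where "j = \<lfloor>q * h x / c\<rfloor>"
      have "t j \<le> h z \<and> h z \<le> t j + c / q" if "z \<in> I j" for z
        using that equivariant_mono[OF h(1), of "g (t j)" z] equivariant_mono[OF h(1), of z "g (t (j + 1))"]
        by (auto simp: I_def g(1) t1)
      from this[of x] this[of y] have d: "\<bar>h y - h x\<bar> \<le> c / q" using xI[OF x(1)] x(2) by (auto simp: j_def)
      have hx: "h (x + 2) = h x + 2" "h (x - 2) = h x - 2"
        using equivariant_int[OF h(1), of x 2] equivariant_int[OF h(1), of x "- 2"] by auto
      have "h (x - 2) < h y" "h y < h (x + 2)" using d q0(2) hx by linarith+
      then have "x - 2 < y" "y < x + 2" using less by blast+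
      then have "y \<in> {-2..3}" using x(1) K(3) by auto
      moreover have "infdist (h y) (h ` K) \<le> dist (h y) (h x)" using x(1) by (intro infdist_le) auto
      moreover have "c / q \<le> c / real (Suc m0)" using q c by (intro divide_left_mono) auto
      ultimately show "y \<in> C m0" using d by (auto simp: C_def dist_real_def)
    qed
    \<comment> \<open>Pigeonhole: otherwise E would fill at least the fraction \<epsilon> of U,
      hence at least \<epsilon> |K|; but E misses K, and what U has outside K measures less than
      \<epsilon> |K|.\<close>
    have "\<exists>j\<in>J. measure lborel (E \<inter> I j) \<le> \<epsilon> * (g (t (j + 1)) - g (t j))"
    proof (rule ccontr)
      assume "\<not> ?thesis"
      then have big: "\<epsilon> * (g (t (j + 1)) - g (t j)) \<le> measure lborel (E \<inter> I j)" if "j \<in> J" for j using that by force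
      have Idis: "I i \<inter> I j = {}" if "i \<noteq> j" for i j
        using gmono[of "i + 1" j] gmono[of "j + 1" i] that by (cases "i < j") (auto simp: I_def)
      have fin1: "emeasure lborel (A \<inter> I j) \<noteq> \<infinity>" for A j
      proof -
        have "emeasure lborel (A \<inter> I j) \<le> emeasure lborel (I j)" by (intro emeasure_mono) (auto simp: I_def)
        also have "\<dots> < \<infinity>" using gt[of j] by (simp add: I_def)
        finally show ?thesis by simp
      qed
      have un: "measure lborel (A \<inter> U) = (\<Sum>j\<in>J. measure lborel (A \<inter> I j))" if "A \<in> sets borel" for A
      proof -
        have "A \<inter> U = (\<Union>j\<in>J. A \<inter> I j)" by (auto simp: U_def)
        moreover have "disjoint_family_on (\<lambda>j. A \<inter> I j) J" using Idis by (auto simp: disjoint_family_on_def)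
        ultimately show ?thesis using that fin fin1
          by (simp only:) (intro measure_finite_Union, auto simp: I_def)
      qed
      have UB: "U \<in> sets borel" unfolding U_def using fin by (auto simp: I_def)
      have mfin: "A \<in> fmeasurable lborel" if "A \<in> sets borel" "A \<subseteq> C m0" for A
        using that Cfin[of m0] CB[of m0] emeasure_mono[of A "C m0" lborel] by (auto intro!: fmeasurableI intro: le_less_trans)
      have "\<epsilon> * measure lborel K \<le> \<epsilon> * measure lborel U"
        using \<epsilon> KU KB mfin[OF UB UC] by (intro mult_left_mono measure_mono_fmeasurable) auto
      also have "measure lborel U = (\<Sum>j\<in>J. g (t (j + 1)) - g (t j))"
        using un[of UNIV] gt by (simp add: I_def less_imp_le)
      also have "\<epsilon> * (\<Sum>j\<in>J. g (t (j + 1)) - g (t j)) \<le> (\<Sum>j\<in>J. measure lborel (E \<inter> I j))"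
        unfolding sum_distrib_left by (rule sum_mono) (rule big)
      also have "\<dots> = measure lborel (E \<inter> U)" using un[OF E] by simp
      also have "\<dots> \<le> measure lborel (C m0 - K)"
        using UC K(2) E UB CB KB by (intro measure_mono_fmeasurable mfin) auto
      also have "\<dots> = measure lborel (C m0) - measure lborel K"
        using KU UC mfin[OF CB] KB by (intro measurable_measure_Diff) auto
      also have "\<dots> < \<epsilon> * measure lborel K" using m0[of m0] by simp
      finally show False by simp
    qed
    then obtain j where j: "measure lborel (E \<inter> {g (t j)..<g (t (j + 1))}) \<le> \<epsilon> * (g (t (j + 1)) - g (t j))"
      unfolding I_def by blast
    show "\<exists>x0 x1. x0 < x1 \<and> h x1 - h x0 = c / q \<and> measure lborel (E \<inter> {x0..<x1}) \<le> \<epsilon> * (x1 - x0)"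
      by (intro exI[of _ "g (t j)"] exI[of _ "g (t (j + 1))"] conjI gt j) (simp add: g(1) t1)
  qed
qed

text \<open>Koksma's inequality for \<open>x \<mapsto> |E \<inter> [0,x]|\<close> replaces the covering of the circle by the images of a cell.\<close>

theorem invariant_set_null:
  assumes f: "equivariant 1 f" "strict_mono f" and h: "semiconj \<alpha> f h" and irr: "\<alpha> \<notin> \<rat>"
    and D: "lebesgue_jacobian f D" and B: "equivariant V B"
    and var: "\<And>x y. x \<le> y \<Longrightarrow> \<bar>ln (D x) - ln (D y)\<bar> \<le> B y - B x"
    and E: "E \<in> sets borel" and per: "\<And>x. x + 1 \<in> E \<longleftrightarrow> x \<in> E" and inv: "\<And>x. f x \<in> E \<longleftrightarrow> x \<in> E"
    and plat: "\<And>x y. x \<notin> E \<Longrightarrow> h x = h y \<Longrightarrow> x = y" and pos: "emeasure lborel (- E) \<noteq> 0"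
  shows "emeasure lborel E = 0"
proof -
  have h': "equivariant 1 h" "continuous_on UNIV h" using h by (auto simp: semiconj_def)
  define e where "e = measure lborel (E \<inter> {0..<1})"
  obtain W where W: "equivariant e W" "\<And>a b. a \<le> b \<Longrightarrow> measure lborel (E \<inter> {a..<b}) = W b - W a"
    unfolding e_def using restricted_cdf[OF E per] by metis
  \<comment> \<open>The distortion bound (C + 5) V for a cell of h-length 6/q, that is, C =
    6.\<close>
  define \<kappa> where "\<kappa> = exp (11 * V)"
  have \<kappa>: "0 < \<kappa>" by (simp add: \<kappa>_def)
  have Dpos: "0 < D x" for x using D by (simp add: lebesgue_jacobian_def)
  \<comment> \<open>With h-length 6/q the images of the cell carry E-measure at least 6 e - 5 e = e,
    while their total length is at most 6 + 5 = 11. The factor \<kappa> appears twice: the weight is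
    compared with its value at x0 from above on E and from below on the whole cell.\<close>
  have bound: "e \<le> 11 * (\<kappa> * \<kappa> * \<epsilon>)" if \<epsilon>: "0 < \<epsilon>" for \<epsilon>
  proof -
    obtain Q :: nat where Q: "\<And>q. Q < q \<Longrightarrow> \<exists>x0 x1. x0 < x1 \<and> h x1 - h x0 = 6 / q \<and>
        measure lborel (E \<inter> {x0..<x1}) \<le> \<epsilon> * (x1 - x0)"
      using dense_cell[OF h' E per plat pos \<epsilon>, of 6] by auto
    obtain q p where nr: "near_rational \<alpha> q p" "Q < q" using near_rational_exists[OF irr] .
    then have q: "0 < q" by (simp add: near_rational_def)
    obtain x0 x1 where x: "x0 < x1" "h x1 - h x0 = 6 / q" "measure lborel (E \<inter> {x0..<x1}) \<le> \<epsilon> * (x1 - x0)"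
      using Q[OF nr(2)] by blast
    have hq: "q * (h x1 - h x0) = 6" using x(2) q by simp
    have step: "measure lborel (E \<inter> {(f ^^ n) x0..<(f ^^ n) x1}) \<le> \<kappa> * \<kappa> * \<epsilon> * ((f ^^ n) x1 - (f ^^ n) x0)"
      if n: "n < q" for n
    proof -
      let ?w = "orbit_weight f D n"
      have fn: "strict_mono (f ^^ n)" using f(2) by (induction n) (auto simp: strict_mono_def)
      note [measurable] = orbit_weight(1)[OF D]
      have wpos: "0 < ?w x" for x by (rule orbit_weight(2)[OF D])
      define b where "b = ?w x0"
      have b: "0 < b" using wpos by (simp add: b_def)
      have w: "b / \<kappa> \<le> ?w x" "?w x \<le> \<kappa> * b" if "x \<in> {x0..<x1}" for x
      proof -
        have "\<bar>ln (?w x) - ln b\<bar> \<le> (6 + 5) * V"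
          unfolding b_def using that hq n f(2)
          by (intro orbit_weight_distortion[OF _ h nr(1) _ Dpos B var, where ?x1.0 = x1]) (auto simp: strict_mono_mono)
        then have "ln b - 11 * V \<le> ln (?w x)" "ln (?w x) \<le> 11 * V + ln b" by auto
        then have "exp (ln b - 11 * V) \<le> exp (ln (?w x))" "exp (ln (?w x)) \<le> exp (11 * V + ln b)" by auto
        then show "b / \<kappa> \<le> ?w x" "?w x \<le> \<kappa> * b" using b wpos[of x] by (simp_all add: exp_diff exp_add \<kappa>_def)
      qed
      have invn: "(f ^^ n) x \<in> E \<longleftrightarrow> x \<in> E" for x by (induction n) (auto simp: inv)
      have ord: "(f ^^ n) x \<in> {(f ^^ n) x0..<(f ^^ n) x1} \<longleftrightarrow> x \<in> {x0..<x1}" for x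
        using strict_mono_less[OF fn] strict_mono_less_eq[OF fn] by auto
      have cv: "emeasure lborel A = (\<integral>\<^sup>+x. indicator A ((f ^^ n) x) * ennreal (?w x) \<partial>lborel)"
        if "A \<in> sets borel" for A
        using orbit_weight(3)[OF D, of "indicator A" n] that by simp
      have 1: "emeasure lborel (E \<inter> {(f ^^ n) x0..<(f ^^ n) x1}) \<le> ennreal (\<kappa> * b * (\<epsilon> * (x1 - x0)))"
      proof -
        have "emeasure lborel (E \<inter> {(f ^^ n) x0..<(f ^^ n) x1}) =
            (\<integral>\<^sup>+x. indicator (E \<inter> {x0..<x1}) x * ennreal (?w x) \<partial>lborel)"
          using E by (subst cv) (auto intro!: nn_integral_cong simp: indicator_def invn ord simp del: atLeastLessThan_iff)
        also have "\<dots> \<le> (\<integral>\<^sup>+x. ennreal (\<kappa> * b) * indicator (E \<inter> {x0..<x1}) x \<partial>lborel)"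
          using w(2) by (intro nn_integral_mono) (auto simp: indicator_def intro!: ennreal_leI)
        also have "\<dots> = ennreal (\<kappa> * b) * emeasure lborel (E \<inter> {x0..<x1})"
          using E by (subst nn_integral_cmult_indicator) auto
        also have "emeasure lborel (E \<inter> {x0..<x1}) = ennreal (measure lborel (E \<inter> {x0..<x1}))"
        proof (rule emeasure_eq_ennreal_measure)
          have "emeasure lborel (E \<inter> {x0..<x1}) \<le> emeasure lborel {x0..<x1}" by (intro emeasure_mono) auto
          then show "emeasure lborel (E \<inter> {x0..<x1}) \<noteq> top" using x(1) by (auto simp: top_unique)
        qed
        also have "ennreal (\<kappa> * b) * \<dots> \<le> ennreal (\<kappa> * b) * ennreal (\<epsilon> * (x1 - x0))"
          using x(3) by (intro mult_left_mono ennreal_leI) auto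
        also have "\<dots> = ennreal (\<kappa> * b * (\<epsilon> * (x1 - x0)))"
          using \<kappa> b by (simp add: ennreal_mult')
        finally show ?thesis .
      qed
      have 2: "b / \<kappa> * (x1 - x0) \<le> (f ^^ n) x1 - (f ^^ n) x0"
      proof -
        have lt: "(f ^^ n) x0 < (f ^^ n) x1" using x(1) strict_mono_less[OF fn] by simp
        have "ennreal (b / \<kappa> * (x1 - x0)) = ennreal (b / \<kappa>) * emeasure lborel {x0..<x1}"
          using x(1) b \<kappa> by (simp add: ennreal_mult[symmetric])
        also have "\<dots> = (\<integral>\<^sup>+x. ennreal (b / \<kappa>) * indicator {x0..<x1} x \<partial>lborel)"
          by (subst nn_integral_cmult_indicator) auto
        also have "\<dots> \<le> (\<integral>\<^sup>+x. indicator {(f ^^ n) x0..<(f ^^ n) x1} ((f ^^ n) x) * ennreal (?w x) \<partial>lborel)"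
          using w(1) by (intro nn_integral_mono) (auto simp: indicator_def ord intro!: ennreal_leI simp del: atLeastLessThan_iff)
        also have "\<dots> = ennreal ((f ^^ n) x1 - (f ^^ n) x0)"
          using cv[of "{(f ^^ n) x0..<(f ^^ n) x1}"] lt by simp
        finally show ?thesis using lt by simp
      qed
      have "measure lborel (E \<inter> {(f ^^ n) x0..<(f ^^ n) x1}) \<le> \<kappa> * b * (\<epsilon> * (x1 - x0))"
        unfolding measure_def using 1 \<kappa> b \<epsilon> x(1) by (intro enn2real_leI) auto
      also have "\<dots> = \<kappa> * \<kappa> * \<epsilon> * (b / \<kappa> * (x1 - x0))" using \<kappa> by simp
      also have "\<dots> \<le> \<kappa> * \<kappa> * \<epsilon> * ((f ^^ n) x1 - (f ^^ n) x0)"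
        using 2 \<kappa> \<epsilon> by (intro mult_left_mono) auto
      finally show ?thesis .
    qed
    have mf: "(f ^^ i) x0 \<le> (f ^^ i) x1" for i
      using equivariant_mono[OF equivariant_iter[OF f(1)]] x(1) by simp
    have "q * e * (h x1 - h x0) = 6 * e" using x(2) q by simp
    then have "e \<le> (\<Sum>i<q. W ((f ^^ i) x1)) - (\<Sum>i<q. W ((f ^^ i) x0))"
      using koksma[OF W(1) h nr(1), of x1 x0] by linarith
    also have "\<dots> = (\<Sum>i<q. measure lborel (E \<inter> {(f ^^ i) x0..<(f ^^ i) x1}))"
      unfolding sum_subtractf[symmetric] by (intro sum.cong refl W(2)[symmetric] mf)
    also have "\<dots> \<le> (\<Sum>i<q. \<kappa> * \<kappa> * \<epsilon> * ((f ^^ i) x1 - (f ^^ i) x0))"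
      by (intro sum_mono step) simp
    also have "\<dots> = \<kappa> * \<kappa> * \<epsilon> * ((\<Sum>i<q. (f ^^ i) x1) - (\<Sum>i<q. (f ^^ i) x0))"
      by (simp add: sum_distrib_left sum_subtractf right_diff_distrib)
    also have "\<dots> \<le> \<kappa> * \<kappa> * \<epsilon> * 11"
    proof (rule mult_left_mono)
      have "equivariant 1 (\<lambda>x. x)" by (simp add: equivariant_def mono_def)
      then show "(\<Sum>i<q. (f ^^ i) x1) - (\<Sum>i<q. (f ^^ i) x0) \<le> 11"
        using koksma[OF _ h nr(1), of 1 "\<lambda>x. x" x1 x0] hq by simp
    qed (use \<kappa> \<epsilon> in simp)
    finally show ?thesis by simp
  qed
  have "e \<le> 0"
  proof (rule field_le_epsilon)
    fix d :: real assume "0 < d"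
    then show "e \<le> 0 + d" using bound[of "d / (11 * (\<kappa> * \<kappa>))"] \<kappa> by simp
  qed
  then have e0: "measure lborel (E \<inter> {0..<1}) = 0" unfolding e_def by (simp add: measure_le_0_iff)
  have "emeasure lborel (E \<inter> {0..<1}) \<le> emeasure lborel {0..<1::real}" by (intro emeasure_mono) auto
  then have "emeasure lborel (E \<inter> {0..<1}) \<noteq> \<infinity>" by (auto simp: top_unique)
  then have "emeasure lborel (E \<inter> {0..<1}) = 0"
    using e0 by (simp add: emeasure_eq_ennreal_measure)
  then show ?thesis by (rule periodic_null[OF E per])
qed

section \<open>Periodic integrable functions\<close>

definition periodic_integrable :: "(real \<Rightarrow> real) \<Rightarrow> bool" where
  "periodic_integrable r \<longleftrightarrow> r \<in> borel_measurable borel \<and> (\<forall>x. r (x + 1) = r x) \<and>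
     integrable lborel (\<lambda>t. indicator {0..<1} t * r t)"

definition mean :: "(real \<Rightarrow> real) \<Rightarrow> real" where
  "mean r = (\<integral>t. indicator {0..<1} t * r t \<partial>lborel)"

lemma nn_integral_translate:
  "u \<in> borel_measurable borel \<Longrightarrow> (\<integral>\<^sup>+x. u (x + c) \<partial>lborel) = (\<integral>\<^sup>+x. u (x::real) \<partial>lborel)"
  using nn_integral_real_affine[of u 1 c] by (simp add: add.commute[of _ c])

lemma nn_integral_periodic:
  fixes r :: "real \<Rightarrow> ennreal"
  assumes r: "r \<in> borel_measurable borel" and per: "\<And>x. r (x + 1) = r x"
  shows "(\<integral>\<^sup>+t. indicator {s..<s + 1} t * r t \<partial>lborel) = (\<integral>\<^sup>+t. indicator {0..<1} t * r t \<partial>lborel)"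
proof -
  define N where "N = density lborel r"
  have N: "sets N = sets borel" by (simp add: N_def)
  have em: "emeasure N A = (\<integral>\<^sup>+t. indicator A t * r t \<partial>lborel)" if "A \<in> sets borel" for A
    using r that by (simp add: N_def emeasure_density mult.commute)
  have perk: "r (x + of_int k) = r x" for x and k :: int
    using periodic_int[of "{y. r y = r x}" x k] by (simp add: per)
  have "emeasure N {x. x + of_int k \<in> A} = emeasure N A" if A: "A \<in> sets borel" for A and k :: int
  proof -
    have "(\<lambda>x. x + of_int k) -` A \<inter> space borel \<in> sets borel"
      by (rule measurable_sets[OF _ A]) measurable
    then have "emeasure N {x. x + of_int k \<in> A} = (\<integral>\<^sup>+t. indicator A (t + of_int k) * r (t + of_int k) \<partial>lborel)"
      by (subst em) (auto simp: vimage_def perk indicator_def intro!: nn_integral_cong)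
    also have "\<dots> = emeasure N A"
      using nn_integral_translate[of "\<lambda>t. indicator A t * r t" "of_int k"] r A em[OF A] by simp
    finally show ?thesis .
  qed
  then have "emeasure N (UNIV \<inter> {s..<s + 1}) = emeasure N (UNIV \<inter> {0..<1})"
    using N by (intro emeasure_periodic) auto
  then show ?thesis by (simp add: em)
qed

text \<open>Turns a nonnegative integrable function into a monotone function of mass
  \<open>mean r\<close>, so that \<open>koksma\<close> bounds its integrals over the intervals of an
  orbit.\<close>

lemma periodic_integrable_cdf:
  assumes r: "periodic_integrable r" and pos: "\<And>x. 0 \<le> r x"
  obtains W where "equivariant (mean r) W"
    "\<And>a b. a \<le> b \<Longrightarrow> (\<integral>t. indicator {a..<b} t * r t \<partial>lborel) = W b - W a"
    "\<And>a b. integrable lborel (\<lambda>t. indicator {a..<b} t * r t)"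
proof -
  have [measurable]: "r \<in> borel_measurable borel" and per: "\<And>x. r (x + 1) = r x"
    and int: "integrable lborel (\<lambda>t. indicator {0..<1} t * r t)"
    using r by (auto simp: periodic_integrable_def)
  define N where "N = density lborel (\<lambda>t. ennreal (r t))"
  have N: "sets N = sets borel" by (simp add: N_def)
  have em: "emeasure N {a..<b} = (\<integral>\<^sup>+t. indicator {a..<b} t * ennreal (r t) \<partial>lborel)" for a b
    by (simp add: N_def emeasure_density mult.commute)
  have one: "emeasure N {s..<s + 1} < \<infinity>" for s
  proof -
    have "emeasure N {s..<s + 1} = (\<integral>\<^sup>+t. indicator {0..<1} t * ennreal (r t) \<partial>lborel)"
      unfolding em by (rule nn_integral_periodic) (auto simp: per)
    also have "\<dots> = (\<integral>\<^sup>+t. ennreal (norm (indicator {0..<1} t * r t)) \<partial>lborel)"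
      using pos by (intro nn_integral_cong) (auto simp: indicator_def)
    also have "\<dots> < \<infinity>" using int by (simp add: integrable_iff_bounded)
    finally show ?thesis .
  qed
  have fin: "emeasure N {a..<b} \<noteq> \<infinity>" for a b
  proof -
    have "{a..<b} \<subseteq> (\<Union>k\<in>{\<lfloor>a\<rfloor>..\<lfloor>b\<rfloor>}. {of_int k..<of_int k + 1})"
    proof
      fix x assume "x \<in> {a..<b}"
      then have "\<lfloor>x\<rfloor> \<in> {\<lfloor>a\<rfloor>..\<lfloor>b\<rfloor>}" "x \<in> {of_int \<lfloor>x\<rfloor>..<of_int \<lfloor>x\<rfloor> + 1}"
        by (auto intro: floor_mono)
      then show "x \<in> (\<Union>k\<in>{\<lfloor>a\<rfloor>..\<lfloor>b\<rfloor>}. {of_int k..<of_int k + 1})" by blast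
    qed
    then have "emeasure N {a..<b} \<le> emeasure N (\<Union>k\<in>{\<lfloor>a\<rfloor>..\<lfloor>b\<rfloor>}. {of_int k..<of_int k + 1})"
      using N by (intro emeasure_mono) auto
    also have "\<dots> \<le> (\<Sum>k\<in>{\<lfloor>a\<rfloor>..\<lfloor>b\<rfloor>}. emeasure N {of_int k..<of_int k + 1})"
      by (rule emeasure_subadditive_finite) (auto simp: N)
    also have "\<dots> < \<infinity>" using one by (auto simp: less_top[symmetric])
    finally show ?thesis by simp
  qed
  have int': "integrable lborel (\<lambda>t. indicator {a..<b} t * r t)" for a b
  proof -
    have "(\<integral>\<^sup>+t. ennreal (norm (indicator {a..<b} t * r t)) \<partial>lborel) = emeasure N {a..<b}"
      unfolding em using pos by (intro nn_integral_cong) (auto simp: indicator_def)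
    then show ?thesis using fin[of a b] by (simp add: integrable_iff_bounded less_top[symmetric])
  qed
  have m: "measure N {a..<b} = (\<integral>t. indicator {a..<b} t * r t \<partial>lborel)" for a b
  proof -
    have "emeasure N {a..<b} = (\<integral>\<^sup>+t. ennreal (indicator {a..<b} t * r t) \<partial>lborel)"
      unfolding em by (intro nn_integral_cong) (auto simp: indicator_def)
    then show ?thesis using pos by (simp add: measure_def integral_eq_nn_integral)
  qed
  have "emeasure N {a + 1..<b + 1} = emeasure N {a..<b}" for a b
  proof -
    have "(\<integral>\<^sup>+t. indicator {a + 1..<b + 1} t * ennreal (r t) \<partial>lborel) =
        (\<integral>\<^sup>+t. indicator {a + 1..<b + 1} (t + 1) * ennreal (r (t + 1)) \<partial>lborel)"
      by (rule nn_integral_translate[symmetric]) measurable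
    also have "\<dots> = (\<integral>\<^sup>+t. indicator {a..<b} t * ennreal (r t) \<partial>lborel)"
      by (intro nn_integral_cong) (auto simp: indicator_def per)
    finally show ?thesis unfolding em .
  qed
  then have "measure N {a + 1..<b + 1} = measure N {a..<b}" for a b by (simp add: measure_def)
  from equivariant_signed_cdf[OF N fin this] signed_cdf[OF N fin] int' show ?thesis
    unfolding m mean_def[symmetric] by (rule that)
qed

lemma periodic_integrable_abs: "periodic_integrable r \<Longrightarrow> periodic_integrable (\<lambda>x. \<bar>r x\<bar>)"
proof -
  assume r: "periodic_integrable r"
  then have "integrable lborel (\<lambda>t. \<bar>indicator {0..<1} t * r t\<bar>)"
    by (intro integrable_abs) (auto simp: periodic_integrable_def)
  then have "integrable lborel (\<lambda>t. indicator {0..<1} t * \<bar>r t\<bar>)"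
    by (simp add: abs_mult)
  then show ?thesis using r by (auto simp: periodic_integrable_def)
qed

lemma periodic_integrable_diff:
  "periodic_integrable r \<Longrightarrow> periodic_integrable s \<Longrightarrow> periodic_integrable (\<lambda>x. r x - s x)"
  unfolding periodic_integrable_def right_diff_distrib
  by (intro conjI allI borel_measurable_diff Bochner_Integration.integrable_diff) simp_all

lemma periodic_integrable_interval:
  assumes r: "periodic_integrable r"
  shows "integrable lborel (\<lambda>t. indicator {a..<b} t * r t)"
proof -
  have int: "integrable lborel (\<lambda>t. indicator {a..<b} t * \<bar>r t\<bar>)"
    by (rule periodic_integrable_cdf[OF periodic_integrable_abs[OF r]]) auto
  have [measurable]: "r \<in> borel_measurable borel" using r by (simp add: periodic_integrable_def)
  show ?thesis
    by (rule Bochner_Integration.integrable_bound[OF int]) (auto simp: indicator_def abs_mult)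
qed

lemma periodic_mean_shift:
  assumes r: "periodic_integrable r"
  shows "integrable lborel (\<lambda>t. indicator {0..<1} t * r (t + s))"
    "(\<integral>t. indicator {0..<1} t * r (t + s) \<partial>lborel) = mean r"
proof -
  have [measurable]: "r \<in> borel_measurable borel" and per: "\<And>x. r (x + 1) = r x"
    using r by (auto simp: periodic_integrable_def)
  have e: "(\<lambda>t. indicator {0..<1} t * r (t + s)) = (\<lambda>t. indicator {s..<s + 1} (s + 1 * t) * r (s + 1 * t))"
    by (auto simp: indicator_def add.commute)
  have i: "integrable lborel (\<lambda>t. indicator {s..<s + 1} t * r t)"
    by (rule periodic_integrable_interval[OF r])
  show "integrable lborel (\<lambda>t. indicator {0..<1} t * r (t + s))"
    unfolding e using i by (rule lborel_integrable_real_affine) simp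
  have e1: "(\<integral>t. indicator {0..<1} t * r (t + s) \<partial>lborel) = (\<integral>t. indicator {s..<s + 1} t * r t \<partial>lborel)"
    unfolding e using lborel_integral_real_affine[of 1 "\<lambda>t. indicator {s..<s + 1} t * r t" s] by simp
  \<comment> \<open>Used with c the identity and with c the negation: \<open>ennreal\<close> sends
    negative values to 0, so these are the integrals of the positive and the negative part.\<close>
  have pn: "(\<integral>\<^sup>+t. ennreal (indicator {s..<s + 1} t * c (r t)) \<partial>lborel) =
      (\<integral>\<^sup>+t. ennreal (indicator {0..<1} t * c (r t)) \<partial>lborel)"
    if "c \<in> borel_measurable borel" for c :: "real \<Rightarrow> real" and s
  proof -
    note [measurable] = that
    have "ennreal (indicator A t * c (r t)) = indicator A t * ennreal (c (r t))" for A :: "real set" and t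
      by (auto simp: indicator_def)
    then show ?thesis by (simp only:) (rule nn_integral_periodic, auto simp: per)
  qed
  have "(\<integral>t. indicator {s..<s + 1} t * r t \<partial>lborel) = mean r"
    unfolding mean_def real_lebesgue_integral_def[OF i]
      real_lebesgue_integral_def[OF periodic_integrable_interval[OF r, of 0 1]]
    using pn[of "\<lambda>x. x" s] pn[of uminus s] by simp
  with e1 show "(\<integral>t. indicator {0..<1} t * r (t + s) \<partial>lborel) = mean r" by simp
qed

lemma integral_interval_shift:
  fixes r :: "real \<Rightarrow> real"
  shows "(\<integral>t. indicator {x + s..<y + s} t * r t \<partial>lborel) = (\<integral>t. indicator {x..<y} t * r (t + s) \<partial>lborel)"
proof -
  have "(\<integral>t. indicator {x + s..<y + s} t * r t \<partial>lborel) =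
      (\<integral>t. indicator {x + s..<y + s} (s + 1 * t) * r (s + 1 * t) \<partial>lborel)"
    using lborel_integral_real_affine[of 1 "\<lambda>t. indicator {x + s..<y + s} t * r t" s] by simp
  also have "\<dots> = (\<integral>t. indicator {x..<y} t * r (t + s) \<partial>lborel)"
    by (intro Bochner_Integration.integral_cong) (auto simp: indicator_def add.commute)
  finally show ?thesis .
qed

lemma integral_period: "periodic_integrable r \<Longrightarrow> (\<integral>t. indicator {s..<s + 1} t * r t \<partial>lborel) = mean r"
  using integral_interval_shift[of 0 s 1 r] periodic_mean_shift(2)[of r s] by (simp add: add.commute)

text \<open>The Jordan decomposition serves as the definition; the common mass V makes the
  difference periodic and lets the linear terms of \<open>koksma\<close> cancel.\<close>

definition bv_periodic :: "(real \<Rightarrow> real) \<Rightarrow> bool" where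
  "bv_periodic u \<longleftrightarrow> (\<exists>V W1 W2. equivariant V W1 \<and> equivariant V W2 \<and> u = (\<lambda>x. W1 x - W2 x))"

lemma equivariant_add: "equivariant V W \<Longrightarrow> equivariant V' W' \<Longrightarrow> equivariant (V + V') (\<lambda>x. W x + W' x)"
  by (auto simp: equivariant_def mono_def add_mono)

lemma equivariant_scale: "0 \<le> c \<Longrightarrow> equivariant V W \<Longrightarrow> equivariant (c * V) (\<lambda>x. c * W x)"
  by (auto simp: equivariant_def mono_def mult_left_mono algebra_simps)

lemma bv_periodic_add: "bv_periodic u \<Longrightarrow> bv_periodic v \<Longrightarrow> bv_periodic (\<lambda>x. u x + v x)"
proof -
  assume "bv_periodic u" "bv_periodic v"
  then obtain V W1 W2 V' W1' W2' where "equivariant V W1" "equivariant V W2" "u = (\<lambda>x. W1 x - W2 x)"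
    "equivariant V' W1'" "equivariant V' W2'" "v = (\<lambda>x. W1' x - W2' x)"
    unfolding bv_periodic_def by auto
  then show ?thesis unfolding bv_periodic_def
    by (intro exI[of _ "V + V'"] exI[of _ "\<lambda>x. W1 x + W1' x"] exI[of _ "\<lambda>x. W2 x + W2' x"])
      (auto intro: equivariant_add)
qed

lemma bv_periodic_minus: "bv_periodic u \<Longrightarrow> bv_periodic (\<lambda>x. - u x)"
  unfolding bv_periodic_def by (metis minus_diff_eq)

lemma bv_periodic_scale: assumes u: "bv_periodic u" shows "bv_periodic (\<lambda>x. c * u x)"
proof -
  have pos: "bv_periodic (\<lambda>x. c * u x)" if c: "0 \<le> c" and "bv_periodic u" for c u
  proof -
    obtain V W1 W2 where W: "equivariant V W1" "equivariant V W2" "u = (\<lambda>x. W1 x - W2 x)"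
      using \<open>bv_periodic u\<close> unfolding bv_periodic_def by auto
    then have "(\<lambda>x. c * u x) = (\<lambda>x. c * W1 x - c * W2 x)" by (simp add: right_diff_distrib)
    then show ?thesis
      unfolding bv_periodic_def using equivariant_scale[OF c W(1)] equivariant_scale[OF c W(2)] by blast
  qed
  show ?thesis
  proof (cases "0 \<le> c")
    case False
    then have "bv_periodic (\<lambda>x. - c * (- u x))" using u by (intro pos bv_periodic_minus) auto
    then show ?thesis by simp
  qed (use pos u in auto)
qed

lemma bv_periodic_const: "bv_periodic (\<lambda>x. c)"
  unfolding bv_periodic_def
  by (intro exI[of _ 1] exI[of _ "\<lambda>x. x + c"] exI[of _ "\<lambda>x. x"]) (auto simp: equivariant_def mono_def)

lemma bv_periodic_indicator:
  assumes "0 \<le> a" "a < (1::real)" shows "bv_periodic (\<lambda>x. indicator {a<..} (frac x))"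
  unfolding bv_periodic_def frac_gt_indicator[OF assms]
  by (intro exI[of _ 1] exI[of _ "\<lambda>y. of_int \<lceil>y - a\<rceil>"] exI[of _ "\<lambda>y. of_int \<lfloor>y\<rfloor>"])
    (auto simp: equivariant_def mono_def ceiling_mono floor_mono diff_add_eq[symmetric])

lemma periodic_integrable_bv:
  assumes u: "bv_periodic u" shows "periodic_integrable u"
proof -
  obtain V W1 W2 where W: "equivariant V W1" "equivariant V W2" "u = (\<lambda>x. W1 x - W2 x)"
    using u unfolding bv_periodic_def by auto
  have m: "W1 \<in> borel_measurable borel" "W2 \<in> borel_measurable borel"
    using W by (auto intro: borel_measurable_mono simp: equivariant_def)
  have int: "integrable lborel (\<lambda>t. indicator {0..<1} t * W t)" if "equivariant V W" "W \<in> borel_measurable borel" for W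
  proof -
    have bd: "\<bar>W t\<bar> \<le> \<bar>W 0\<bar> + \<bar>W 1\<bar>" if "t \<in> {0..<1}" for t
      using that equivariant_mono[OF \<open>equivariant V W\<close>, of 0 t] equivariant_mono[OF \<open>equivariant V W\<close>, of t 1] by auto
    have "integrable lborel (\<lambda>t::real. (\<bar>W 0\<bar> + \<bar>W 1\<bar>) * indicator {0..<1} t)"
      by (intro integrable_mult_right integrable_real_indicator) auto
    then show ?thesis
      by (rule Bochner_Integration.integrable_bound) (use that bd in \<open>auto simp: indicator_def\<close>)
  qed
  show ?thesis unfolding periodic_integrable_def W(3)
    using W m int[OF W(1) m(1)] int[OF W(2) m(2)] by (auto simp: equivariant_def right_diff_distrib)
qed

text \<open>The approximable functions on the unit interval form a vector space closed under limits
  in L^1. Half-lines generate the Borel sets and are stable under intersection, and inside [0, 1)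
  their indicators are constants or differences of ceilings and floors; sets, simple functions and
  integrable functions follow by induction.\<close>

lemma bv_periodic_dense:
  assumes r: "periodic_integrable r" and \<epsilon>: "0 < \<epsilon>"
  obtains u where "bv_periodic u" "mean (\<lambda>x. \<bar>r x - u x\<bar>) < \<epsilon>"
proof -
  define M where "M = restrict_space lborel {0..<1::real}"
  interpret M: finite_measure M
    by (rule finite_measureI) (simp add: M_def emeasure_restrict_space space_restrict_space)
  define P where "P f \<longleftrightarrow> (\<forall>\<epsilon>>0. \<exists>u. bv_periodic u \<and> integral\<^sup>L M (\<lambda>x. \<bar>f x - u x\<bar>) < \<epsilon>)" for f
  have bvM: "integrable M u" if "bv_periodic u" for u
    using periodic_integrable_bv[OF that] unfolding M_def
    by (subst integrable_restrict_space) (auto simp: periodic_integrable_def)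
  have P_lim: "P f" if f: "integrable M f" "\<And>i. P (s i)" "\<And>i. integrable M (s i)"
    "(\<lambda>i. integral\<^sup>L M (\<lambda>x. \<bar>f x - s i x\<bar>)) \<longlonglongrightarrow> 0" for f and s :: "nat \<Rightarrow> real \<Rightarrow> real"
    unfolding P_def
  proof (intro allI impI)
    fix e :: real assume e: "0 < e"
    then have "eventually (\<lambda>i. integral\<^sup>L M (\<lambda>x. \<bar>f x - s i x\<bar>) < e / 2) sequentially"
      using f(4) by (intro order_tendstoD(2)[of _ 0]) auto
    then obtain i where i: "integral\<^sup>L M (\<lambda>x. \<bar>f x - s i x\<bar>) < e / 2" by (auto simp: eventually_sequentially)
    obtain u where u: "bv_periodic u" "integral\<^sup>L M (\<lambda>x. \<bar>s i x - u x\<bar>) < e / 2"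
      using f(2)[of i] e unfolding P_def by (meson half_gt_zero)
    have "integral\<^sup>L M (\<lambda>x. \<bar>f x - u x\<bar>) \<le> integral\<^sup>L M (\<lambda>x. \<bar>f x - s i x\<bar> + \<bar>s i x - u x\<bar>)"
      using f(1,3) bvM[OF u(1)] by (intro integral_mono) auto
    also have "\<dots> < e" using i u(2) f(1,3) bvM[OF u(1)] by (subst Bochner_Integration.integral_add) auto
    finally show "\<exists>u. bv_periodic u \<and> integral\<^sup>L M (\<lambda>x. \<bar>f x - u x\<bar>) < e" using u(1) by blast
  qed
  have P_add: "P (\<lambda>x. f x + g x)" if fg: "integrable M f" "P f" "integrable M g" "P g" for f g
    unfolding P_def
  proof (intro allI impI)
    fix e :: real assume e: "0 < e"
    obtain u where u: "bv_periodic u" "integral\<^sup>L M (\<lambda>x. \<bar>f x - u x\<bar>) < e / 2"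
      using fg(2) e unfolding P_def by (meson half_gt_zero)
    obtain v where v: "bv_periodic v" "integral\<^sup>L M (\<lambda>x. \<bar>g x - v x\<bar>) < e / 2"
      using fg(4) e unfolding P_def by (meson half_gt_zero)
    have "integral\<^sup>L M (\<lambda>x. \<bar>f x + g x - (u x + v x)\<bar>) \<le> integral\<^sup>L M (\<lambda>x. \<bar>f x - u x\<bar> + \<bar>g x - v x\<bar>)"
      using fg(1,3) bvM[OF u(1)] bvM[OF v(1)] by (intro integral_mono) auto
    also have "\<dots> < e" using u(2) v(2) fg(1,3) bvM[OF u(1)] bvM[OF v(1)]
      by (subst Bochner_Integration.integral_add) auto
    finally show "\<exists>w. bv_periodic w \<and> integral\<^sup>L M (\<lambda>x. \<bar>f x + g x - w x\<bar>) < e"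
      using bv_periodic_add[OF u(1) v(1)] by blast
  qed
  have P_scale: "P (\<lambda>x. c * f x)" if fg: "integrable M f" "P f" for c f
    unfolding P_def
  proof (intro allI impI)
    fix e :: real assume e: "0 < e"
    then have "0 < e / (\<bar>c\<bar> + 1)" by simp
    then obtain u where u: "bv_periodic u" "integral\<^sup>L M (\<lambda>x. \<bar>f x - u x\<bar>) < e / (\<bar>c\<bar> + 1)"
      using fg(2) unfolding P_def by meson
    have "integral\<^sup>L M (\<lambda>x. \<bar>c * f x - c * u x\<bar>) = \<bar>c\<bar> * integral\<^sup>L M (\<lambda>x. \<bar>f x - u x\<bar>)"
      by (simp add: abs_mult flip: right_diff_distrib)
    also have "\<dots> \<le> (\<bar>c\<bar> + 1) * integral\<^sup>L M (\<lambda>x. \<bar>f x - u x\<bar>)"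
      by (intro mult_right_mono integral_nonneg) auto
    also have "\<dots> < e" using u(2) by (simp add: field_simps)
    finally show "\<exists>w. bv_periodic w \<and> integral\<^sup>L M (\<lambda>x. \<bar>c * f x - w x\<bar>) < e"
      using bv_periodic_scale[OF u(1)] by blast
  qed
  have bvP: "P f" if bv: "bv_periodic u" and eq: "\<And>x. x \<in> {0..<1} \<Longrightarrow> f x = u x" for f u
    unfolding P_def
  proof (intro allI impI)
    fix e :: real assume "0 < e"
    moreover have "integral\<^sup>L M (\<lambda>x. \<bar>f x - u x\<bar>) = integral\<^sup>L M (\<lambda>x. 0)"
      using eq by (intro Bochner_Integration.integral_cong) (auto simp: M_def space_restrict_space)
    ultimately show "\<exists>u. bv_periodic u \<and> integral\<^sup>L M (\<lambda>x. \<bar>f x - u x\<bar>) < e" using bv by auto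
  qed
  have borelM: "A \<in> sets borel \<Longrightarrow> integrable M (indicator A :: real \<Rightarrow> real)" for A
    by (rule M.integrable_const_bound[of _ 1]) (auto simp: M_def intro!: measurable_restrict_space1)
  have ind: "P (indicator A)" if "A \<in> sets borel" for A :: "real set"
  proof -
    have int: "Int_stable (range (\<lambda>a::real. {a<..}))"
      by (auto simp: Int_stable_def lessThan_Int_lessThan)
    have closed: "range (\<lambda>a::real. {a<..}) \<subseteq> Pow UNIV" by simp
    have "A \<in> sigma_sets UNIV (range (\<lambda>a::real. {a<..}))"
      using that unfolding borel_Ioi by simp
    from this show ?thesis
    proof (induction rule: sigma_sets_induct_disjoint[OF int closed, consumes 1, case_names basic empty compl union])
      case (basic A)
      then obtain a where A: "A = {a<..}" by auto
      consider "a < 0" | "0 \<le> a" "a < 1" | "1 \<le> a" by linarith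
      then show ?case
      proof cases
        case 1 then show ?thesis unfolding A by (intro bvP[OF bv_periodic_const[of 1]]) auto
      next
        case 2 then show ?thesis unfolding A by (intro bvP[OF bv_periodic_indicator[of a]]) (auto simp: frac_eq)
      next
        case 3 then show ?thesis unfolding A by (intro bvP[OF bv_periodic_const[of 0]]) auto
      qed
    next
      case empty
      show ?case by (intro bvP[OF bv_periodic_const[of 0]]) auto
    next
      case (compl A)
      have A: "A \<in> sets borel" using compl(1) unfolding borel_Ioi by simp
      have P1: "P (\<lambda>x. 1)" by (rule bvP[OF bv_periodic_const[of 1]]) simp
      have "integrable M (\<lambda>x. (- 1) * indicator A x :: real)" using borelM[OF A] by simp
      from P_add[OF _ P1 this P_scale[OF borelM[OF A] compl(2), of "- 1"]]
      have "P (\<lambda>x. 1 + (- 1) * indicator A x)" by simp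
      moreover have "(\<lambda>x. 1 + (- 1) * indicator A x) = (indicator (UNIV - A) :: real \<Rightarrow> real)"
        by (auto simp: indicator_def)
      ultimately show ?case by simp
    next
      case (union A)
      have A: "A i \<in> sets borel" for i using union(2) unfolding borel_Ioi by auto
      define s where "s n x = (\<Sum>i<n. indicator (A i) x :: real)" for n x
      have s: "s n x = indicator (\<Union>i<n. A i) x" for n x
        unfolding s_def using union(1)
        by (subst indicator_UN_disjoint) (auto simp: disjoint_family_on_def)
      have sm: "(\<Union>i<n. A i) \<in> sets borel" for n using A by auto
      have sP: "P (s n)" for n
      proof (induction n)
        case 0 then show ?case unfolding s_def by (intro bvP[OF bv_periodic_const[of 0]]) auto
      next
        case (Suc n)
        have "P (\<lambda>x. s n x + indicator (A n) x)"
          using Suc union(3) borelM[OF A] borelM[OF sm[of n]] by (intro P_add) (auto simp: s[abs_def])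
        then show ?case unfolding s_def by simp
      qed
      show ?case
      proof (rule P_lim[of _ s])
        show "integrable M (indicator (\<Union>i. A i) :: real \<Rightarrow> real)" using A by (intro borelM) auto
        show "integrable M (s i)" for i using borelM[OF sm[of i]] by (simp add: s[abs_def])
        have "(\<lambda>i. integral\<^sup>L M (\<lambda>x. \<bar>indicator (\<Union>i. A i) x - s i x\<bar>)) \<longlonglongrightarrow> integral\<^sup>L M (\<lambda>x. 0 :: real)"
        proof (rule integral_dominated_convergence[where w = "\<lambda>x. 1"])
          show "(\<lambda>x. \<bar>indicator (\<Union>i. A i) x - s i x\<bar>) \<in> borel_measurable M" for i
            unfolding s M_def using A sm[of i] by (intro measurable_restrict_space1) auto
          show "AE x in M. (\<lambda>i. \<bar>indicator (\<Union>i. A i) x - s i x\<bar>) \<longlonglongrightarrow> 0"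
          proof (rule AE_I2)
            fix x
            have "(\<lambda>i. \<bar>indicator (\<Union>i. A i) x - s i x\<bar>) \<longlonglongrightarrow> \<bar>indicator (\<Union>i. A i) x - indicator (\<Union>i. A i) x\<bar>"
              unfolding s by (intro tendsto_intros LIMSEQ_indicator_UN)
            then show "(\<lambda>i. \<bar>indicator (\<Union>i. A i) x - s i x :: real\<bar>) \<longlonglongrightarrow> 0" by simp
          qed
          show "AE x in M. norm \<bar>indicator (\<Union>i. A i) x - s i x\<bar> \<le> 1" for i
            unfolding s by (auto simp: indicator_def)
        qed auto
        then show "(\<lambda>i. integral\<^sup>L M (\<lambda>x. \<bar>indicator (\<Union>i. A i) x - s i x\<bar>)) \<longlonglongrightarrow> 0" by simp
      qed (rule sP)
    qed
  qed
  have rm: "r \<in> borel_measurable borel" using r by (simp add: periodic_integrable_def)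
  have rM: "integrable M r"
    using r unfolding M_def by (subst integrable_restrict_space) (auto simp: periodic_integrable_def)
  then have "P r"
  proof (induction rule: integrable_induct)
    case (base A c)
    then obtain B where B: "B \<in> sets borel" "A = B \<inter> {0..<1}"
      by (auto simp: M_def sets_restrict_space)
    then have AB: "A \<in> sets borel" by auto
    then have "P (\<lambda>x. c * indicator A x)" using borelM[OF AB] ind by (intro P_scale) auto
    then show ?case by (simp add: mult.commute)
  next
    case (add f g) then show ?case by (intro P_add)
  next
    case (lim f s)
    show ?case
    proof (rule P_lim[of _ s])
      have "(\<lambda>i. integral\<^sup>L M (\<lambda>x. \<bar>f x - s i x\<bar>)) \<longlonglongrightarrow> integral\<^sup>L M (\<lambda>x. 0 :: real)"
      proof (rule integral_dominated_convergence[where w = "\<lambda>x. 3 * \<bar>f x\<bar>"])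
        show "AE x in M. (\<lambda>i. \<bar>f x - s i x\<bar>) \<longlonglongrightarrow> 0"
        proof (rule AE_I2)
          fix x assume x: "x \<in> space M"
          then have "(\<lambda>i. s i x) \<longlonglongrightarrow> f x" using lim by blast
          then have "(\<lambda>i. \<bar>f x - s i x\<bar>) \<longlonglongrightarrow> \<bar>f x - f x\<bar>" by (intro tendsto_intros)
          then show "(\<lambda>i. \<bar>f x - s i x\<bar>) \<longlonglongrightarrow> 0" by simp
        qed
        show "AE x in M. norm \<bar>f x - s i x\<bar> \<le> 3 * \<bar>f x\<bar>" for i
        proof (rule AE_I2)
          fix x assume "x \<in> space M"
          then have "norm (s i x) \<le> 2 * norm (f x)" using lim by blast
          then show "norm \<bar>f x - s i x\<bar> \<le> 3 * \<bar>f x\<bar>" by simp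
        qed
      qed (use lim in auto)
      then show "(\<lambda>i. integral\<^sup>L M (\<lambda>x. \<bar>f x - s i x\<bar>)) \<longlonglongrightarrow> 0" by simp
    qed (use lim in auto)
  qed
  then obtain u where u: "bv_periodic u" "integral\<^sup>L M (\<lambda>x. \<bar>r x - u x\<bar>) < \<epsilon>"
    using \<epsilon> unfolding P_def by blast
  have "mean (\<lambda>x. \<bar>r x - u x\<bar>) = integral\<^sup>L M (\<lambda>x. \<bar>r x - u x\<bar>)"
    unfolding mean_def M_def by (subst integral_restrict_space) auto
  then show ?thesis using u by (intro that[of u]) auto
qed

section \<open>Means and translations of periodic functions\<close>

lemma periodic_integrable_shift:
  assumes r: "periodic_integrable r" shows "periodic_integrable (\<lambda>x. r (x + s))"
proof -
  have [measurable]: "r \<in> borel_measurable borel" using r by (simp add: periodic_integrable_def)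
  have "r (x + 1 + s) = r (x + s)" for x
    using r unfolding periodic_integrable_def by (metis add.assoc add.commute)
  then show ?thesis using periodic_mean_shift(1)[OF r, of s] by (simp add: periodic_integrable_def)
qed

lemma mean_shift: "periodic_integrable r \<Longrightarrow> mean (\<lambda>x. r (x + s)) = mean r"
  using periodic_mean_shift(2)[of r s] by (simp add: mean_def)

lemma periodic_integrable_add:
  "periodic_integrable r \<Longrightarrow> periodic_integrable s \<Longrightarrow> periodic_integrable (\<lambda>x. r x + s x)"
  unfolding periodic_integrable_def distrib_left
  by (intro conjI allI borel_measurable_add Bochner_Integration.integrable_add) simp_all

lemma mean_add: "periodic_integrable r \<Longrightarrow> periodic_integrable s \<Longrightarrow> mean (\<lambda>x. r x + s x) = mean r + mean s"
  unfolding mean_def distrib_left by (rule Bochner_Integration.integral_add) (simp_all add: periodic_integrable_def)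

lemma mean_diff: "periodic_integrable r \<Longrightarrow> periodic_integrable s \<Longrightarrow> mean (\<lambda>x. r x - s x) = mean r - mean s"
  unfolding mean_def right_diff_distrib
  by (rule Bochner_Integration.integral_diff) (simp_all add: periodic_integrable_def)

lemma mean_mono: "periodic_integrable r \<Longrightarrow> periodic_integrable s \<Longrightarrow> (\<And>x. r x \<le> s x) \<Longrightarrow> mean r \<le> mean s"
  unfolding mean_def by (rule integral_mono) (simp_all add: periodic_integrable_def mult_left_mono)

lemma mean_const: "mean (\<lambda>x. c) = c"
  by (simp add: mean_def)

lemma periodic_integrable_const: "periodic_integrable (\<lambda>x. c)"
  by (intro periodic_integrable_bv bv_periodic_const)

lemma periodic_integrable_sum:
  fixes n :: nat
  shows "(\<And>i. i < n \<Longrightarrow> periodic_integrable (r i)) \<Longrightarrow> periodic_integrable (\<lambda>x. \<Sum>i<n. r i x)"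
proof (induction n)
  case 0 then show ?case using periodic_integrable_const[of 0] by simp
next
  case (Suc n) then show ?case using periodic_integrable_add[of "\<lambda>x. \<Sum>i<n. r i x" "r n"] by simp
qed

lemma mean_sum:
  fixes n :: nat
  shows "(\<And>i. i < n \<Longrightarrow> periodic_integrable (r i)) \<Longrightarrow> mean (\<lambda>x. \<Sum>i<n. r i x) = (\<Sum>i<n. mean (r i))"
proof (induction n)
  case 0 then show ?case by (simp add: mean_const)
next
  case (Suc n)
  then show ?case
    using mean_add[OF periodic_integrable_sum[of n r], of "r n"] by simp
qed

lemma abs_mean_diff:
  assumes "periodic_integrable r" "periodic_integrable s"
  shows "\<bar>mean r - mean s\<bar> \<le> mean (\<lambda>x. \<bar>r x - s x\<bar>)"
proof -
  have "mean (\<lambda>x. r x - s x) \<le> mean (\<lambda>x. \<bar>r x - s x\<bar>)" "mean (\<lambda>x. s x - r x) \<le> mean (\<lambda>x. \<bar>r x - s x\<bar>)"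
    using assms by (auto intro!: mean_mono periodic_integrable_diff periodic_integrable_abs)
  then show ?thesis using mean_diff[OF assms] mean_diff[OF assms(2,1)] by linarith
qed

text \<open>W (x + \<delta>) - W x has the sign of \<delta>, so the absolute value can be resolved,
  and the periodic function W x - V x has the same mean after translation.\<close>

lemma equivariant_translation_mean:
  assumes W: "equivariant V W"
  shows "periodic_integrable (\<lambda>x. \<bar>W (x + \<delta>) - W x\<bar>)" "mean (\<lambda>x. \<bar>W (x + \<delta>) - W x\<bar>) = V * \<bar>\<delta>\<bar>"
proof -
  define P where "P x = W x - V * x" for x
  have "equivariant V (\<lambda>x. V * x)"
    using equivariant_nonneg[OF W] by (auto simp: equivariant_def mono_def mult_left_mono distrib_left)
  then have "bv_periodic P" using W unfolding bv_periodic_def P_def by blast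
  then have P: "periodic_integrable P" by (rule periodic_integrable_bv)
  note Ps = periodic_integrable_shift[OF P, of \<delta>]
  define D where "D = (\<lambda>x. P (x + \<delta>) - P x)"
  have D: "periodic_integrable D" "mean D = 0"
    unfolding D_def using P Ps by (auto simp: periodic_integrable_diff mean_diff mean_shift)
  have DW: "W (x + \<delta>) - W x = D x + V * \<delta>" for x by (simp add: D_def P_def algebra_simps)
  have c: "periodic_integrable (\<lambda>x. c)" for c :: real by (rule periodic_integrable_const)
  show "periodic_integrable (\<lambda>x. \<bar>W (x + \<delta>) - W x\<bar>)"
    unfolding DW by (intro periodic_integrable_abs periodic_integrable_add D c)
  show "mean (\<lambda>x. \<bar>W (x + \<delta>) - W x\<bar>) = V * \<bar>\<delta>\<bar>"
  proof (cases "0 \<le> \<delta>")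
    case True
    then have "\<bar>W (x + \<delta>) - W x\<bar> = D x + V * \<delta>" for x
      using equivariant_mono[OF W, of x "x + \<delta>"] DW[of x] by simp
    then show ?thesis using True mean_add[OF D(1) c] by (simp add: D mean_const)
  next
    case False
    then have "\<bar>W (x + \<delta>) - W x\<bar> = - (V * \<delta>) - D x" for x
      using equivariant_mono[OF W, of "x + \<delta>" x] DW[of x] by simp
    then show ?thesis using False mean_diff[OF c D(1)] by (simp add: D mean_const)
  qed
qed

text \<open>A third of \<epsilon> goes to replacing r by u at y + \<delta>, a third to the same at
  y, and the rest to the translation of u, which moves by at most V |\<delta>| for each of its two
  monotone parts.\<close>

lemma L1_translation:
  assumes r: "periodic_integrable r" and \<epsilon>: "0 < \<epsilon>"
  obtains d where "0 < d" "\<And>\<delta>. \<bar>\<delta>\<bar> < d \<Longrightarrow> mean (\<lambda>y. \<bar>r (y + \<delta>) - r y\<bar>) < \<epsilon>"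
proof -
  obtain u where u: "bv_periodic u" "mean (\<lambda>x. \<bar>r x - u x\<bar>) < \<epsilon> / 3"
    using bv_periodic_dense[OF r, of "\<epsilon> / 3"] \<epsilon> by auto
  obtain V W1 W2 where W: "equivariant V W1" "equivariant V W2" "u = (\<lambda>x. W1 x - W2 x)"
    using u(1) unfolding bv_periodic_def by auto
  have V: "0 \<le> V" using W(1) by (rule equivariant_nonneg)
  define d where "d = \<epsilon> / 3 / (2 * V + 1)"
  have d: "0 < d" using V \<epsilon> by (simp add: d_def)
  show ?thesis
  proof (rule that[OF d])
    fix \<delta> assume "\<bar>\<delta>\<bar> < d"
    then have \<delta>: "2 * V * \<bar>\<delta>\<bar> \<le> \<epsilon> / 3" 
    proof -
      have "2 * V * \<bar>\<delta>\<bar> \<le> (2 * V + 1) * d" using V \<open>\<bar>\<delta>\<bar> < d\<close> by (intro mult_mono) auto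
      also have "\<dots> = \<epsilon> / 3" using V by (simp add: d_def del: divide_divide_eq_left)
      finally show ?thesis .
    qed
    have pu: "periodic_integrable u" using u(1) by (rule periodic_integrable_bv)
    have ru: "periodic_integrable (\<lambda>x. \<bar>r x - u x\<bar>)" using r pu by (intro periodic_integrable_abs periodic_integrable_diff)
    note rus = periodic_integrable_shift[OF ru, of \<delta>]
    note t1 = equivariant_translation_mean[OF W(1), of \<delta>] and t2 = equivariant_translation_mean[OF W(2), of \<delta>]
    note rs = periodic_integrable_shift[OF r, of \<delta>]
    have "mean (\<lambda>y. \<bar>r (y + \<delta>) - r y\<bar>) \<le>
      mean (\<lambda>y. (\<bar>r (y + \<delta>) - u (y + \<delta>)\<bar> + \<bar>r y - u y\<bar>) + (\<bar>W1 (y + \<delta>) - W1 y\<bar> + \<bar>W2 (y + \<delta>) - W2 y\<bar>))"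
    proof (rule mean_mono)
      show "\<bar>r (y + \<delta>) - r y\<bar> \<le> (\<bar>r (y + \<delta>) - u (y + \<delta>)\<bar> + \<bar>r y - u y\<bar>) + (\<bar>W1 (y + \<delta>) - W1 y\<bar> + \<bar>W2 (y + \<delta>) - W2 y\<bar>)" for y
        unfolding W(3) by linarith
    qed (intro periodic_integrable_abs periodic_integrable_diff periodic_integrable_add rs r rus ru t1(1) t2(1))+
    also have "\<dots> = (mean (\<lambda>x. \<bar>r x - u x\<bar>) + mean (\<lambda>x. \<bar>r x - u x\<bar>)) + (V * \<bar>\<delta>\<bar> + V * \<bar>\<delta>\<bar>)"
      using mean_add[OF periodic_integrable_add[OF rus ru] periodic_integrable_add[OF t1(1) t2(1)]]
        mean_add[OF rus ru] mean_add[OF t1(1) t2(1)] mean_shift[OF ru, of \<delta>] t1(2) t2(2) by simp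
    also have "\<dots> < \<epsilon>" using u(2) \<delta> by simp
    finally show "mean (\<lambda>y. \<bar>r (y + \<delta>) - r y\<bar>) < \<epsilon>" .
  qed
qed

lemma semiconj_rotation: "semiconj \<alpha> (\<lambda>x. x + \<alpha>) (\<lambda>x. x)"
  by (auto simp: semiconj_def equivariant_def mono_def continuous_on_id)

lemma rotation_iter: "((\<lambda>x. x + \<alpha>) ^^ i) y = y + real i * \<alpha>"
  by (induction i) (auto simp: algebra_simps)

text \<open>Equidistribution at the scale 1/q. Replacing r by u of bounded variation, with L^1 error
  e, costs q t e + 5 e \<le> 6 e by \<open>koksma\<close> for the distribution function of |r - u|,
  and at most e in the mean. For u the orbit sum is known up to 10 V at every point, hence up to 10
  V t \<le> 10 V / q after integration. This explains \<epsilon>/14 and 20 V / \<epsilon>.\<close>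

theorem orbit_integral:
  assumes r: "periodic_integrable r" and \<epsilon>: "0 < \<epsilon>"
  obtains Q :: nat where "\<And>q p y t. Q < q \<Longrightarrow> near_rational \<alpha> q p \<Longrightarrow> 0 \<le> t \<Longrightarrow> t \<le> 1 / real q \<Longrightarrow>
    \<bar>(\<Sum>i<q. \<integral>z. indicator {y + real i * \<alpha>..<y + real i * \<alpha> + t} z * r z \<partial>lborel) - q * t * mean r\<bar> \<le> \<epsilon>"
proof -
  obtain u where u: "bv_periodic u" "mean (\<lambda>x. \<bar>r x - u x\<bar>) < \<epsilon> / 14"
    using bv_periodic_dense[OF r, of "\<epsilon> / 14"] \<epsilon> by auto
  obtain V W1 W2 where W: "equivariant V W1" "equivariant V W2" "u = (\<lambda>x. W1 x - W2 x)"
    using u(1) unfolding bv_periodic_def by auto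
  have V: "0 \<le> V" using W(1) by (rule equivariant_nonneg)
  have pu: "periodic_integrable u" using u(1) by (rule periodic_integrable_bv)
  define v where "v x = \<bar>r x - u x\<bar>" for x
  have pv: "periodic_integrable v"
    unfolding v_def using r pu by (intro periodic_integrable_abs periodic_integrable_diff)
  define e where "e = mean v"
  have e: "e < \<epsilon> / 14" using u(2) by (simp add: e_def v_def[abs_def])
  obtain X where X: "equivariant e X" "\<And>a b. a \<le> b \<Longrightarrow> (\<integral>t. indicator {a..<b} t * v t \<partial>lborel) = X b - X a"
    unfolding e_def by (rule periodic_integrable_cdf[OF pv]) (auto simp: v_def)
  have e0: "0 \<le> e" using X(1) by (rule equivariant_nonneg)
  obtain Q :: nat where Q: "20 * V / \<epsilon> < Q" using reals_Archimedean2 by blast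
  show ?thesis
  proof (rule that[of Q])
    fix q :: nat and p and y t :: real
    assume q: "Q < q" and nr: "near_rational \<alpha> q p" and t: "0 \<le> t" "t \<le> 1 / real q"
    have q0: "0 < real q" using q by simp
    have qt: "0 \<le> q * t" "q * t \<le> 1" using t q0 by (auto simp: field_simps)
    define I where "I i = {y + real i * \<alpha>..<y + real i * \<alpha> + t}" for i :: nat
    note K = koksma[OF _ semiconj_rotation nr, unfolded rotation_iter]
    note int = periodic_integrable_interval
    have Vq: "10 * V * t \<le> \<epsilon> / 2"
    proof -
      have "20 * V / \<epsilon> < q" using Q q by linarith
      then have "20 * V \<le> q * \<epsilon>" using \<epsilon> by (simp add: field_simps)
      moreover have "10 * V * t \<le> 10 * V * (1 / q)" using t(2) V by (intro mult_left_mono) auto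
      moreover have "10 * V * (1 / q) \<le> \<epsilon> / 2" using q0 \<open>20 * V \<le> q * \<epsilon>\<close> by (simp add: field_simps)
      ultimately show ?thesis by linarith
    qed
    have 1: "\<bar>(\<Sum>i<q. \<integral>z. indicator (I i) z * r z \<partial>lborel) - (\<Sum>i<q. \<integral>z. indicator (I i) z * u z \<partial>lborel)\<bar> \<le> 6 * e"
    proof -
      have "\<bar>(\<Sum>i<q. \<integral>z. indicator (I i) z * r z \<partial>lborel) - (\<Sum>i<q. \<integral>z. indicator (I i) z * u z \<partial>lborel)\<bar>
          \<le> (\<Sum>i<q. \<bar>(\<integral>z. indicator (I i) z * r z \<partial>lborel) - (\<integral>z. indicator (I i) z * u z \<partial>lborel)\<bar>)"
        unfolding sum_subtractf[symmetric] by (rule sum_abs)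
      also have "\<dots> \<le> (\<Sum>i<q. X (y + t + real i * \<alpha>) - X (y + real i * \<alpha>))"
      proof (rule sum_mono)
        fix i
        have "(\<integral>z. indicator (I i) z * r z \<partial>lborel) - (\<integral>z. indicator (I i) z * u z \<partial>lborel) =
            (\<integral>z. indicator (I i) z * (r z - u z) \<partial>lborel)"
          unfolding I_def right_diff_distrib by (rule Bochner_Integration.integral_diff[symmetric]) (rule int[OF r] int[OF pu])+
        also have "\<bar>\<dots>\<bar> \<le> (\<integral>z. \<bar>indicator (I i) z * (r z - u z)\<bar> \<partial>lborel)"
          by (rule integral_abs_bound)
        also have "\<dots> = (\<integral>z. indicator (I i) z * v z \<partial>lborel)"
          by (simp add: v_def abs_mult)
        also have "\<dots> = X (y + real i * \<alpha> + t) - X (y + real i * \<alpha>)"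
          unfolding I_def using t(1) by (intro X(2)) simp
        finally show "\<bar>(\<integral>z. indicator (I i) z * r z \<partial>lborel) - (\<integral>z. indicator (I i) z * u z \<partial>lborel)\<bar>
            \<le> X (y + t + real i * \<alpha>) - X (y + real i * \<alpha>)" by (simp add: algebra_simps)
      qed
      also have "\<dots> \<le> q * e * t + 5 * e"
        using K[OF X(1), of "y + t" y] by (simp add: sum_subtractf)
      also have "\<dots> = (q * t) * e + 5 * e" by simp
      also have "\<dots> \<le> 1 * e + 5 * e" using qt e0 by (intro add_right_mono mult_right_mono) auto
      finally show ?thesis by simp
    qed
    define S where "S s = (\<Sum>i<q. u (s + (y + real i * \<alpha>)))" for s
    have pS: "periodic_integrable S" unfolding S_def by (intro periodic_integrable_sum periodic_integrable_shift pu)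
    have mS: "mean S = q * mean u"
      unfolding S_def by (simp add: mean_sum periodic_integrable_shift pu mean_shift)
    have osc: "\<bar>S s - S s'\<bar> \<le> 10 * V" for s s'
      using K[OF W(1), of "s + y" "s' + y"] K[OF W(2), of "s + y" "s' + y"]
      unfolding S_def W(3) sum_subtractf by (simp add: add.assoc abs_le_iff)
    \<comment> \<open>A function oscillating by at most 10 V stays within 10 V of its mean.\<close>
    have S: "\<bar>S s - q * mean u\<bar> \<le> 10 * V" for s
    proof -
      have "mean S \<le> mean (\<lambda>x. S s + 10 * V)" "mean (\<lambda>x. S s - 10 * V) \<le> mean S"
        using osc[of s] osc[of _ s] by (auto intro!: mean_mono pS periodic_integrable_const simp: abs_le_iff algebra_simps)
      then show ?thesis unfolding mean_const mS by linarith
    qed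
    have 2: "\<bar>(\<Sum>i<q. \<integral>z. indicator (I i) z * u z \<partial>lborel) - q * t * mean u\<bar> \<le> 10 * V * t"
    proof -
      have sh: "(\<integral>z. indicator (I i) z * u z \<partial>lborel) = (\<integral>s. indicator {0..<t} s * u (s + (y + real i * \<alpha>)) \<partial>lborel)" for i
      proof -
        have "(\<integral>z. indicator (I i) z * u z \<partial>lborel) =
            (\<integral>s. indicator (I i) ((y + real i * \<alpha>) + 1 * s) * u ((y + real i * \<alpha>) + 1 * s) \<partial>lborel)"
          using lborel_integral_real_affine[of 1 "\<lambda>z. indicator (I i) z * u z" "y + real i * \<alpha>"] by simp
        also have "\<dots> = (\<integral>s. indicator {0..<t} s * u (s + (y + real i * \<alpha>)) \<partial>lborel)"
          by (intro Bochner_Integration.integral_cong) (auto simp: I_def indicator_def add.commute)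
        finally show ?thesis .
      qed
      have "(\<Sum>i<q. \<integral>z. indicator (I i) z * u z \<partial>lborel) = (\<integral>s. (\<Sum>i<q. indicator {0..<t} s * u (s + (y + real i * \<alpha>))) \<partial>lborel)"
        unfolding sh by (rule Bochner_Integration.integral_sum[symmetric])
          (intro int periodic_integrable_shift pu)
      also have "\<dots> = (\<integral>s. indicator {0..<t} s * S s \<partial>lborel)" by (simp add: S_def sum_distrib_left)
      finally have e1: "(\<Sum>i<q. \<integral>z. indicator (I i) z * u z \<partial>lborel) = (\<integral>s. indicator {0..<t} s * S s \<partial>lborel)" .
      have c: "integrable lborel (\<lambda>s. indicator {0..<t} s * c)" "(\<integral>s. indicator {0..<t} s * c \<partial>lborel) = t * c" for c :: real
        using t(1) int[OF periodic_integrable_const] by auto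
      have "(\<integral>s. indicator {0..<t} s * S s \<partial>lborel) \<le> t * (q * mean u + 10 * V)"
        unfolding c(2)[symmetric] using S by (intro integral_mono int[OF pS] c(1)) (auto simp: indicator_def abs_le_iff algebra_simps)
      moreover have "t * (q * mean u - 10 * V) \<le> (\<integral>s. indicator {0..<t} s * S s \<partial>lborel)"
        unfolding c(2)[symmetric] using S by (intro integral_mono int[OF pS] c(1)) (auto simp: indicator_def abs_le_iff algebra_simps)
      ultimately show ?thesis unfolding e1 by (simp add: abs_le_iff algebra_simps)
    qed
    have 3: "\<bar>q * t * mean u - q * t * mean r\<bar> \<le> e"
    proof -
      have "\<bar>q * t * mean u - q * t * mean r\<bar> = (q * t) * \<bar>mean r - mean u\<bar>"
        using t(1) by (simp add: abs_mult abs_minus_commute flip: right_diff_distrib)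
      also have "\<dots> \<le> 1 * e"
        using qt abs_mean_diff[OF r pu] e0 by (intro mult_mono) (auto simp: e_def v_def[abs_def])
      finally show ?thesis by simp
    qed
    show "\<bar>(\<Sum>i<q. \<integral>z. indicator {y + real i * \<alpha>..<y + real i * \<alpha> + t} z * r z \<partial>lborel) - q * t * mean r\<bar> \<le> \<epsilon>"
      using 1 2 3 e Vq unfolding I_def by linarith
  qed
qed

section \<open>Piecewise absolutely continuous derivatives\<close>

text \<open>L'Hopital's rule for the difference quotient at the end point. This connects jump ratios
  with boundary values of ln Df on the smooth arcs.\<close>

lemma right_deriv_limit:
  assumes f: "continuous_on UNIV f" and uv: "u < v"
    and d: "\<And>x. u < x \<Longrightarrow> x < v \<Longrightarrow> (f has_real_derivative d x) (at x)"
    and lim: "(d \<longlongrightarrow> l) (at_right u)"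
  shows "right_deriv f u = l"
proof -
  have ev: "eventually (\<lambda>x. u < x \<and> x < v) (at_right u)"
    using uv by (auto simp: eventually_at_right)
  have "((\<lambda>y. (f y - f u) / (y - u)) \<longlongrightarrow> l) (at_right u)"
  proof (rule lhopital_right[where f' = d and g' = "\<lambda>_. 1"])
    have "isCont f u" using f by (simp add: continuous_on_eq_continuous_at)
    then have "(f \<longlongrightarrow> f u) (at_right u)"
      unfolding isCont_def by (rule tendsto_within_subset) simp
    from tendsto_diff[OF this tendsto_const[of "f u"]] show "((\<lambda>y. f y - f u) \<longlongrightarrow> 0) (at_right u)" by simp
    have "((\<lambda>y. y - u) \<longlongrightarrow> u - u) (at_right u)" by (intro tendsto_intros)
    then show "((\<lambda>y. y - u) \<longlongrightarrow> 0) (at_right u)" by simp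
    show "\<forall>\<^sub>F x in at_right u. x - u \<noteq> 0" using ev by eventually_elim auto
    show "\<forall>\<^sub>F x in at_right u. DERIV (\<lambda>y. f y - f u) x :> d x"
      using ev
    proof eventually_elim
      case (elim x)
      then show ?case using DERIV_diff[OF d[of x] DERIV_const[of "f u"]] by simp
    qed
    show "\<forall>\<^sub>F x in at_right u. DERIV (\<lambda>y. y - u) x :> 1"
    proof (intro always_eventually allI)
      fix x show "DERIV (\<lambda>y. y - u) x :> 1"
        using DERIV_diff[OF DERIV_ident DERIV_const[of u]] by simp
    qed
  qed (use lim in auto)
  then have "(f has_real_derivative l) (at_right u)" by (simp add: has_field_derivative_iff)
  then have "(f has_vector_derivative l) (at_right u)" by (simp add: has_real_derivative_iff_has_vector_derivative)
  then show ?thesis unfolding right_deriv_def by (intro vector_derivative_within) simp_all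
qed

lemma left_deriv_limit:
  assumes f: "continuous_on UNIV f" and uv: "u < v"
    and d: "\<And>x. u < x \<Longrightarrow> x < v \<Longrightarrow> (f has_real_derivative d x) (at x)"
    and lim: "(d \<longlongrightarrow> l) (at_left v)"
  shows "(f has_real_derivative l) (at_left v)" "left_deriv f v = l"
proof -
  have ev: "eventually (\<lambda>x. u < x \<and> x < v) (at_left v)"
    using uv by (auto simp: eventually_at_left)
  have "((\<lambda>y. (f y - f v) / (y - v)) \<longlongrightarrow> l) (at_left v)"
  proof (rule lhopital_left[where f' = d and g' = "\<lambda>_. 1"])
    have "isCont f v" using f by (simp add: continuous_on_eq_continuous_at)
    then have "(f \<longlongrightarrow> f v) (at_left v)"
      unfolding isCont_def by (rule tendsto_within_subset) simp
    from tendsto_diff[OF this tendsto_const[of "f v"]] show "((\<lambda>y. f y - f v) \<longlongrightarrow> 0) (at_left v)" by simp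
    have "((\<lambda>y. y - v) \<longlongrightarrow> v - v) (at_left v)" by (intro tendsto_intros)
    then show "((\<lambda>y. y - v) \<longlongrightarrow> 0) (at_left v)" by simp
    show "\<forall>\<^sub>F x in at_left v. x - v \<noteq> 0" using ev by eventually_elim auto
    show "\<forall>\<^sub>F x in at_left v. DERIV (\<lambda>y. f y - f v) x :> d x"
      using ev
    proof eventually_elim
      case (elim x)
      then show ?case using DERIV_diff[OF d[of x] DERIV_const[of "f v"]] by simp
    qed
    show "\<forall>\<^sub>F x in at_left v. DERIV (\<lambda>y. y - v) x :> 1"
    proof (intro always_eventually allI)
      fix x show "DERIV (\<lambda>y. y - v) x :> 1"
        using DERIV_diff[OF DERIV_ident DERIV_const[of v]] by simp
    qed
  qed (use lim in auto)
  then show d: "(f has_real_derivative l) (at_left v)" by (simp add: has_field_derivative_iff)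
  then have "(f has_vector_derivative l) (at_left v)" by (simp add: has_real_derivative_iff_has_vector_derivative)
  then show "left_deriv f v = l" unfolding left_deriv_def by (intro vector_derivative_within) simp_all
qed

text \<open>The smooth arc to the left of the smaller break point a is treated as the one ending at
  a + 1.\<close>

lemma left_deriv_periodic:
  assumes f: "\<And>x. f (x + 1) = f x + 1" and d: "(f has_real_derivative l) (at_left (v + 1))"
  shows "left_deriv f v = l"
proof -
  have "(f has_real_derivative l) (at ((\<lambda>x. x + 1) v) within (\<lambda>x. x + 1) ` {..<v})"
  proof -
    have "(\<lambda>x. x + 1) ` {..<v} = {..<v + 1}"
    proof (rule antisym; rule subsetI)
      fix x assume "x \<in> {..<v + 1}"
      then have "x = (x - 1) + 1" "x - 1 \<in> {..<v}" by auto
      then show "x \<in> (\<lambda>x. x + 1) ` {..<v}" by blast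
    qed auto
    then show ?thesis using d by simp
  qed
  moreover have "((\<lambda>x. x + 1) has_real_derivative 1) (at_left v)" by (auto intro!: derivative_eq_intros)
  ultimately have "(f \<circ> (\<lambda>x. x + 1) has_real_derivative l * 1) (at_left v)"
    by (rule DERIV_image_chain)
  then have "((\<lambda>x. f x + 1) has_real_derivative l) (at_left v)" by (simp add: comp_def f)
  then have "((\<lambda>x. f x + 1 - 1) has_real_derivative l - 0) (at_left v)"
    by (intro DERIV_diff DERIV_const)
  then have "(f has_vector_derivative l) (at_left v)" by (simp add: has_real_derivative_iff_has_vector_derivative)
  then show ?thesis unfolding left_deriv_def by (intro vector_derivative_within) simp_all
qed

definition clip :: "real \<Rightarrow> real \<Rightarrow> real \<Rightarrow> real" where
  "clip u v x = max u (min v x)"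

lemma mono_clip: "mono (clip u v)"
  unfolding mono_def clip_def by (intro allI impI max.mono min.mono order_refl)

lemma clip_lipschitz: "x \<le> y \<Longrightarrow> clip u v y - clip u v x \<le> y - x"
  by (auto simp: clip_def max_def min_def)

lemma increment_clip_le:
  assumes S: "separated S" shows "increment (\<lambda>x. x) (push_pairs (clip u v) S) \<le> increment (\<lambda>x. x) S"
proof -
  have "increment (clip u v) S \<le> increment (\<lambda>x. x) S"
    unfolding increment_def by (intro sum_mono clip_lipschitz separated_le[OF S])
  then show ?thesis by (simp add: push_pairs(2)[OF S mono_clip])
qed

text \<open>On values above c the logarithm is Lipschitz, so ln D is absolutely and hence uniformly
  continuous on the open interval and extends continuously to its end points; outside it is
  continued by constants. The end values are the logarithms of the one-sided limits of D.\<close>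

lemma abs_continuous_extension:
  assumes uv: "u < v" and ac: "absolutely_continuous_on {u<..<v} D"
    and c: "0 < c" "\<And>x. u < x \<Longrightarrow> x < v \<Longrightarrow> c < D x"
  obtains F where "abs_continuous F" "\<And>x. u < x \<Longrightarrow> x < v \<Longrightarrow> F x = ln (D x)"
    "\<And>x. x \<le> u \<Longrightarrow> F x = F u" "\<And>x. v \<le> x \<Longrightarrow> F x = F v"
    "(D \<longlongrightarrow> exp (F u)) (at_right u)" "(D \<longlongrightarrow> exp (F v)) (at_left v)"
proof -
  define L where "L x = ln (D x)" for x
  have lnd: "\<bar>L x - L y\<bar> \<le> \<bar>D x - D y\<bar> / c" if "u < x" "x < v" "u < y" "y < v" for x y
  proof -
    have le: "L s - L t \<le> \<bar>D s - D t\<bar> / c" if "c < D s" "c < D t" for s t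
    proof -
      have "L s - L t = ln (D s / D t)" unfolding L_def using that c(1) by (simp add: ln_div)
      also have "\<dots> \<le> D s / D t - 1" using that c(1) by (intro ln_le_minus_one) simp
      also have "\<dots> = (D s - D t) / D t" using that c(1) by (simp add: diff_divide_distrib)
      also have "\<dots> \<le> \<bar>D s - D t\<bar> / D t" using that c(1) by (intro divide_right_mono) auto
      also have "\<dots> \<le> \<bar>D s - D t\<bar> / c" using that c(1) by (intro divide_left_mono) auto
      finally show ?thesis .
    qed
    show ?thesis using le[of x y] le[of y x] c(2) that by (simp add: abs_le_iff abs_minus_commute)
  qed
  have acL: "\<exists>\<delta>>0. \<forall>S. separated S \<and> (\<forall>p\<in>S. u < fst p \<and> snd p < v) \<and> increment (\<lambda>x. x) S < \<delta> \<longrightarrow>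
      \<bar>increment L S\<bar> \<le> \<epsilon>" if \<epsilon>: "0 < \<epsilon>" for \<epsilon>
  proof -
    have "0 < \<epsilon> * c" using \<epsilon> c by simp
    from ac[unfolded absolutely_continuous_on_def, rule_format, OF this]
    obtain \<delta> where \<delta>: "\<delta> > 0" and acD: "\<forall>(n::nat) (a::nat \<Rightarrow> real) (b::nat \<Rightarrow> real).
        (\<forall>i<n. a i \<le> b i \<and> {a i..b i} \<subseteq> {u<..<v}) \<and>
        (\<forall>i<n. \<forall>j<n. i \<noteq> j \<longrightarrow> {a i<..<b i} \<inter> {a j<..<b j} = {}) \<and>
        (\<Sum>i<n. b i - a i) < \<delta> \<longrightarrow> (\<Sum>i<n. \<bar>D (b i) - D (a i)\<bar>) < \<epsilon> * c"
      by auto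
    show ?thesis
    proof (intro exI[of _ \<delta>] conjI allI impI \<delta>)
      fix S assume "separated S \<and> (\<forall>p\<in>S. u < fst p \<and> snd p < v) \<and> increment (\<lambda>x. x) S < \<delta>"
      then have S: "separated S" "\<And>p. p \<in> S \<Longrightarrow> u < fst p \<and> snd p < v" "increment (\<lambda>x. x) S < \<delta>" by auto
      obtain e where e: "bij_betw e {..<card S} S"
        using ex_bij_betw_nat_finite[OF separated_finite[OF S(1)]] by (auto simp: atLeast0LessThan)
      have eS: "e i \<in> S" if "i < card S" for i using e that by (auto simp: bij_betw_def)
      have sum: "(\<Sum>i<card S. G (e i)) = sum G S" for G :: "real \<times> real \<Rightarrow> real"
        by (rule sum.reindex_bij_betw[OF e])
      have "(\<Sum>i<card S. \<bar>D (snd (e i)) - D (fst (e i))\<bar>) < \<epsilon> * c"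
      proof (rule acD[THEN spec, THEN spec, THEN spec, THEN mp], intro conjI)
        show "\<forall>i<card S. fst (e i) \<le> snd (e i) \<and> {fst (e i)..snd (e i)} \<subseteq> {u<..<v}"
          using separated_le[OF S(1) eS] S(2)[OF eS] by fastforce
        show "\<forall>i<card S. \<forall>j<card S. i \<noteq> j \<longrightarrow> {fst (e i)<..<snd (e i)} \<inter> {fst (e j)<..<snd (e j)} = {}"
        proof (intro allI impI)
          fix i j assume ij: "i < card S" "j < card S" "i \<noteq> j"
          then have "e i \<noteq> e j" using e unfolding bij_betw_def inj_on_def by blast
          from separated_apart[OF S(1) eS[OF ij(1)] eS[OF ij(2)] this]
          show "{fst (e i)<..<snd (e i)} \<inter> {fst (e j)<..<snd (e j)} = {}" by auto
        qed
        show "(\<Sum>i<card S. snd (e i) - fst (e i)) < \<delta>"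
          using S(3) sum[of "\<lambda>p. snd p - fst p"] by (simp add: increment_def)
      qed
      then have D: "(\<Sum>p\<in>S. \<bar>D (snd p) - D (fst p)\<bar>) < \<epsilon> * c"
        using sum[of "\<lambda>p. \<bar>D (snd p) - D (fst p)\<bar>"] by simp
      have "\<bar>increment L S\<bar> \<le> (\<Sum>p\<in>S. \<bar>L (snd p) - L (fst p)\<bar>)" unfolding increment_def by (rule sum_abs)
      also have "\<dots> \<le> (\<Sum>p\<in>S. \<bar>D (snd p) - D (fst p)\<bar> / c)"
      proof (rule sum_mono)
        fix p assume p: "p \<in> S"
        show "\<bar>L (snd p) - L (fst p)\<bar> \<le> \<bar>D (snd p) - D (fst p)\<bar> / c"
          using S(2)[OF p] separated_less[OF S(1) p] by (intro lnd) auto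
      qed
      also have "\<dots> \<le> \<epsilon>" using D c(1) by (simp add: field_simps flip: sum_divide_distrib)
      finally show "\<bar>increment L S\<bar> \<le> \<epsilon>" .
    qed
  qed
  have uc: "uniformly_continuous_on {u<..<v} L"
    unfolding uniformly_continuous_on_def
  proof (intro allI impI)
    fix e :: real assume e: "0 < e"
    then obtain \<delta> where \<delta>: "\<delta> > 0" "\<And>S. separated S \<Longrightarrow> (\<And>p. p \<in> S \<Longrightarrow> u < fst p \<and> snd p < v) \<Longrightarrow>
        increment (\<lambda>x. x) S < \<delta> \<Longrightarrow> \<bar>increment L S\<bar> \<le> e / 2"
      using acL[of "e / 2"] by (meson half_gt_zero)
    have pair: "\<bar>L t - L s\<bar> < e" if "s < t" "t - s < \<delta>" "u < s" "t < v" for s t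
      using \<delta>(2)[of "{(s, t)}"] that e by (simp add: separated_def increment_def)
    show "\<exists>d>0. \<forall>x\<in>{u<..<v}. \<forall>x'\<in>{u<..<v}. dist x' x < d \<longrightarrow> dist (L x') (L x) < e"
    proof (intro exI[of _ \<delta>] conjI ballI impI \<delta>(1))
      fix x x' assume "x \<in> {u<..<v}" "x' \<in> {u<..<v}" "dist x' x < \<delta>"
      then show "dist (L x') (L x) < e"
        using pair[of x x'] pair[of x' x] e
        by (cases x x' rule: linorder_cases) (auto simp: dist_real_def abs_minus_commute)
    qed
  qed
  obtain g where g: "uniformly_continuous_on (closure {u<..<v}) g" "\<And>x. x \<in> {u<..<v} \<Longrightarrow> L x = g x"
    by (rule uniformly_continuous_on_extension_on_closure[OF uc]) (rule that)
  then have gc: "continuous_on {u..v} g" using uv by (simp add: uniformly_continuous_imp_continuous)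
  define F where "F x = g (clip u v x)" for x
  have clip_cont: "continuous_on UNIV (clip u v)"
    unfolding clip_def[abs_def] by (intro continuous_intros)
  have "continuous_on UNIV F"
    unfolding F_def using uv by (intro continuous_on_compose2[OF gc clip_cont]) (auto simp: clip_def)
  then have Fc: "isCont F x" for x by (simp add: continuous_on_eq_continuous_at)
  have FL: "F x = L x" if "u < x" "x < v" for x using that g(2)[of x] by (simp add: F_def clip_def)
  have Fac: "abs_continuous F"
    unfolding abs_continuous_def
  proof (intro allI impI)
    fix \<epsilon> :: real assume "0 < \<epsilon>"
    then obtain \<delta> where \<delta>: "\<delta> > 0" "\<And>S. separated S \<Longrightarrow> (\<And>p. p \<in> S \<Longrightarrow> u < fst p \<and> snd p < v) \<Longrightarrow>
        increment (\<lambda>x. x) S < \<delta> \<Longrightarrow> \<bar>increment L S\<bar> \<le> \<epsilon>"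
      using acL by meson
    show "\<exists>\<delta>>0. \<forall>S. separated S \<and> increment (\<lambda>x. x) S < \<delta> \<longrightarrow> \<bar>increment F S\<bar> \<le> \<epsilon>"
    proof (intro exI[of _ \<delta>] conjI allI impI \<delta>(1))
      fix S assume "separated S \<and> increment (\<lambda>x. x) S < \<delta>"
      then have S: "separated S" "increment (\<lambda>x. x) S < \<delta>" by auto
      \<comment> \<open>A family that touches u or v is first clipped into the open interval, at
        distance \<open>\<eta> n\<close> from its ends, and then n goes to infinity. A third of the
        length keeps u + \<eta> n below v - \<eta> n.\<close>
      define \<eta> where "\<eta> n = (v - u) / 3 * inverse (real (Suc n))" for n
      have \<eta>: "0 < \<eta> n" "\<eta> n \<le> (v - u) / 3" for n
        unfolding \<eta>_def using uv mult_left_le[of "inverse (real (Suc n))" "(v - u) / 3"]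
        by (auto intro!: mult_pos_pos simp: inverse_le_1_iff)
      define \<phi> where "\<phi> n = clip (u + \<eta> n) (v - \<eta> n)" for n
      have \<phi>in: "u < \<phi> n x" "\<phi> n x < v" for n x
        using \<eta>[of n] uv by (auto simp: \<phi>_def clip_def max_def min_def)
      have \<phi>m: "mono (\<phi> n)" for n unfolding \<phi>_def by (rule mono_clip)
      have bd: "\<bar>increment (\<lambda>x. L (\<phi> n x)) S\<bar> \<le> \<epsilon>" for n
      proof -
        have "increment (\<lambda>x. x) (push_pairs (\<phi> n) S) < \<delta>"
          using increment_clip_le[OF S(1)] S(2) unfolding \<phi>_def by (rule le_less_trans)
        moreover have "u < fst p \<and> snd p < v" if "p \<in> push_pairs (\<phi> n) S" for p
          using that \<phi>in by (auto simp: push_pairs_def)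
        ultimately have "\<bar>increment L (push_pairs (\<phi> n) S)\<bar> \<le> \<epsilon>"
          using \<delta>(2)[OF push_pairs(1)[OF S(1) \<phi>m]] by blast
        then show ?thesis by (simp only: push_pairs(2)[OF S(1) \<phi>m])
      qed
      have \<eta>0: "\<eta> \<longlonglongrightarrow> 0"
        unfolding \<eta>_def[abs_def] by (rule tendsto_mult_right_zero[OF LIMSEQ_inverse_real_of_nat])
      have "(\<lambda>n. L (\<phi> n x)) \<longlonglongrightarrow> F x" for x
      proof -
        have "(\<lambda>n. max (u + \<eta> n) (min (v - \<eta> n) x)) \<longlonglongrightarrow> max (u + 0) (min (v - 0) x)"
          by (intro tendsto_intros \<eta>0)
        then have "(\<lambda>n. \<phi> n x) \<longlonglongrightarrow> clip u v x" by (simp add: \<phi>_def clip_def)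
        then have "(\<lambda>n. F (\<phi> n x)) \<longlonglongrightarrow> F (clip u v x)" by (rule isCont_tendsto_compose[OF Fc])
        moreover have "F (clip u v x) = F x" using uv by (simp add: F_def clip_def)
        ultimately show ?thesis using FL[OF \<phi>in] by simp
      qed
      then have "(\<lambda>n. \<bar>increment (\<lambda>x. L (\<phi> n x)) S\<bar>) \<longlonglongrightarrow> \<bar>increment F S\<bar>"
        unfolding increment_def by (intro tendsto_intros)
      then show "\<bar>increment F S\<bar> \<le> \<epsilon>" using bd by (intro LIMSEQ_le_const2) auto
    qed
  qed
  have lim: "(D \<longlongrightarrow> exp (F x)) (at x within T)" if "eventually (\<lambda>y. u < y \<and> y < v) (at x within T)" for x T
  proof -
    have "(F \<longlongrightarrow> F x) (at x within T)"
      using Fc[of x] unfolding isCont_def by (rule tendsto_within_subset) simp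
    then have "((\<lambda>y. exp (F y)) \<longlongrightarrow> exp (F x)) (at x within T)" by (rule tendsto_exp)
    moreover have "eventually (\<lambda>y. exp (F y) = D y) (at x within T)"
      using that
    proof eventually_elim
      case (elim y)
      then have "0 < D y" using c by (meson less_trans)
      then show ?case using elim FL[of y] by (simp add: L_def)
    qed
    ultimately show ?thesis by (rule Lim_transform_eventually)
  qed
  have ev: "eventually (\<lambda>y. u < y \<and> y < v) (at_right u)" "eventually (\<lambda>y. u < y \<and> y < v) (at_left v)"
    using uv by (auto simp: eventually_at_right eventually_at_left)
  have left: "F x = F u" if "x \<le> u" for x using that uv by (simp add: F_def clip_def)
  have right: "F x = F v" if "v \<le> x" for x using that uv by (simp add: F_def clip_def)
  show ?thesis
    by (rule that[OF Fac _ left right lim[OF ev(1)] lim[OF ev(2)]]) (use FL L_def in simp)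
qed

lemma abs_continuous_add:
  assumes F: "abs_continuous F" and G: "abs_continuous G" shows "abs_continuous (\<lambda>x. F x + G x)"
  unfolding abs_continuous_def
proof (intro allI impI)
  fix e :: real assume "0 < e"
  then have e: "0 < e / 2" by simp
  obtain d where d: "d > 0" "\<And>S. separated S \<Longrightarrow> increment (\<lambda>x. x) S < d \<Longrightarrow> \<bar>increment F S\<bar> \<le> e / 2"
    using F e unfolding abs_continuous_def by meson
  obtain d' where d': "d' > 0" "\<And>S. separated S \<Longrightarrow> increment (\<lambda>x. x) S < d' \<Longrightarrow> \<bar>increment G S\<bar> \<le> e / 2"
    using G e unfolding abs_continuous_def by meson
  show "\<exists>\<delta>>0. \<forall>S. separated S \<and> increment (\<lambda>x. x) S < \<delta> \<longrightarrow> \<bar>increment (\<lambda>x. F x + G x) S\<bar> \<le> e"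
  proof (intro exI[of _ "min d d'"] conjI allI impI)
    fix S assume "separated S \<and> increment (\<lambda>x. x) S < min d d'"
    then have "\<bar>increment F S\<bar> \<le> e / 2" "\<bar>increment G S\<bar> \<le> e / 2" using d d' by auto
    moreover have "increment (\<lambda>x. F x + G x) S = increment F S + increment G S"
      unfolding increment_def sum.distrib[symmetric] by (intro sum.cong) auto
    ultimately show "\<bar>increment (\<lambda>x. F x + G x) S\<bar> \<le> e" by linarith
  qed (use d d' in auto)
qed

section \<open>The lift, its Jacobian and the variation of its logarithm\<close>

lemma frac_eq_translate: "frac x = b \<Longrightarrow> x = b + of_int \<lfloor>x\<rfloor>"
  by (simp add: frac_def)

lemma frac_translate: "0 \<le> b \<Longrightarrow> b < 1 \<Longrightarrow> frac (b + of_int k) = b"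
  by (simp add: frac_eq)

lemma lift_derivative:
  assumes f: "equivariant 1 f" and x: "frac x \<notin> break_points f"
  shows "(f has_real_derivative deriv f x) (at x)" "deriv f x = deriv f (frac x)"
proof -
  have "f differentiable at (frac x)" using x by (auto simp: break_points_def frac_lt_1)
  then have d: "(f has_real_derivative deriv f (frac x)) (at (frac x))"
    using DERIV_deriv_iff_real_differentiable by blast
  have "(\<lambda>t. f (t + of_int \<lfloor>x\<rfloor>)) = (\<lambda>t. f t + of_int \<lfloor>x\<rfloor>)"
    using equivariant_int[OF f] by auto
  moreover have "((\<lambda>t. f t + of_int \<lfloor>x\<rfloor>) has_real_derivative deriv f (frac x)) (at (frac x))"
    using DERIV_add[OF d DERIV_const[of "of_int \<lfloor>x\<rfloor>"]] by simp
  ultimately have "(f has_real_derivative deriv f (frac x)) (at (frac x + of_int \<lfloor>x\<rfloor>))"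
    by (simp add: DERIV_shift)
  then have "(f has_real_derivative deriv f (frac x)) (at x)" by (simp add: frac_def)
  then show "deriv f x = deriv f (frac x)" "(f has_real_derivative deriv f x) (at x)"
    by (auto simp: DERIV_imp_deriv)
qed

text \<open>A bounded interval contains finitely many exceptional points, so the fundamental theorem
  of calculus gives the integral of D over it; hence f maps D dx to a measure that agrees with
  Lebesgue measure on intervals. The value 1 at break points is a placeholder that keeps D positive,
  with ln D = 0 there.\<close>

lemma lebesgue_jacobian_lift:
  assumes f: "circle_lift f" and bp: "finite (break_points f)"
    and pos: "\<And>x. frac x \<notin> break_points f \<Longrightarrow> 0 < deriv f x"
  shows "lebesgue_jacobian f (\<lambda>x. if frac x \<in> break_points f then 1 else deriv f x)"
proof -
  define D where "D = (\<lambda>x. if frac x \<in> break_points f then 1 else deriv f x)"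
  have eqf: "equivariant 1 f" by (rule circle_lift_equivariant[OF f])
  have fc: "continuous_on UNIV f" and fs: "strict_mono f" using f by (auto simp: circle_lift_def)
  have [measurable]: "f \<in> borel_measurable borel" using fc by (rule borel_measurable_continuous_onI)
  have der: "(f has_real_derivative D x) (at x)" if "frac x \<notin> break_points f" for x
    using lift_derivative(1)[OF eqf that] that by (simp add: D_def)
  have Dpos: "0 < D x" for x using pos by (simp add: D_def)
  have [measurable]: "D \<in> borel_measurable borel"
  proof (rule borel_measurable_LIMSEQ_real)
    fix x :: real
    define u where "u n x = (if frac x \<in> break_points f then 1 else (f (x + 1 / real (Suc n)) - f x) * real (Suc n))" for n x
    show "(\<lambda>n. u n x) \<longlonglongrightarrow> D x"
    proof (cases "frac x \<in> break_points f")
      case False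
      have "(\<lambda>h. (f (x + h) - f x) / h) \<midarrow>0\<rightarrow> D x" using der[OF False] by (simp add: DERIV_def)
      moreover have "filterlim (\<lambda>n. 1 / real (Suc n)) (at 0) sequentially"
        using LIMSEQ_inverse_real_of_nat by (simp add: filterlim_at inverse_eq_divide)
      ultimately have "(\<lambda>n. (f (x + 1 / real (Suc n)) - f x) / (1 / real (Suc n))) \<longlonglongrightarrow> D x"
        by (rule filterlim_compose)
      then show ?thesis using False by (simp add: u_def)
    qed (simp add: u_def D_def)
  next
    fix n
    have [measurable]: "break_points f \<in> sets borel" using bp by (rule borel_closed[OF finite_imp_closed])
    show "(\<lambda>x. if frac x \<in> break_points f then 1 else (f (x + 1 / real (Suc n)) - f x) * real (Suc n)) \<in> borel_measurable borel"
      by measurable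
  qed
  have finbrk: "finite ({x. frac x \<in> break_points f} \<inter> {x0..x1})" for x0 x1
  proof -
    have "{x. frac x \<in> break_points f} \<inter> {x0..x1} \<subseteq> (\<lambda>(b, k). b + of_int k) ` (break_points f \<times> {\<lfloor>x0\<rfloor>..\<lfloor>x1\<rfloor>})"
    proof
      fix x assume x: "x \<in> {x. frac x \<in> break_points f} \<inter> {x0..x1}"
      then have "(frac x, \<lfloor>x\<rfloor>) \<in> break_points f \<times> {\<lfloor>x0\<rfloor>..\<lfloor>x1\<rfloor>}" by (auto intro: floor_mono)
      moreover have "x = frac x + of_int \<lfloor>x\<rfloor>" by (simp add: frac_def)
      ultimately show "x \<in> (\<lambda>(b, k). b + of_int k) ` (break_points f \<times> {\<lfloor>x0\<rfloor>..\<lfloor>x1\<rfloor>})" by force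
    qed
    then show ?thesis using bp by (auto intro: finite_subset)
  qed
  have int: "(\<integral>\<^sup>+x. indicator {x0<..<x1} x * ennreal (D x) \<partial>lborel) = ennreal (f x1 - f x0)" if x: "x0 \<le> x1" for x0 x1
  proof -
    have "(D has_integral (f x1 - f x0)) {x0..x1}"
    proof (rule fundamental_theorem_of_calculus_interior_strong[OF finbrk[of x0 x1] x])
      show "(f has_vector_derivative D t) (at t)" if "t \<in> {x0<..<x1} - {x. frac x \<in> break_points f} \<inter> {x0..x1}" for t
        using der[of t] that by (auto simp: has_real_derivative_iff_has_vector_derivative)
      show "continuous_on {x0..x1} f" using fc continuous_on_subset by blast
    qed
    then have "((\<lambda>x. if x \<in> {x0..x1} then D x else 0) has_integral (f x1 - f x0)) UNIV"
      by (simp only: has_integral_restrict_UNIV)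
    then have "(\<integral>\<^sup>+x. ennreal (if x \<in> {x0..x1} then D x else 0) \<partial>lborel) = ennreal (f x1 - f x0)"
      using Dpos by (intro nn_integral_has_integral_lborel) (auto simp: less_imp_le)
    moreover have "(\<integral>\<^sup>+x. indicator {x0<..<x1} x * ennreal (D x) \<partial>lborel) =
        (\<integral>\<^sup>+x. ennreal (if x \<in> {x0..x1} then D x else 0) \<partial>lborel)"
    proof (rule nn_integral_cong_AE)
      have "AE x in lborel. x \<notin> {x0, x1}" by (intro AE_not_in countable_imp_null_set_lborel) auto
      then show "AE x in lborel. indicator {x0<..<x1} x * ennreal (D x) = ennreal (if x \<in> {x0..x1} then D x else 0)"
        by eventually_elim (auto simp: indicator_def)
    qed
    ultimately show ?thesis by simp
  qed
  have "lborel = distr (density lborel (\<lambda>x. ennreal (D x))) borel f"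
  proof (rule lborel_eqI)
    fix l u :: real assume "\<And>b. b \<in> Basis \<Longrightarrow> l \<bullet> b \<le> u \<bullet> b"
    then have lu: "l \<le> u" by simp
    obtain x0 x1 where x: "f x0 = l" "f x1 = u" using equivariant_surj[OF eqf fc] by metis
    have pre: "f -` {l<..<u} = {x0<..<x1}" unfolding x[symmetric] using strict_mono_less[OF fs] by auto
    have "x0 \<le> x1" using lu strict_mono_less_eq[OF fs] by (simp add: x[symmetric])
    then have "emeasure (distr (density lborel (\<lambda>x. ennreal (D x))) borel f) {l<..<u} = ennreal (u - l)"
      using int[of x0 x1] by (simp add: emeasure_distr emeasure_density pre x mult.commute)
    then show "emeasure (distr (density lborel (\<lambda>x. ennreal (D x))) borel f) (box l u) = (\<Prod>b\<in>Basis. (u - l) \<bullet> b)"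
      by (simp add: box_real)
  qed simp
  note eq = this
  have "(\<integral>\<^sup>+x. u (f x) * ennreal (D x) \<partial>lborel) = (\<integral>\<^sup>+x. u x \<partial>lborel)" if [measurable]: "u \<in> borel_measurable borel" for u
  proof -
    have "(\<integral>\<^sup>+x. u x \<partial>lborel) = (\<integral>\<^sup>+x. u x \<partial>distr (density lborel (\<lambda>x. ennreal (D x))) borel f)"
      by (simp only: eq[symmetric])
    also have "\<dots> = (\<integral>\<^sup>+x. ennreal (D x) * u (f x) \<partial>lborel)"
      by (simp add: nn_integral_distr nn_integral_density)
    finally show ?thesis by (simp add: mult.commute)
  qed
  then show ?thesis unfolding lebesgue_jacobian_def D_def[symmetric] using Dpos by auto
qed

text \<open>The increment of the floor misses a break point at the left end x, that of the ceiling
  one at the right end y; each of them sees what the other misses.\<close>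

lemma break_count:
  fixes b x y :: real
  assumes "x \<le> z" "z \<le> y" "x < y" "z = b + of_int k"
  shows "1 \<le> (\<lfloor>y - b\<rfloor> + \<lceil>y - b\<rceil>) - (\<lfloor>x - b\<rfloor> + \<lceil>x - b\<rceil>)"
proof -
  have m: "\<lfloor>x - b\<rfloor> \<le> \<lfloor>y - b\<rfloor>" "\<lceil>x - b\<rceil> \<le> \<lceil>y - b\<rceil>" using assms by (auto intro!: floor_mono ceiling_mono)
  show ?thesis
  proof (cases "x = z")
    case True
    then have "\<lceil>x - b\<rceil> = k" using assms(4) by simp
    moreover have "k < \<lceil>y - b\<rceil>" using assms True by (simp add: less_ceiling_iff)
    ultimately show ?thesis using m by linarith
  next
    case False
    then have "\<lfloor>x - b\<rfloor> < k" using assms by (simp add: floor_less_iff)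
    moreover have "k \<le> \<lfloor>y - b\<rfloor>" using assms by (simp add: le_floor_iff)
    ultimately show ?thesis using m by linarith
  qed
qed

lemma equivariant_break_count:
  "equivariant 2 (\<lambda>x. of_int (\<lfloor>x - b\<rfloor> + \<lceil>x - b\<rceil>))"
proof -
  have "\<lfloor>x + 1 - b\<rfloor> = \<lfloor>x - b\<rfloor> + 1" "\<lceil>x + 1 - b\<rceil> = \<lceil>x - b\<rceil> + 1" for x by linarith+
  then show ?thesis by (auto simp: equivariant_def mono_def intro!: add_mono floor_mono ceiling_mono)
qed

lemma integral_Ico_eq_Ioc:
  fixes r :: "real \<Rightarrow> real"
  assumes [measurable]: "r \<in> borel_measurable borel"
  shows "(\<integral>t. indicator {x..<y} t * r t \<partial>lborel) = (\<integral>t. indicator {x<..y} t * r t \<partial>lborel)"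
proof (rule integral_cong_AE)
  have "AE t in lborel. t \<notin> {x, y}" by (intro AE_not_in countable_imp_null_set_lborel) auto
  then show "AE t in lborel. indicator {x..<y} t * r t = indicator {x<..y} t * r t"
    by eventually_elim (auto simp: indicator_def)
qed measurable

text \<open>Condenses the regularity of f into what the dynamics needs: a Jacobian D, a monotone
  bound B for the variation of ln D, and a density l of ln D between break points whose mean K
  records the jumps.\<close>

lemma piecewise_smooth_lift:
  assumes P: "class_P f" and bp: "break_points f = {a, c}" and ac: "a < c"
    and jump: "jump_ratio f a * jump_ratio f c \<noteq> 1"
    and abscont: "\<And>I. is_interval I \<Longrightarrow> (\<forall>x\<in>I. frac x \<notin> {a, c}) \<Longrightarrow> absolutely_continuous_on I (deriv f)"
  obtains D V B l where "lebesgue_jacobian f D" "\<And>x. D (x + 1) = D x" "equivariant V B"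
    "\<And>x y. x \<le> y \<Longrightarrow> \<bar>ln (D x) - ln (D y)\<bar> \<le> B y - B x" "periodic_integrable l" "mean l \<noteq> 0"
    "\<And>x y. x \<le> y \<Longrightarrow> \<forall>z\<in>{x..y}. frac z \<notin> {a, c} \<Longrightarrow>
      ln (D y) - ln (D x) = (\<integral>t. indicator {x..<y} t * l t \<partial>lborel)"
proof -
  have f: "circle_lift f" using P by (simp add: class_P_def)
  have eqf: "equivariant 1 f" by (rule circle_lift_equivariant[OF f])
  have f1: "f (x + 1) = f x + 1" for x using eqf by (simp add: equivariant_def)
  have fc: "continuous_on UNIV f" using f by (simp add: circle_lift_def)
  have "a \<in> {0..<1}" "c \<in> {0..<1}" using bp by (auto simp: break_points_def)
  then have r: "0 \<le> a" "a < c" "c < 1" using ac by auto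
  obtain c1 c2 where c12: "0 < c1" "c1 < c2" "\<And>x. x \<in> {0..<1} - break_points f \<Longrightarrow> c1 < deriv f x \<and> deriv f x < c2"
    using P unfolding class_P_def by blast
  have bd: "c1 < deriv f x \<and> deriv f x < c2" if "frac x \<notin> {a, c}" for x
    using lift_derivative(2)[OF eqf, of x] c12(3)[of "frac x"] that bp by (auto simp: frac_lt_1)
  define D where "D x = (if frac x \<in> {a, c} then 1 else deriv f x)" for x
  have jac: "lebesgue_jacobian f D"
    unfolding D_def[abs_def] bp[symmetric]
    using bd c12(1) by (intro lebesgue_jacobian_lift f) (auto simp: bp intro: less_trans)
  have D1: "D (x + 1) = D x" for x
    using lift_derivative(2)[OF eqf, of x] lift_derivative(2)[OF eqf, of "x + 1"]
    by (auto simp: D_def bp frac_1_eq)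
  have Dk: "D (x + of_int k) = D x" for x k
    using periodic_int[of "{y. D y = D x}" x k] by (simp add: D1)
  \<comment> \<open>Bounds |ln D| everywhere, including the value 0 at break points, so two values
    differ by at most 2 J.\<close>
  define J where "J = \<bar>ln c1\<bar> + \<bar>ln c2\<bar>"
  have J: "\<bar>ln (D x)\<bar> \<le> J" for x
  proof (cases "frac x \<in> {a, c}")
    case False
    then have "ln c1 < ln (D x)" "ln (D x) < ln c2" using bd[OF False] c12(1) by (auto simp: D_def)
    then show ?thesis unfolding J_def by linarith
  qed (simp add: D_def J_def)
  have nb1: "frac x \<notin> {a, c}" if "a < x" "x < c" for x
    using that r by (simp add: frac_eq[THEN iffD2])
  have nb2: "frac x \<notin> {a, c}" if "c < x" "x < a + 1" for x
  proof (cases "x < 1")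
    case True then show ?thesis using that r by (simp add: frac_eq[THEN iffD2])
  next
    case False
    then have "frac (x - 1) = x - 1" using that r by (simp add: frac_eq)
    then have "frac x = x - 1" using frac_1_eq[of "x - 1"] by simp
    then show ?thesis using that r by auto
  qed
  have ac1: "absolutely_continuous_on {a<..<c} (deriv f)"
    by (rule abscont[OF is_interval_oo], rule ballI) (rule nb1, simp_all)
  have ac2: "absolutely_continuous_on {c<..<a + 1} (deriv f)"
    by (rule abscont[OF is_interval_oo], rule ballI) (rule nb2, simp_all)
  have bd1: "c1 < deriv f x" if "a < x" "x < c" for x using bd nb1[OF that] by blast
  have bd2: "c1 < deriv f x" if "c < x" "x < a + 1" for x using bd nb2[OF that] by blast
  obtain F1 where F1: "abs_continuous F1" "\<And>x. a < x \<Longrightarrow> x < c \<Longrightarrow> F1 x = ln (deriv f x)"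
    "\<And>x. x \<le> a \<Longrightarrow> F1 x = F1 a" "\<And>x. c \<le> x \<Longrightarrow> F1 x = F1 c"
    "(deriv f \<longlongrightarrow> exp (F1 a)) (at_right a)" "(deriv f \<longlongrightarrow> exp (F1 c)) (at_left c)"
    by (rule abs_continuous_extension[OF r(2) ac1 c12(1) bd1], assumption, assumption, rule that)
  have r': "c < a + 1" using r by simp
  obtain F2 where F2: "abs_continuous F2" "\<And>x. c < x \<Longrightarrow> x < a + 1 \<Longrightarrow> F2 x = ln (deriv f x)"
    "\<And>x. x \<le> c \<Longrightarrow> F2 x = F2 c" "\<And>x. a + 1 \<le> x \<Longrightarrow> F2 x = F2 (a + 1)"
    "(deriv f \<longlongrightarrow> exp (F2 c)) (at_right c)" "(deriv f \<longlongrightarrow> exp (F2 (a + 1))) (at_left (a + 1))"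
    by (rule abs_continuous_extension[OF r' ac2 c12(1) bd2], assumption, assumption, rule that)
  have der1: "(f has_real_derivative deriv f x) (at x)" if "a < x" "x < c" for x
    using lift_derivative(1)[OF eqf] nb1[OF that] bp by simp
  have der2: "(f has_real_derivative deriv f x) (at x)" if "c < x" "x < a + 1" for x
    using lift_derivative(1)[OF eqf] nb2[OF that] bp by simp
  have "right_deriv f a = exp (F1 a)" by (rule right_deriv_limit[OF fc r(2) der1 F1(5)])
  moreover have "left_deriv f c = exp (F1 c)" by (rule left_deriv_limit(2)[OF fc r(2) der1 F1(6)])
  moreover have "right_deriv f c = exp (F2 c)" by (rule right_deriv_limit[OF fc r' der2 F2(5)])
  moreover have "left_deriv f a = exp (F2 (a + 1))"
    by (rule left_deriv_periodic[OF f1 left_deriv_limit(1)[OF fc r' der2 F2(6)]])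
  \<comment> \<open>Grouped by break points this exponent is the logarithm of the product of jump
    ratios; regrouped by arcs, (F1 c - F1 a) + (F2 (a + 1) - F2 c), it is the total growth of ln Df
    between them.\<close>
  ultimately have "jump_ratio f a * jump_ratio f c = exp ((F2 (a + 1) - F1 a) + (F1 c - F2 c))"
    by (simp add: jump_ratio_def exp_diff exp_add)
  then have K: "(F2 (a + 1) - F1 a) + (F1 c - F2 c) \<noteq> 0" using jump by (metis exp_zero)
  \<comment> \<open>Each summand is constant off its own arc, so on each arc F is ln Df plus a
    constant, and the jump at c has disappeared.\<close>
  define F where "F x = F1 x + F2 x" for x
  have Fac: "abs_continuous F" unfolding F_def by (rule abs_continuous_add[OF F1(1) F2(1)])
  have Fl: "F x = F a" if "x \<le> a" for x
    using F1(3)[of x] F2(3)[of x] F2(3)[of a] that r by (simp add: F_def)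
  have Fr: "F x = F (a + 1)" if "a + 1 \<le> x" for x
    using F1(4)[of x] F1(4)[of "a + 1"] F2(4)[of x] that r by (simp add: F_def)
  obtain \<phi> where \<phi>: "integrable lborel \<phi>"
    "\<And>x y. x \<le> y \<Longrightarrow> (\<integral>t. indicator {x<..y} t * \<phi> t \<partial>lborel) = F y - F x"
    by (rule abs_continuous_density[OF Fac _ Fl Fr], simp, assumption, assumption, rule that)
  have \<phi>m[measurable]: "\<phi> \<in> borel_measurable borel" using \<phi>(1) by simp
  \<comment> \<open>Periodic continuation of the density from the period [a, a + 1), in which F was
    built.\<close>
  define l where "l x = \<phi> (a + frac (x - a))" for x
  have lm[measurable]: "l \<in> borel_measurable borel" unfolding l_def by measurable
  have l1: "l (x + 1) = l x" for x
    using frac_1_eq[of "x - a"] by (simp add: l_def diff_add_eq)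
  have lk: "l (x + of_int k) = l x" for x k
    using periodic_int[of "{y. l y = l x}" x k] by (simp add: l1)
  have l\<phi>: "l x = \<phi> x" if "a \<le> x" "x < a + 1" for x
    using that frac_eq[of "x - a"] by (simp add: l_def)
  have lint: "periodic_integrable l"
    unfolding periodic_integrable_def
  proof (intro conjI allI lm l1)
    have "(\<integral>\<^sup>+t. ennreal (norm (indicator {0..<1} t * l t)) \<partial>lborel) = (\<integral>\<^sup>+t. indicator {0..<1} t * ennreal \<bar>l t\<bar> \<partial>lborel)"
      by (intro nn_integral_cong) (auto simp: indicator_def)
    also have "\<dots> = (\<integral>\<^sup>+t. indicator {a..<a + 1} t * ennreal \<bar>l t\<bar> \<partial>lborel)"
      by (rule nn_integral_periodic[symmetric]) (auto simp: l1)
    also have "\<dots> \<le> (\<integral>\<^sup>+t. ennreal (norm (\<phi> t)) \<partial>lborel)"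
      using l\<phi> by (intro nn_integral_mono) (auto simp: indicator_def)
    also have "\<dots> < \<infinity>" using \<phi>(1) by (simp add: integrable_iff_bounded)
    finally show "integrable lborel (\<lambda>t. indicator {0..<1} t * l t)"
      by (intro integrableI_bounded) auto
  qed
  have \<phi>int: "(\<integral>t. indicator {x..<y} t * l t \<partial>lborel) = F y - F x" if "a \<le> x" "x \<le> y" "y \<le> a + 1" for x y
  proof -
    have "(\<integral>t. indicator {x..<y} t * l t \<partial>lborel) = (\<integral>t. indicator {x..<y} t * \<phi> t \<partial>lborel)"
      using l\<phi> that by (intro Bochner_Integration.integral_cong) (auto simp: indicator_def)
    then show ?thesis using \<phi>(2)[OF that(2)] by (simp add: integral_Ico_eq_Ioc)
  qed
  have "mean l = (\<integral>t. indicator {0 + a..<1 + a} t * l t \<partial>lborel)"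
    unfolding integral_interval_shift using periodic_mean_shift(2)[OF lint, of a] by simp
  also have "\<dots> = F (a + 1) - F a" using \<phi>int[of a "a + 1"] by (simp add: add.commute)
  also have "\<dots> = (F2 (a + 1) - F1 a) + (F1 c - F2 c)"
    using F1(4)[of "a + 1"] F2(3)[of a] r by (simp add: F_def)
  finally have meanl: "mean l \<noteq> 0" using K by simp
  have incr: "ln (D y) - ln (D x) = (\<integral>t. indicator {x..<y} t * l t \<partial>lborel)"
    if xy: "x \<le> y" and nb: "\<forall>z\<in>{x..y}. frac z \<notin> {a, c}" for x y
  proof -
    \<comment> \<open>Translation by n brings x into [a, a + 1); an interval free of break points
      then lies inside one of the two arcs.\<close>
    define n where "n = \<lfloor>x - a\<rfloor>"
    define x' where "x' = x - of_int n"
    define y' where "y' = y - of_int n"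
    have x: "x = x' + of_int n" "y = y' + of_int n" "x' \<le> y'" using xy by (auto simp: x'_def y'_def)
    have no: "\<not> (x' \<le> b + of_int k \<and> b + of_int k \<le> y')" if "b \<in> {a, c}" for b k
    proof
      assume "x' \<le> b + of_int k \<and> b + of_int k \<le> y'"
      then have "frac (b + of_int (k + n)) \<notin> {a, c}" by (intro nb[rule_format]) (auto simp: x)
      moreover have "frac (b + of_int (k + n)) = b" using that r by (intro frac_translate) auto
      ultimately show False using that by simp
    qed
    have "a \<le> x'" "x' < a + 1" unfolding x'_def n_def by linarith+
    moreover have "\<not> (x' \<le> a \<and> a \<le> y')" "\<not> (x' \<le> a + 1 \<and> a + 1 \<le> y')" "\<not> (x' \<le> c \<and> c \<le> y')"
      using no[of a 0] no[of a 1] no[of c 0] by auto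
    ultimately have range: "a < x'" "y' < a + 1" "y' < c \<or> c < x'" using x(3) by linarith+
    have D': "D z = deriv f z" if "x' \<le> z" "z \<le> y'" for z
      using nb1[of z] nb2[of z] that range by (auto simp: D_def)
    have "F y' - F x' = ln (D y') - ln (D x')"
      using range(3)
    proof
      assume "y' < c"
      then show ?thesis
        using F1(2)[of x'] F1(2)[of y'] F2(3)[of x'] F2(3)[of y'] D'[of x'] D'[of y'] x(3) range by (simp add: F_def)
    next
      assume "c < x'"
      then show ?thesis
        using F2(2)[of x'] F2(2)[of y'] F1(4)[of x'] F1(4)[of y'] D'[of x'] D'[of y'] x(3) range by (simp add: F_def)
    qed
    moreover have "(\<integral>t. indicator {x..<y} t * l t \<partial>lborel) = F y' - F x'"
      unfolding x(1,2) integral_interval_shift lk using range x(3) by (intro \<phi>int) auto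
    moreover have "ln (D y) - ln (D x) = ln (D y') - ln (D x')" unfolding x(1,2) Dk ..
    ultimately show ?thesis by simp
  qed
  obtain X where X: "equivariant (mean (\<lambda>x. \<bar>l x\<bar>)) X"
    "\<And>x y. x \<le> y \<Longrightarrow> (\<integral>t. indicator {x..<y} t * \<bar>l t\<bar> \<partial>lborel) = X y - X x"
    by (rule periodic_integrable_cdf[OF periodic_integrable_abs[OF lint]]) auto
  \<comment> \<open>Floor and ceiling together count a break point also when it is an end point of \<open>[x, y]\<close>.\<close>
  define N where "N b x = real_of_int (\<lfloor>x - b\<rfloor> + \<lceil>x - b\<rceil>)" for b x :: real
  have N: "equivariant 2 (N b)" for b unfolding N_def by (rule equivariant_break_count)
  \<comment> \<open>X accounts for the variation between break points, and 2 J for any interval that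
    contains one.\<close>
  define B where "B x = X x + 2 * J * (N a x + N c x)" for x
  have J0: "0 \<le> 2 * J" by (simp add: J_def)
  have B: "equivariant (mean (\<lambda>x. \<bar>l x\<bar>) + 2 * J * (2 + 2)) B"
    unfolding B_def by (intro equivariant_add X(1) equivariant_scale J0 N)
  have var: "\<bar>ln (D x) - ln (D y)\<bar> \<le> B y - B x" if xy: "x \<le> y" for x y
  proof (cases "\<exists>z. x \<le> z \<and> z \<le> y \<and> frac z \<in> {a, c}")
    case False
    have "\<bar>ln (D x) - ln (D y)\<bar> = \<bar>\<integral>t. indicator {x..<y} t * l t \<partial>lborel\<bar>"
      using incr[OF xy] False by (metis abs_minus_commute atLeastAtMost_iff)
    also have "\<dots> \<le> (\<integral>t. \<bar>indicator {x..<y} t * l t\<bar> \<partial>lborel)" by (rule integral_abs_bound)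
    also have "\<dots> = X y - X x" using X(2)[OF xy] by (simp add: abs_mult)
    also have "\<dots> \<le> B y - B x"
    proof -
      have "0 \<le> 2 * J * ((N a y + N c y) - (N a x + N c x))"
        using J0 equivariant_mono[OF N[of a] xy] equivariant_mono[OF N[of c] xy] by (intro mult_nonneg_nonneg) auto
      then show ?thesis by (simp add: B_def algebra_simps)
    qed
    finally show ?thesis .
  next
    case True
    then obtain z b where z: "x \<le> z" "z \<le> y" "b \<in> {a, c}" "frac z = b" by blast
    show ?thesis
    proof (cases "x = y")
      case False
      then have "1 \<le> N b y - N b x"
        using break_count[OF z(1,2) _ frac_eq_translate[OF z(4)]] xy unfolding N_def
        by (metis (mono_tags) less_le of_int_1_le_iff of_int_diff)
      then have "1 \<le> (N a y + N c y) - (N a x + N c x)"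
        using z(3) equivariant_mono[OF N[of a] xy] equivariant_mono[OF N[of c] xy] by auto
      then have "2 * J * 1 \<le> 2 * J * ((N a y + N c y) - (N a x + N c x))" by (intro mult_left_mono J0)
      moreover have "X x \<le> X y" using equivariant_mono[OF X(1) xy] .
      ultimately have "2 * J \<le> B y - B x" by (simp add: B_def algebra_simps)
      then show ?thesis using J[of x] J[of y] by linarith
    qed simp
  qed
  show ?thesis by (rule that[OF jac D1 B var lint meanl incr])
qed

section \<open>Singularity of the invariant measure\<close>

lemma equivariant_inv_iter:
  assumes f: "equivariant 1 f" "continuous_on UNIV f" "strict_mono f"
  shows "(inv f ^^ m) ((f ^^ m) x) = x" "(f ^^ m) ((inv f ^^ m) x) = x" "(inv f ^^ m) \<in> borel_measurable borel"
proof -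
  have surj: "f (inv f x) = x" for x using equivariant_surj[OF f(1,2), of x] by (metis f_inv_into_f rangeI)
  have inj: "inv f (f x) = x" for x using strict_mono_imp_inj_on[OF f(3)] by (simp add: inv_f_f)
  show "(inv f ^^ m) ((f ^^ m) x) = x" for x by (induction m arbitrary: x) (auto simp: funpow_swap1 inj)
  show "(f ^^ m) ((inv f ^^ m) x) = x" for x by (induction m arbitrary: x) (auto simp: funpow_swap1 surj)
  have "mono (inv f)"
  proof (rule monoI)
    fix x y :: real assume "x \<le> y"
    then show "inv f x \<le> inv f y" using strict_mono_less_eq[OF f(3), of "inv f x" "inv f y"] surj by simp
  qed
  then show "(inv f ^^ m) \<in> borel_measurable borel"
    by (intro measurable_funpow borel_measurable_mono)
qed

lemma plateau_valuesI: "h x = y \<Longrightarrow> h x' = y \<Longrightarrow> x \<noteq> x' \<Longrightarrow> y \<in> plateau_values h"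
  unfolding plateau_values_def by (auto simp: neq_iff)

text \<open>Saturation of A under f, its inverse and integer translations. The exponents on both
  sides express backward images through forward iterates.\<close>

definition grand_orbit :: "(real \<Rightarrow> real) \<Rightarrow> real set \<Rightarrow> real set" where
  "grand_orbit f A = {x. \<exists>n m (k::int). \<exists>e\<in>A. (f ^^ n) x = (f ^^ m) e + k}"

lemma grand_orbit:
  assumes f: "equivariant 1 f" "continuous_on UNIV f" "strict_mono f" and A: "A \<in> sets borel"
  shows "grand_orbit f A \<in> sets borel" "x + 1 \<in> grand_orbit f A \<longleftrightarrow> x \<in> grand_orbit f A"
    "f x \<in> grand_orbit f A \<longleftrightarrow> x \<in> grand_orbit f A" "A \<subseteq> grand_orbit f A"
proof -
  have fi: "equivariant 1 (f ^^ n)" for n by (rule equivariant_iter[OF f(1)])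
  have [measurable]: "f \<in> borel_measurable borel" using f(2) by (rule borel_measurable_continuous_onI)
  have [measurable]: "(f ^^ n) \<in> borel_measurable borel" "(inv f ^^ n) \<in> borel_measurable borel" for n
    by (auto intro: measurable_funpow equivariant_inv_iter[OF f])
  have "grand_orbit f A = (\<Union>n m. \<Union>k::int. (\<lambda>x. (inv f ^^ m) ((f ^^ n) x - of_int k)) -` A)"
  proof (rule set_eqI)
    fix x
    have "(\<exists>e\<in>A. (f ^^ n) x = (f ^^ m) e + of_int k) \<longleftrightarrow> (inv f ^^ m) ((f ^^ n) x - of_int k) \<in> A" for n m k
    proof
      assume "\<exists>e\<in>A. (f ^^ n) x = (f ^^ m) e + of_int k"
      then show "(inv f ^^ m) ((f ^^ n) x - of_int k) \<in> A" by (auto simp: equivariant_inv_iter(1)[OF f])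
    next
      assume "(inv f ^^ m) ((f ^^ n) x - of_int k) \<in> A"
      then show "\<exists>e\<in>A. (f ^^ n) x = (f ^^ m) e + of_int k"
        by (intro bexI[of _ "(inv f ^^ m) ((f ^^ n) x - of_int k)"]) (auto simp: equivariant_inv_iter(2)[OF f])
    qed
    then show "x \<in> grand_orbit f A \<longleftrightarrow> x \<in> (\<Union>n m. \<Union>k::int. (\<lambda>x. (inv f ^^ m) ((f ^^ n) x - of_int k)) -` A)"
      by (simp add: grand_orbit_def)
  qed
  moreover have "(\<lambda>x. (inv f ^^ m) ((f ^^ n) x - of_int k)) -` A \<in> sets borel" for n m and k :: int
    using measurable_sets[of "\<lambda>x. (inv f ^^ m) ((f ^^ n) x - of_int k)" borel borel A] A by simp
  ultimately show "grand_orbit f A \<in> sets borel" by auto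
  have s: "(f ^^ n) (x + 1) = (f ^^ n) x + 1" for n x using fi[of n] by (simp add: equivariant_def)
  show "x + 1 \<in> grand_orbit f A \<longleftrightarrow> x \<in> grand_orbit f A"
  proof
    assume "x + 1 \<in> grand_orbit f A"
    then obtain n m k e where "e \<in> A" "(f ^^ n) x + 1 = (f ^^ m) e + of_int k" by (auto simp: grand_orbit_def s)
    then have "e \<in> A" "(f ^^ n) x = (f ^^ m) e + of_int (k - 1)" by auto
    then show "x \<in> grand_orbit f A" unfolding grand_orbit_def by blast
  next
    assume "x \<in> grand_orbit f A"
    then obtain n m k e where "e \<in> A" "(f ^^ n) x = (f ^^ m) e + of_int k" by (auto simp: grand_orbit_def)
    then have "e \<in> A" "(f ^^ n) (x + 1) = (f ^^ m) e + of_int (k + 1)" by (auto simp: s)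
    then show "x + 1 \<in> grand_orbit f A" unfolding grand_orbit_def by blast
  qed
  show "f x \<in> grand_orbit f A \<longleftrightarrow> x \<in> grand_orbit f A"
  proof
    assume "f x \<in> grand_orbit f A"
    then obtain n m k e where e: "e \<in> A" "(f ^^ n) (f x) = (f ^^ m) e + of_int k" by (auto simp: grand_orbit_def)
    then have "(f ^^ Suc n) x = (f ^^ m) e + of_int k" by (simp add: funpow_swap1)
    with e(1) show "x \<in> grand_orbit f A" unfolding grand_orbit_def by blast
  next
    assume "x \<in> grand_orbit f A"
    then obtain n m k e where e: "e \<in> A" "(f ^^ n) x = (f ^^ m) e + of_int k" by (auto simp: grand_orbit_def)
    have "(f ^^ n) (f x) = f ((f ^^ n) x)" by (simp add: funpow_swap1)
    also have "\<dots> = f ((f ^^ m) e + of_int k)" using e(2) by simp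
    also have "\<dots> = (f ^^ Suc m) e + of_int k" using equivariant_int[OF f(1)] by simp
    finally show "f x \<in> grand_orbit f A" using e(1) unfolding grand_orbit_def by blast
  qed
  show "A \<subseteq> grand_orbit f A"
  proof
    fix e assume e: "e \<in> A"
    have "(f ^^ 0) e = (f ^^ 0) e + of_int 0" by simp
    then show "e \<in> grand_orbit f A" using e unfolding grand_orbit_def by blast
  qed
qed

text \<open>The grand orbit of a null set of the invariant measure is Lebesgue null or has a Lebesgue null
  complement, and the latter would make the invariant measure singular.\<close>

lemma lebesgue_absolutely_continuous:
  assumes f: "circle_lift f" and h: "semiconj \<alpha> f h" and irr: "\<alpha> \<notin> \<rat>"
    and D: "lebesgue_jacobian f D" and B: "equivariant V B"
    and var: "\<And>x y. x \<le> y \<Longrightarrow> \<bar>ln (D x) - ln (D y)\<bar> \<le> B y - B x"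
    and ns: "\<not> singular_on_circle (circle_invariant h)"
    and A: "A \<in> sets borel" and null: "emeasure lborel {y. section_of h y \<in> A} = 0"
  shows "emeasure lborel A = 0"
proof -
  have h': "equivariant 1 h" "continuous_on UNIV h" using h by (auto simp: semiconj_def)
  have f': "equivariant 1 f" "continuous_on UNIV f" "strict_mono f"
    using f circle_lift_equivariant by (auto simp: circle_lift_def)
  define g where "g = section_of h"
  note g = section_of[OF h', folded g_def]
  note [measurable] = section_measurable[OF h', folded g_def]
  have [measurable]: "h \<in> borel_measurable borel" using h'(2) by (rule borel_measurable_continuous_onI)
  have cnt: "countable (plateau_values h)" using countable_plateau_values h'(1) by (auto simp: equivariant_def)
  \<comment> \<open>The plateaus join A so that h is injective off E, as
    \<open>invariant_set_null\<close> requires; in the coordinate y they add only a countable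
    set.\<close>
  define P where "P = h -` plateau_values h"
  have "plateau_values h \<in> sets borel" using cnt by (rule sets.countable[rotated]) simp
  then have PB: "P \<in> sets borel" using measurable_sets[of h borel borel "plateau_values h"] by (simp add: P_def)
  define E where "E = grand_orbit f (A \<union> P)"
  have AP: "A \<union> P \<in> sets borel" using A PB by simp
  note E = grand_orbit[OF f' AP, folded E_def]
  define Z where "Z = {y. g y \<in> A \<union> P}"
  have ZB: "Z \<in> sets borel" using measurable_sets[of g borel borel "A \<union> P"] AP by (simp add: Z_def vimage_def)
  have "Z \<in> null_sets lborel"
  proof -
    have "{y. g y \<in> A} \<in> null_sets lborel"
      using null measurable_sets[of g borel borel A] A by (simp add: g_def[symmetric] vimage_def null_sets_def)
    moreover have "plateau_values h \<in> null_sets lborel" using cnt by (rule countable_imp_null_set_lborel)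
    ultimately have "{y. g y \<in> A} \<union> plateau_values h \<in> null_sets lborel" by (rule null_sets.Un)
    moreover have "Z = {y. g y \<in> A} \<union> plateau_values h" by (auto simp: Z_def P_def g(1))
    ultimately show ?thesis by simp
  qed
  then have Z0: "emeasure lborel Z = 0" by auto
  \<comment> \<open>In the coordinate y the grand orbit becomes a countable union of translates of
    the null set Z, so E is null for the invariant measure too.\<close>
  define Y where "Y = (\<Union>n m::nat. \<Union>k::int. {y. y + (real n * \<alpha> - real m * \<alpha> - of_int k) \<in> Z})"
  have "{y. y + c \<in> Z} \<in> null_sets lborel" for c
    using lborel_translate[OF ZB, of c] Z0 measurable_sets[of "\<lambda>y. y + c" borel borel Z] ZB
    by (simp add: null_sets_def vimage_def)
  then have Y0: "Y \<in> null_sets lborel" unfolding Y_def by (intro null_sets_UN') auto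
  have EY: "{y. g y \<in> E} \<subseteq> Y"
  proof (rule subsetI, simp only: mem_Collect_eq)
    fix y assume "g y \<in> E"
    then obtain n m k e where e: "e \<in> A \<union> P" "(f ^^ n) (g y) = (f ^^ m) e + of_int k"
      unfolding E_def grand_orbit_def by blast
    have "h ((f ^^ n) (g y)) = h ((f ^^ m) e + of_int k)" using e(2) by simp
    then have y: "y + (real n * \<alpha> - real m * \<alpha> - of_int k) = h e"
      unfolding equivariant_int[OF h'(1)] semiconj_iter[OF h] g(1) by simp
    \<comment> \<open>The section may choose another preimage of h e than e, but only on a plateau,
      and plateaus lie in P.\<close>
    have "g (h e) \<in> A \<union> P"
    proof (cases "g (h e) = e")
      case False
      then have "h e \<in> plateau_values h" by (rule plateau_valuesI[rotated 2]) (simp_all add: g(1))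
      then show ?thesis by (simp add: P_def g(1))
    qed (use e in auto)
    then have "y + (real n * \<alpha> - real m * \<alpha> - of_int k) \<in> Z" by (simp add: y Z_def)
    then show "y \<in> Y" unfolding Y_def by blast
  qed
  \<comment> \<open>Otherwise the part of [0, 1) outside E would be Lebesgue null and of full
    invariant measure, which is singularity.\<close>
  have pos: "emeasure lborel (- E) \<noteq> 0"
  proof
    assume c0: "emeasure lborel (- E) = 0"
    define S where "S = {0..<1} - E"
    have SB: "S \<in> sets (restrict_space borel {0..<1})" using E(1) by (auto simp: S_def sets_restrict_space_iff)
    have "emeasure lborel S \<le> emeasure lborel (- E)" using E(1) by (intro emeasure_mono) (auto simp: S_def)
    then have S0: "emeasure lborel S = 0" using c0 by simp
    have "emeasure (circle_invariant h) S = emeasure lborel {y \<in> {0..<1}. frac (g y) \<in> S}"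
      unfolding g_def by (rule emeasure_circle_invariant[OF h' SB])
    also have "\<dots> = emeasure lborel {0..<1::real}"
    proof (rule emeasure_eq_AE)
      have fE: "frac x \<in> E \<longleftrightarrow> x \<in> E" for x
        using periodic_int[of E "frac x" "\<lfloor>x\<rfloor>"] E(2) by (simp add: frac_def)
      have "AE y in lborel. y \<notin> Y" using Y0 by (rule AE_not_in)
      then show "AE y in lborel. y \<in> {y \<in> {0..<1}. frac (g y) \<in> S} \<longleftrightarrow> y \<in> {0..<1}"
        by eventually_elim (use EY fE in \<open>auto simp: S_def frac_lt_1\<close>)
      have "S \<in> sets borel" using E(1) by (simp add: S_def)
      then have "(\<lambda>y. frac (g y)) -` S \<inter> space borel \<in> sets borel" by (intro measurable_sets[of _ borel borel]) auto
      then show "{y \<in> {0..<1}. frac (g y) \<in> S} \<in> sets lborel" by (simp add: vimage_def Collect_conj_eq)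
    qed simp
    finally have "emeasure (circle_invariant h) S = 1" by simp
    moreover have "S \<in> sets (circle_invariant h)" using SB by (simp add: circle_invariant_def)
    ultimately show False using ns S0 unfolding singular_on_circle_def by blast
  qed
  have plat: "x = y" if "x \<notin> E" "h x = h y" for x y
  proof (rule ccontr)
    assume "x \<noteq> y"
    then have "h x \<in> plateau_values h" by (rule plateau_valuesI[rotated 2]) (simp_all add: that(2))
    then have "x \<in> P" by (simp add: P_def)
    then show False using that(1) E(4) by auto
  qed
  have "emeasure lborel E = 0"
    by (rule invariant_set_null[OF f'(1,3) h irr D B var E(1,2,3) plat pos])
  moreover have "emeasure lborel A \<le> emeasure lborel E" using E(1,4) by (intro emeasure_mono) auto
  ultimately show ?thesis by simp
qed

section \<open>Lebesgue measure in the coordinate of the conjugacy\<close>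

lemma lebesgue_jacobian_rotation: "lebesgue_jacobian (\<lambda>x. x + \<alpha>) (\<lambda>x. 1)"
  by (auto simp: lebesgue_jacobian_def nn_integral_translate)

lemma AE_translate:
  fixes P :: "real \<Rightarrow> bool"
  assumes "AE y in lborel. P y" shows "AE y in lborel. P (y + c)"
proof -
  obtain N where N: "\<And>y. y \<notin> N \<Longrightarrow> P y" "N \<in> null_sets lborel"
    using AE_E3[OF assms] by auto
  have "{y. y + c \<in> N} \<in> null_sets lborel"
    using lborel_translate[of N c] N(2) measurable_sets[of "\<lambda>y. y + c" borel borel N]
    by (auto simp: null_sets_def vimage_def)
  then have "AE y in lborel. y \<notin> {y. y + c \<in> N}" by (rule AE_not_in)
  then show ?thesis by eventually_elim (use N(1) in auto)
qed

text \<open>Bounds the starting points y whose interval [y, y + s] is hit by an integer translate of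
  \<beta>; within one period these fill a single window of length s.\<close>

lemma window_measure:
  fixes \<beta> s :: real
  assumes s: "0 \<le> s" "s < 1"
  shows "emeasure lborel ({y. \<exists>k::int. y \<le> \<beta> + k \<and> \<beta> + k \<le> y + s} \<inter> {0..<1}) \<le> ennreal s"
    "{y. \<exists>k::int. y \<le> \<beta> + k \<and> \<beta> + k \<le> y + s} \<in> sets borel"
proof -
  define S where "S = {y. \<exists>k::int. y \<le> \<beta> + k \<and> \<beta> + k \<le> y + s}"
  have "S = (\<Union>k::int. {\<beta> + k - s..\<beta> + k})" by (auto simp: S_def algebra_simps)
  then have SB: "S \<in> sets borel" by simp
  have per: "y + 1 \<in> S \<longleftrightarrow> y \<in> S" for y
  proof
    assume "y + 1 \<in> S"
    then obtain k :: int where "y + 1 \<le> \<beta> + k" "\<beta> + k \<le> y + 1 + s" by (auto simp: S_def)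
    then show "y \<in> S" unfolding S_def by (intro CollectI exI[of _ "k - 1"]) simp
  next
    assume "y \<in> S"
    then obtain k :: int where "y \<le> \<beta> + k" "\<beta> + k \<le> y + s" by (auto simp: S_def)
    then show "y + 1 \<in> S" unfolding S_def by (intro CollectI exI[of _ "k + 1"]) simp
  qed
  have "emeasure lborel (S \<inter> {0..<1}) = emeasure lborel (S \<inter> {\<beta> - s..<\<beta> - s + 1})"
    by (rule emeasure_periodic[OF SB per, symmetric]) (auto intro: lborel_translate)
  also have "\<dots> \<le> emeasure lborel {\<beta> - s..\<beta>}"
  proof (rule emeasure_mono)
    show "S \<inter> {\<beta> - s..<\<beta> - s + 1} \<subseteq> {\<beta> - s..\<beta>}"
    proof
      fix y assume y: "y \<in> S \<inter> {\<beta> - s..<\<beta> - s + 1}"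
      then obtain k :: int where k: "y \<le> \<beta> + k" "\<beta> + k \<le> y + s" by (auto simp: S_def)
      have "k < 1" using k(2) y by (simp flip: of_int_less_1_iff)
      then have "real_of_int k \<le> 0" by simp
      then show "y \<in> {\<beta> - s..\<beta>}" using k(1) y by auto
    qed
  qed simp
  also have "\<dots> = ennreal s" using s by simp
  finally show "emeasure lborel ({y. \<exists>k::int. y \<le> \<beta> + k \<and> \<beta> + k \<le> y + s} \<inter> {0..<1}) \<le> ennreal s"
    by (simp only: S_def)
  show "{y. \<exists>k::int. y \<le> \<beta> + k \<and> \<beta> + k \<le> y + s} \<in> sets borel" using SB by (simp only: S_def)
qed

lemma rotation_circle: "equivariant 1 (\<lambda>x. x + \<alpha>)" "continuous_on UNIV (\<lambda>x::real. x + \<alpha>)" "strict_mono (\<lambda>x::real. x + \<alpha>)"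
proof -
  show "continuous_on UNIV (\<lambda>x::real. x + \<alpha>)" by (intro continuous_intros)
qed (simp_all add: equivariant_def mono_def strict_mono_def)

text \<open>Absolute continuity first makes h injective, so that its section is an inverse
  conjugating f to the rotation. G is the density of the image of Lebesgue measure under h; the
  change of variables formula for f becomes the cocycle identity, and ergodicity of the rotation
  makes G positive.\<close>

lemma conjugacy_density:
  assumes f: "circle_lift f" and h: "semiconj \<alpha> f h" and irr: "\<alpha> \<notin> \<rat>" and D: "lebesgue_jacobian f D"
    and lac: "\<And>A. A \<in> sets borel \<Longrightarrow> emeasure lborel {y. section_of h y \<in> A} = 0 \<Longrightarrow> emeasure lborel A = 0"
  obtains G where "periodic_integrable G" "\<And>y. 0 \<le> G y"
    "distr lborel borel h = density lborel (\<lambda>y. ennreal (G y))"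
    "\<And>x. section_of h (h x) = x" "\<And>n y. (f ^^ n) (section_of h y) = section_of h (y + real n * \<alpha>)"
    "\<And>n (k::int). AE y in lborel. G (y + (real n * \<alpha> + k)) = orbit_weight f D n (section_of h y) * G y"
    "AE y in lborel. 0 < G y"
proof -
  have h': "equivariant 1 h" "continuous_on UNIV h" using h by (auto simp: semiconj_def)
  define g where "g = section_of h"
  note g = section_of[OF h', folded g_def]
  have [measurable]: "g \<in> borel_measurable borel" unfolding g_def by (rule section_measurable[OF h'])
  have [measurable]: "h \<in> borel_measurable borel" using h'(2) by (rule borel_measurable_continuous_onI)
  have [measurable]: "f \<in> borel_measurable borel" using f by (auto simp: circle_lift_def intro: borel_measurable_continuous_onI)
  have [measurable]: "(f ^^ n) \<in> borel_measurable borel" for n by (rule measurable_funpow) simp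
  \<comment> \<open>A plateau has positive length but corresponds to at most one value of the
    coordinate y.\<close>
  have no_plateau: "\<not> (x < y \<and> h x = h y)" for x y
  proof
    assume xy: "x < y \<and> h x = h y"
    have "{z. g z \<in> {x..y}} \<subseteq> {h x}"
    proof
      fix z assume "z \<in> {z. g z \<in> {x..y}}"
      then have "h x \<le> h (g z)" "h (g z) \<le> h y" by (auto intro: equivariant_mono[OF h'(1)])
      then show "z \<in> {h x}" using xy by (simp add: g(1))
    qed
    then have "emeasure lborel {z. g z \<in> {x..y}} \<le> emeasure lborel {h x}" by (rule emeasure_mono) simp
    then have "emeasure lborel {z. section_of h z \<in> {x..y}} = 0" by (simp add: g_def)
    from lac[OF _ this] have "emeasure lborel {x..y} = 0" by simp
    then show False using xy by simp
  qed
  have inj: "x = y" if "h x = h y" for x y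
    using no_plateau[of x y] no_plateau[of y x] that by (cases x y rule: linorder_cases) auto
  have gh: "g (h x) = x" for x by (rule inj) (rule g(1))
  have conj: "(f ^^ n) (g y) = g (y + real n * \<alpha>)" for n y
    by (rule inj) (simp add: semiconj_iter[OF h] g(1))
  define m where "m = distr lborel borel h"
  have ac: "absolutely_continuous lborel m"
    unfolding absolutely_continuous_def
  proof
    fix N :: "real set" assume N: "N \<in> null_sets lborel"
    then have NB: "N \<in> sets borel" by auto
    have hN: "h -` N \<in> sets borel" using measurable_sets[of h borel borel N] NB by simp
    have "{y. section_of h y \<in> h -` N} = N" unfolding g_def[symmetric] by (auto simp: g(1))
    then have "emeasure lborel {y. section_of h y \<in> h -` N} = 0" using N by auto
    from lac[OF hN this] have "emeasure lborel (h -` N) = 0" .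
    then show "N \<in> null_sets m" using NB by (simp add: m_def null_sets_def emeasure_distr)
  qed
  obtain G0 where G0: "G0 \<in> borel_measurable lborel" "density lborel G0 = m"
    using sigma_finite_measure.Radon_Nikodym[OF sigma_finite_lborel ac] by (auto simp: m_def)
  have [measurable]: "G0 \<in> borel_measurable borel" using G0(1) by simp
  have int0: "(\<integral>\<^sup>+y. G0 y * u y \<partial>lborel) = (\<integral>\<^sup>+x. u (h x) \<partial>lborel)" if [measurable]: "u \<in> borel_measurable borel" for u
  proof -
    have "(\<integral>\<^sup>+y. G0 y * u y \<partial>lborel) = (\<integral>\<^sup>+y. u y \<partial>density lborel G0)" by (simp add: nn_integral_density)
    also have "\<dots> = (\<integral>\<^sup>+x. u (h x) \<partial>lborel)" unfolding G0(2) m_def by (simp add: nn_integral_distr)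
    finally show ?thesis .
  qed
  let ?w = "\<lambda>n. orbit_weight f D n"
  have [measurable]: "?w n \<in> borel_measurable borel" for n by (rule orbit_weight(1)[OF D])
  have wpos: "0 < ?w n x" for n x by (rule orbit_weight(2)[OF D])
  \<comment> \<open>Both sides are densities of the same measure: substituting
    \<open>(f ^^ n) x\<close> for x moves h x by n \<alpha> and multiplies Lebesgue measure by the
    orbit weight. Densities are unique up to null sets.\<close>
  have cocycle0: "AE y in lborel. G0 (y + (real n * \<alpha> + k)) = ennreal (?w n (g y)) * G0 y" for n and k :: int
  proof -
    define s where "s = real n * \<alpha> + k"
    have "density lborel (\<lambda>y. G0 (y + s)) = density lborel (\<lambda>y. ennreal (?w n (g y)) * G0 y)"
    proof (rule measure_eqI)
      fix A assume "A \<in> sets (density lborel (\<lambda>y. G0 (y + s)))"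
      then have [measurable]: "A \<in> sets borel" by simp
      have "(\<integral>\<^sup>+y. G0 (y + s) * indicator A y \<partial>lborel) = (\<integral>\<^sup>+y. G0 (y + s) * indicator A ((y + s) - s) \<partial>lborel)" by simp
      also have "\<dots> = (\<integral>\<^sup>+y. G0 y * indicator A (y - s) \<partial>lborel)"
        by (rule nn_integral_translate[of "\<lambda>y. G0 y * indicator A (y - s)"]) measurable
      also have "\<dots> = (\<integral>\<^sup>+x. indicator A (h x - s) \<partial>lborel)" by (rule int0) measurable
      also have "\<dots> = (\<integral>\<^sup>+x. indicator A (h (x + of_int (- k)) - real n * \<alpha>) \<partial>lborel)"
        unfolding equivariant_int[OF h'(1)] by (simp add: s_def algebra_simps)
      also have "\<dots> = (\<integral>\<^sup>+x. indicator A (h x - real n * \<alpha>) \<partial>lborel)"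
        by (rule nn_integral_translate[of "\<lambda>x. indicator A (h x - real n * \<alpha>)"]) measurable
      also have "\<dots> = (\<integral>\<^sup>+x. indicator A (h ((f ^^ n) x) - real n * \<alpha>) * ennreal (?w n x) \<partial>lborel)"
        by (rule orbit_weight(3)[OF D, symmetric]) measurable
      also have "\<dots> = (\<integral>\<^sup>+x. indicator A (h x) * ennreal (?w n (g (h x))) \<partial>lborel)"
        by (simp add: semiconj_iter[OF h] gh)
      also have "\<dots> = (\<integral>\<^sup>+y. G0 y * (indicator A y * ennreal (?w n (g y))) \<partial>lborel)"
        by (rule int0[symmetric]) measurable
      finally show "emeasure (density lborel (\<lambda>y. G0 (y + s))) A = emeasure (density lborel (\<lambda>y. ennreal (?w n (g y)) * G0 y)) A"
        by (simp add: emeasure_density ac_simps)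
    qed simp
    then show ?thesis unfolding s_def by (subst (asm) sigma_finite_measure.density_unique_iff[OF sigma_finite_lborel]) auto
  qed
  have periodic0: "AE y in lborel. \<forall>k::int. G0 (y + k) = G0 y"
    unfolding AE_all_countable using cocycle0[of 0] by (simp add: orbit_weight_def)
  \<comment> \<open>G0 is finite and periodic only almost everywhere; folding it through
    \<open>frac\<close> yields an everywhere periodic real representative.\<close>
  define G where "G y = enn2real (G0 (frac y))" for y
  have [measurable]: "G \<in> borel_measurable borel" unfolding G_def by measurable
  have G1: "G (y + 1) = G y" for y by (simp add: G_def frac_1_eq)
  have Gpos: "0 \<le> G y" for y by (simp add: G_def)
  have fin: "AE y in lborel. G0 (frac y) \<noteq> \<infinity>"
  proof -
    have pre: "h -` {0..<1} = {g 0..<g 1}"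
    proof (rule set_eqI)
      fix x
      have "h x < 0 \<longleftrightarrow> x < g 0" "h x < 1 \<longleftrightarrow> x < g 1"
        using g(3)[of "h x" 0] g(3)[of "h x" 1] equivariant_mono[OF g(4), of 0 "h x"] equivariant_mono[OF g(4), of 1 "h x"]
        unfolding gh by linarith+
      then show "x \<in> h -` {0..<1} \<longleftrightarrow> x \<in> {g 0..<g 1}" by auto
    qed
    have "(\<integral>\<^sup>+y. G0 y * indicator {0..<1} y \<partial>lborel) = (\<integral>\<^sup>+x. indicator {0..<1} (h x) \<partial>lborel)"
      by (rule int0) simp
    also have "\<dots> = (\<integral>\<^sup>+x. indicator (h -` {0..<1}) x \<partial>lborel)"
      by (intro nn_integral_cong) (simp add: indicator_def)
    also have "\<dots> = 1" unfolding pre using g(2)[of 0] by simp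
    finally have "AE y in lborel. G0 y * indicator {0..<1} y \<noteq> \<infinity>" by (intro nn_integral_PInf_AE) auto
    then have AE: "AE y in lborel. y \<in> {0..<1} \<longrightarrow> G0 y \<noteq> \<infinity>" by eventually_elim auto
    define S where "S = {y. G0 (frac y) = \<infinity>}"
    have SB: "S \<in> sets borel" unfolding S_def by measurable
    have "AE y in lborel. y \<notin> S \<inter> {0..<1}"
      using AE by eventually_elim (auto simp: S_def frac_eq[THEN iffD2])
    then have "emeasure lborel (S \<inter> {0..<1}) = 0"
      using SB by (subst (asm) AE_iff_null_sets[symmetric]) auto
    then have "emeasure lborel S = 0" by (intro periodic_null[OF SB]) (simp_all add: S_def frac_1_eq)
    then have "AE y in lborel. y \<notin> S" using SB by (intro AE_not_in) (auto simp: null_sets_def)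
    then show ?thesis by (simp add: S_def)
  qed
  have G0G: "AE y in lborel. G0 y = ennreal (G y)"
    using periodic0 fin
  proof eventually_elim
    case (elim y)
    have "G0 (y + of_int (- \<lfloor>y\<rfloor>)) = G0 y" using elim(1) by blast
    then have "G0 (frac y) = G0 y" by (simp add: frac_def)
    then show ?case using elim(2) by (simp add: G_def top.not_eq_extremum)
  qed
  have mG: "distr lborel borel h = density lborel (\<lambda>y. ennreal (G y))"
    unfolding m_def[symmetric] G0(2)[symmetric] using G0G by (intro density_cong) auto
  have intG: "(\<integral>\<^sup>+y. ennreal (G y) * u y \<partial>lborel) = (\<integral>\<^sup>+x. u (h x) \<partial>lborel)" if "u \<in> borel_measurable borel" for u
    unfolding int0[OF that, symmetric] using G0G by (intro nn_integral_cong_AE) auto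
  have pG: "periodic_integrable G"
    unfolding periodic_integrable_def
  proof (intro conjI allI G1)
    have "(\<integral>\<^sup>+t. ennreal (norm (indicator {0..<1} t * G t)) \<partial>lborel) = (\<integral>\<^sup>+t. ennreal (G t) * indicator {0..<1} t \<partial>lborel)"
      using Gpos by (intro nn_integral_cong) (auto simp: indicator_def)
    also have "\<dots> = (\<integral>\<^sup>+x. indicator {0..<1} (h x) \<partial>lborel)" by (rule intG) simp
    also have "\<dots> \<le> (\<integral>\<^sup>+x. indicator {g 0..g 1} x \<partial>lborel)"
    proof (rule nn_integral_mono)
      fix x :: real
      have "h x < 0" if "x < g 0" using that equivariant_mono[OF g(4), of 0 "h x"] unfolding gh by linarith
      moreover have "1 < h x" if "g 1 < x" using that equivariant_mono[OF g(4), of "h x" 1] unfolding gh by linarith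
      ultimately show "indicator {0..<1} (h x) \<le> (indicator {g 0..g 1} x :: ennreal)"
        by (force simp: indicator_def)
    qed
    also have "\<dots> < \<infinity>" using g(2)[of 0] by simp
    finally show "integrable lborel (\<lambda>t. indicator {0..<1} t * G t)" by (intro integrableI_bounded) auto
  qed simp
  have cocycle: "AE y in lborel. G (y + (real n * \<alpha> + k)) = ?w n (g y) * G y" for n and k :: int
    using cocycle0[of n k] G0G AE_translate[OF G0G, of "real n * \<alpha> + k"]
  proof eventually_elim
    case (elim y)
    then have "ennreal (G (y + (real n * \<alpha> + k))) = ennreal (?w n (g y) * G y)"
      using wpos[of n "g y"] Gpos[of y] by (simp add: ennreal_mult less_imp_le)
    then show ?case using wpos[of n "g y"] Gpos by (simp add: less_imp_le)
  qed
  \<comment> \<open>By the cocycle identity the zero set Z is invariant under the rotation up to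
    null sets, hence almost equal to its grand orbit E. \<open>invariant_set_null\<close> for the
    rotation, with Jacobian 1 and variation 0, is its ergodicity.\<close>
  have AEpos: "AE y in lborel. 0 < G y"
  proof -
    define Z where "Z = {y. G y = 0}"
    have ZB: "Z \<in> sets borel" unfolding Z_def by measurable
    define E where "E = grand_orbit (\<lambda>x. x + \<alpha>) Z"
    note E = grand_orbit[OF rotation_circle[of \<alpha>] ZB, folded E_def]
    have "AE y in lborel. \<forall>n::nat. \<forall>j::nat. \<forall>k::int. y + (real n * \<alpha> - real j * \<alpha> - k) \<in> Z \<longrightarrow> y \<in> Z"
      unfolding AE_all_countable
    proof (intro allI)
      fix n j :: nat and k :: int
      \<comment> \<open>The identity holds for nonnegative times, so both points are compared with
        the common predecessor y - j \<alpha>.\<close>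
      have "AE y in lborel. G (y + - (real j * \<alpha>) + (real n * \<alpha> + of_int (- k))) = ?w n (g (y + - (real j * \<alpha>))) * G (y + - (real j * \<alpha>))"
        by (rule AE_translate[OF cocycle])
      moreover have "AE y in lborel. G (y + - (real j * \<alpha>) + (real j * \<alpha> + of_int 0)) = ?w j (g (y + - (real j * \<alpha>))) * G (y + - (real j * \<alpha>))"
        by (rule AE_translate[OF cocycle])
      ultimately show "AE y in lborel. y + (real n * \<alpha> - real j * \<alpha> - k) \<in> Z \<longrightarrow> y \<in> Z"
      proof eventually_elim
        case (elim y)
        have e: "y + - (real j * \<alpha>) + (real n * \<alpha> + of_int (- k)) = y + (real n * \<alpha> - real j * \<alpha> - k)"
          "y + - (real j * \<alpha>) + (real j * \<alpha> + of_int 0) = y" by simp_all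
        show ?case
          using elim(1)[unfolded e(1)] elim(2)[unfolded e(2)] wpos[of n "g (y + - (real j * \<alpha>))"]
          by (auto simp: Z_def)
      qed
    qed
    then have EZ: "AE y in lborel. y \<in> E \<longrightarrow> y \<in> Z"
    proof eventually_elim
      case (elim y)
      show ?case
      proof
        assume "y \<in> E"
        then obtain n j k e where e: "e \<in> Z" "y + real n * \<alpha> = e + real j * \<alpha> + of_int k"
          unfolding E_def grand_orbit_def rotation_iter by blast
        then have "y + (real n * \<alpha> - real j * \<alpha> - of_int k) = e" by simp
        then show "y \<in> Z" using elim e(1) by metis
      qed
    qed
    \<comment> \<open>If E were of full measure, G would vanish almost everywhere, but its integral
      over the line is the infinite Lebesgue measure of the line.\<close>
    have pos: "emeasure lborel (- E) \<noteq> 0"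
    proof
      assume "emeasure lborel (- E) = 0"
      then have "AE y in lborel. y \<notin> - E" using E(1) by (intro AE_not_in) (auto simp: null_sets_def)
      then have "AE y in lborel. ennreal (G y) * 1 = 0" using EZ by eventually_elim (auto simp: Z_def)
      then have "(\<integral>\<^sup>+y. ennreal (G y) * 1 \<partial>lborel) = (\<integral>\<^sup>+y. 0 \<partial>(lborel :: real measure))" by (rule nn_integral_cong_AE)
      moreover have "(\<integral>\<^sup>+y. ennreal (G y) * 1 \<partial>lborel) = (\<integral>\<^sup>+x. 1 \<partial>(lborel :: real measure))" by (rule intG) simp
      ultimately show False by (simp add: emeasure_lborel_UNIV)
    qed
    have zero: "equivariant 0 (\<lambda>x. 0)" by (simp add: equivariant_def mono_def)
    have "emeasure lborel E = 0"
      by (rule invariant_set_null[OF rotation_circle(1,3) semiconj_rotation irr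
            lebesgue_jacobian_rotation zero _ E(1,2,3) _ pos]) simp_all
    moreover have "emeasure lborel Z \<le> emeasure lborel E" using E(1,4) by (intro emeasure_mono) auto
    ultimately have "Z \<in> null_sets lborel" using ZB by (simp add: null_sets_def)
    then have "AE y in lborel. y \<notin> Z" by (rule AE_not_in)
    then show ?thesis by eventually_elim (use Gpos in \<open>auto simp: Z_def less_le\<close>)
  qed
  show ?thesis
    by (rule that[OF pG Gpos mG gh[unfolded g_def] conj[unfolded g_def] cocycle[unfolded g_def] AEpos])
qed

text \<open>Measure budget on the unit interval: at most 1/4 for the y whose intervals meet a break
  point, less than 1/4 for large \<Phi> at y, and the same for large \<Phi> at y + s. Together these
  sets would cover the interval.\<close>

lemma not_lebesgue_absolutely_continuous:
  fixes a c :: real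
  assumes f: "circle_lift f" and h: "semiconj \<alpha> f h" and irr: "\<alpha> \<notin> \<rat>"
    and D: "lebesgue_jacobian f D" and D1: "\<And>x. D (x + 1) = D x"
    and l: "periodic_integrable l" and K: "mean l \<noteq> 0"
    and incr: "\<And>x y. x \<le> y \<Longrightarrow> \<forall>z\<in>{x..y}. frac z \<notin> {a, c} \<Longrightarrow>
      ln (D y) - ln (D x) = (\<integral>t. indicator {x..<y} t * l t \<partial>lborel)"
    and lac: "\<And>A. A \<in> sets borel \<Longrightarrow> emeasure lborel {y. section_of h y \<in> A} = 0 \<Longrightarrow> emeasure lborel A = 0"
  shows False
proof -
  have h': "equivariant 1 h" "continuous_on UNIV h" using h by (auto simp: semiconj_def)
  define g where "g = section_of h"
  note g = section_of[OF h', folded g_def]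
  have gm[measurable]: "g \<in> borel_measurable borel" unfolding g_def by (rule section_measurable[OF h'])
  have hm[measurable]: "h \<in> borel_measurable borel" using h'(2) by (rule borel_measurable_continuous_onI)
  have lm[measurable]: "l \<in> borel_measurable borel" and l1: "\<And>x. l (x + 1) = l x"
    using l by (auto simp: periodic_integrable_def)
  have Dm[measurable]: "D \<in> borel_measurable borel" and Dpos: "\<And>x. 0 < D x"
    using D by (auto simp: lebesgue_jacobian_def)
  obtain G where G: "periodic_integrable G" "\<And>y. 0 \<le> G y" "distr lborel borel h = density lborel (\<lambda>y. ennreal (G y))"
    and gh: "\<And>x. g (h x) = x" and conj: "\<And>n y. (f ^^ n) (g y) = g (y + real n * \<alpha>)"
    and cocycle: "\<And>n (k::int). AE y in lborel. G (y + (real n * \<alpha> + k)) = orbit_weight f D n (g y) * G y"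
    and AEpos: "AE y in lborel. 0 < G y"
    by (rule conjugacy_density[OF f h irr D lac, folded g_def], assumption, assumption, rule that)
  have Gm[measurable]: "G \<in> borel_measurable borel" and G1: "\<And>y. G (y + 1) = G y"
    using G(1) by (auto simp: periodic_integrable_def)
  have gless: "g y \<le> x \<longleftrightarrow> y \<le> h x" "x < g y \<longleftrightarrow> h x < y" for x y
    using g(3)[of "h x" y] equivariant_mono[OF g(4), of y "h x"] unfolding gh by linarith+
  \<comment> \<open>The density l carried to the coordinate y, where orbits are those of the
    rotation and \<open>orbit_integral\<close> applies; its mean is still K.\<close>
  define \<Lambda> where "\<Lambda> y = G y * l (g y)" for y
  have \<Lambda>m[measurable]: "\<Lambda> \<in> borel_measurable borel" unfolding \<Lambda>_def by measurable
  have change: "integrable lborel (\<lambda>y. G y * v y) \<longleftrightarrow> integrable lborel (\<lambda>x. v (h x))"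
    "(\<integral>y. G y * v y \<partial>lborel) = (\<integral>x. v (h x) \<partial>lborel)"
    if [measurable]: "v \<in> borel_measurable borel" for v :: "real \<Rightarrow> real"
  proof -
    have "integrable lborel (\<lambda>x. v (h x)) \<longleftrightarrow> integrable (distr lborel borel h) v"
      by (subst integrable_distr_eq) simp_all
    also have "\<dots> \<longleftrightarrow> integrable lborel (\<lambda>y. G y * v y)"
      unfolding G(3) using G(2) by (subst integrable_density) simp_all
    finally show "integrable lborel (\<lambda>y. G y * v y) \<longleftrightarrow> integrable lborel (\<lambda>x. v (h x))" ..
    have "(\<integral>x. v (h x) \<partial>lborel) = integral\<^sup>L (distr lborel borel h) v"
      by (subst integral_distr) simp_all
    also have "\<dots> = (\<integral>y. G y * v y \<partial>lborel)"
      unfolding G(3) using G(2) by (subst integral_density) simp_all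
    finally show "(\<integral>y. G y * v y \<partial>lborel) = (\<integral>x. v (h x) \<partial>lborel)" ..
  qed
  have pre: "indicator {y0..<y1} (h x) = (indicator {g y0..<g y1} x :: real)" for y0 y1 x
    using gless(1)[of y0 x] gless(2)[of x y1] by (simp add: indicator_def)
  have \<Lambda>e: "indicator {y0..<y1} t * \<Lambda> t = G t * (indicator {y0..<y1} t * l (g t))" for y0 y1 t
    by (simp add: \<Lambda>_def)
  have \<Lambda>int: "(\<integral>t. indicator {y0..<y1} t * \<Lambda> t \<partial>lborel) = (\<integral>t. indicator {g y0..<g y1} t * l t \<partial>lborel)" for y0 y1
    unfolding \<Lambda>e by (subst change(2)) (simp_all add: pre gh)
  have p\<Lambda>: "periodic_integrable \<Lambda>"
    unfolding periodic_integrable_def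
  proof (intro conjI allI \<Lambda>m)
    show "\<Lambda> (x + 1) = \<Lambda> x" for x by (simp add: \<Lambda>_def G1 g(2) l1)
    show "integrable lborel (\<lambda>t. indicator {0..<1} t * \<Lambda> t)"
      unfolding \<Lambda>e using periodic_integrable_interval[OF l, of "g 0" "g 1"]
      by (subst change(1)) (simp_all add: pre gh)
  qed
  have mean\<Lambda>: "mean \<Lambda> = mean l"
    using \<Lambda>int[of 0 1] integral_period[OF l, of "g 0"] g(2)[of 0] by (simp add: mean_def)
  \<comment> \<open>The drift K/8 is known up to |K|/16, which leaves at least |K|/16 to be shared
    by the values of \<Phi> at two points.\<close>
  define \<kappa> where "\<kappa> = \<bar>mean l\<bar> / 32"
  \<comment> \<open>exp deviates from 1 less on the negative side, so |\<Phi> y| \<ge> \<kappa>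
    gives |exp (\<Phi> y) - 1| \<ge> \<eta> for either sign.\<close>
  define \<eta> where "\<eta> = 1 - exp (- \<kappa>)"
  have \<kappa>: "0 < \<kappa>" using K by (simp add: \<kappa>_def)
  have \<eta>: "0 < \<eta>" using \<kappa> by (simp add: \<eta>_def)
  \<comment> \<open>Since G > 0 almost everywhere, its sublevel sets shrink to a null set. Where G
    is at least \<kappa>0, a relative change of G is an absolute one.\<close>
  obtain \<kappa>0 where \<kappa>0: "0 < \<kappa>0" "measure lborel {y \<in> {0..<1}. G y < \<kappa>0} < 1 / 8"
  proof -
    define C where "C n = {y \<in> {0..<1}. G y < 1 / real (Suc n)}" for n
    have CB: "C n \<in> sets borel" for n unfolding C_def by measurable
    have Cfin: "emeasure lborel (C n) \<noteq> \<infinity>" for n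
    proof -
      have "emeasure lborel (C n) \<le> emeasure lborel {0..<1::real}" by (intro emeasure_mono) (auto simp: C_def)
      then show ?thesis by (auto simp: top_unique)
    qed
    have "decseq C"
    proof (rule decseq_SucI, rule subsetI)
      fix n x assume x: "x \<in> C (Suc n)"
      have "1 / real (Suc (Suc n)) \<le> 1 / real (Suc n)" by (intro divide_left_mono) auto
      then show "x \<in> C n" using x by (auto simp: C_def)
    qed
    then have lim: "(\<lambda>n. measure lborel (C n)) \<longlonglongrightarrow> measure lborel (\<Inter>n. C n)"
      using CB Cfin by (intro Lim_measure_decseq) auto
    have sub: "(\<Inter>n. C n) \<subseteq> {y. \<not> 0 < G y}"
    proof (rule subsetI, rule CollectI, rule notI)
      fix y assume y: "y \<in> (\<Inter>n. C n)" and "0 < G y"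
      then obtain n where "inverse (real (Suc n)) < G y" using reals_Archimedean by blast
      moreover have "y \<in> C n" using y by blast
      ultimately show False by (simp add: C_def inverse_eq_divide)
    qed
    have "{y. \<not> 0 < G y} \<in> null_sets lborel"
    proof -
      have "{y \<in> space lborel. \<not> 0 < G y} \<in> sets lborel" by measurable
      then show ?thesis using AEpos AE_iff_null[of lborel "\<lambda>y. 0 < G y"] by simp
    qed
    then have "emeasure lborel (\<Inter>n. C n) \<le> 0"
      using sub emeasure_mono[OF sub, of lborel] by auto
    then have "measure lborel (\<Inter>n. C n) = 0" by (simp add: measure_def)
    then have "eventually (\<lambda>n. measure lborel (C n) < 1 / 8) sequentially"
      using lim by (intro order_tendstoD(2)[of _ 0]) auto
    then obtain n where "measure lborel (C n) < 1 / 8" by (auto simp: eventually_sequentially)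
    then show ?thesis by (intro that[of "1 / real (Suc n)"]) (auto simp: C_def)
  qed
  \<comment> \<open>By Chebyshev's inequality the points with large \<Phi> and G \<ge> \<kappa>0
    then have measure below 1/8; with the 1/8 lost to small G this makes 1/4.\<close>
  obtain d where d: "0 < d" "\<And>\<delta>. \<bar>\<delta>\<bar> < d \<Longrightarrow> mean (\<lambda>y. \<bar>G (y + \<delta>) - G y\<bar>) < \<eta> * \<kappa>0 / 8"
    using L1_translation[OF G(1), of "\<eta> * \<kappa>0 / 8"] \<eta> \<kappa>0(1) by auto
  have "0 < \<bar>mean l\<bar> / 16" using K by simp
  then obtain Q :: nat where Q: "\<And>q p y t. Q < q \<Longrightarrow> near_rational \<alpha> q p \<Longrightarrow> 0 \<le> t \<Longrightarrow> t \<le> 1 / real q \<Longrightarrow>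
      \<bar>(\<Sum>i<q. \<integral>z. indicator {y + real i * \<alpha>..<y + real i * \<alpha> + t} z * \<Lambda> z \<partial>lborel) - q * t * mean \<Lambda>\<bar> \<le> \<bar>mean l\<bar> / 16"
    using orbit_integral[OF p\<Lambda>, of "\<bar>mean l\<bar> / 16" \<alpha>] by blast
  obtain Q' :: nat where Q': "1 / d < Q'" using reals_Archimedean2 by blast
  obtain q p where nr: "near_rational \<alpha> q p" "Q + Q' < q" using near_rational_exists[OF irr] .
  have q0: "0 < real q" using nr(2) by simp
  \<comment> \<open>Modulo integers, q steps of the rotation move a point by \<delta>, and
    |\<delta>| < 1/q; the cocycle identity for q steps therefore compares G y with G (y +
    \<delta>).\<close>
  define \<delta> where "\<delta> = real q * \<alpha> + of_int (- p)"
  have "\<bar>\<delta>\<bar> < d"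
  proof -
    have "\<delta> = q * (\<alpha> - p / q)" using q0 by (simp add: \<delta>_def right_diff_distrib)
    then have "\<bar>\<delta>\<bar> = q * \<bar>\<alpha> - p / q\<bar>" by (simp add: abs_mult)
    also have "\<dots> < q * (1 / (real q)\<^sup>2)" using nr(1) q0 by (intro mult_strict_left_mono) (auto simp: near_rational_def)
    also have "\<dots> = 1 / q" using q0 by (simp add: power2_eq_square)
    also have "\<dots> < d"
    proof -
      have "1 / d < q" using Q' nr(2) by linarith
      then show ?thesis using d(1) q0 by (simp add: field_simps)
    qed
    finally show ?thesis .
  qed
  then have small: "mean (\<lambda>y. \<bar>G (y + \<delta>) - G y\<bar>) < \<eta> * \<kappa>0 / 8" by (rule d(2))
  define \<Phi> where "\<Phi> y = (\<Sum>i<q. ln (D (g (y + real i * \<alpha>))))" for y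
  have \<Phi>m[measurable]: "\<Phi> \<in> borel_measurable borel" unfolding \<Phi>_def by measurable
  have \<Phi>1: "\<Phi> (y + 1) = \<Phi> y" for y
  proof -
    have "g (y + 1 + real i * \<alpha>) = g (y + real i * \<alpha>) + 1" for i
      using g(2)[of "y + real i * \<alpha>"] by (simp add: ac_simps)
    then show ?thesis by (simp add: \<Phi>_def D1)
  qed
  have w\<Phi>: "orbit_weight f D q (g y) = exp (\<Phi> y)" for y
  proof -
    have "ln (orbit_weight f D q (g y)) = \<Phi> y"
      unfolding ln_orbit_weight[OF Dpos] conj \<Phi>_def ..
    then show ?thesis using orbit_weight(2)[OF D, of q "g y"] by (metis exp_ln)
  qed
  define B where "B = {y. \<kappa> \<le> \<bar>\<Phi> y\<bar>}"
  have BB: "B \<in> sets borel" unfolding B_def by measurable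
  have B1: "y + 1 \<in> B \<longleftrightarrow> y \<in> B" for y by (simp add: B_def \<Phi>1)
  define C where "C = {y \<in> {0..<1}. G y < \<kappa>0}"
  have CB: "C \<in> sets borel" unfolding C_def by measurable
  have fmeas: "A \<in> fmeasurable lborel" if "A \<in> sets borel" "A \<subseteq> {0..<1::real}" for A
  proof -
    have "emeasure lborel A \<le> emeasure lborel {0..<1::real}" using that by (intro emeasure_mono) auto
    also have "\<dots> < \<infinity>" by simp
    finally show ?thesis using that(1) by (intro fmeasurableI) auto
  qed
  have B4: "measure lborel (B \<inter> {0..<1}) < 1 / 4"
  proof -
    have pt: "\<eta> * \<kappa>0 * indicator (B \<inter> {0..<1} - C) y \<le> indicator {0..<1} y * \<bar>G (y + \<delta>) - G y\<bar>"
      if "G (y + \<delta>) = orbit_weight f D q (g y) * G y" for y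
    proof (cases "y \<in> B \<inter> {0..<1} - C")
      case True
      have e: "G (y + \<delta>) - G y = (exp (\<Phi> y) - 1) * G y" using that by (simp add: w\<Phi> left_diff_distrib)
      have "\<eta> \<le> \<bar>exp (\<Phi> y) - 1\<bar>"
      proof (cases "0 \<le> \<Phi> y")
        case pos: True
        then have "\<kappa> \<le> \<Phi> y" using True by (auto simp: B_def)
        then have "1 + \<kappa> \<le> exp (\<Phi> y)" using exp_ge_add_one_self[of "\<Phi> y"] by linarith
        moreover have "1 - \<kappa> \<le> exp (- \<kappa>)" using exp_ge_add_one_self[of "- \<kappa>"] by simp
        ultimately show ?thesis by (simp add: \<eta>_def)
      next
        case False
        then have "\<Phi> y \<le> - \<kappa>" using True by (auto simp: B_def)
        then have "exp (\<Phi> y) \<le> exp (- \<kappa>)" by simp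
        then show ?thesis unfolding \<eta>_def by linarith
      qed
      moreover have "\<kappa>0 \<le> G y" using True by (auto simp: C_def)
      ultimately have "\<eta> * \<kappa>0 \<le> \<bar>exp (\<Phi> y) - 1\<bar> * G y" using \<eta> \<kappa>0(1) by (intro mult_mono) auto
      also have "\<dots> = \<bar>G (y + \<delta>) - G y\<bar>" unfolding e using G(2)[of y] by (simp add: abs_mult)
      finally show ?thesis using True by simp
    qed simp
    have BC: "B \<inter> {0..<1} - C \<in> fmeasurable lborel" using BB CB by (intro fmeas) auto
    have "\<eta> * \<kappa>0 * measure lborel (B \<inter> {0..<1} - C) = (\<integral>y. \<eta> * \<kappa>0 * indicator (B \<inter> {0..<1} - C) y \<partial>lborel)"
      by simp
    also have "\<dots> \<le> mean (\<lambda>y. \<bar>G (y + \<delta>) - G y\<bar>)"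
      unfolding mean_def
    proof (rule integral_mono_AE)
      show "integrable lborel (\<lambda>y. \<eta> * \<kappa>0 * indicator (B \<inter> {0..<1} - C) y)"
        using BC by (intro integrable_mult_right integrable_real_indicator) (auto simp: fmeasurable_def)
      show "integrable lborel (\<lambda>y. indicator {0..<1} y * \<bar>G (y + \<delta>) - G y\<bar>)"
        using periodic_integrable_abs[OF periodic_integrable_diff[OF periodic_integrable_shift[OF G(1), of \<delta>] G(1)]]
        by (simp add: periodic_integrable_def)
      show "AE y in lborel. \<eta> * \<kappa>0 * indicator (B \<inter> {0..<1} - C) y \<le> indicator {0..<1} y * \<bar>G (y + \<delta>) - G y\<bar>"
        using cocycle[of q "- p", folded \<delta>_def] by eventually_elim (rule pt)
    qed
    also have "\<dots> < \<eta> * \<kappa>0 / 8" by (rule small)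
    finally have "(\<eta> * \<kappa>0) * measure lborel (B \<inter> {0..<1} - C) < (\<eta> * \<kappa>0) * (1 / 8)" by simp
    then have "measure lborel (B \<inter> {0..<1} - C) < 1 / 8" using \<eta> \<kappa>0(1) by (subst (asm) mult_less_cancel_left_pos) auto
    moreover have "measure lborel (B \<inter> {0..<1}) \<le> measure lborel ((B \<inter> {0..<1} - C) \<union> C)"
      using BB CB by (intro measure_mono_fmeasurable fmeas) (auto simp: C_def)
    moreover have "\<dots> \<le> measure lborel (B \<inter> {0..<1} - C) + measure lborel C"
      using BB CB by (intro measure_Un_le) auto
    ultimately show ?thesis using \<kappa>0(2) by (simp add: C_def)
  qed
  \<comment> \<open>Two break points and q times give 2 q windows of length s, of total measure at
    most 1/4.\<close>
  define s where "s = 1 / (8 * real q)"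
  have s: "0 \<le> s" "s < 1" "s \<le> 1 / q" "q * s = 1 / 8" using q0 nr(2) by (auto simp: s_def field_simps)
  \<comment> \<open>The y for which the i-th image of the interval from g y to g (y + s) contains an
    integer translate of b.\<close>
  define S where "S i b = {y. \<exists>k::int. y \<le> (h b - real i * \<alpha>) + k \<and> (h b - real i * \<alpha>) + k \<le> y + s} \<inter> {0..<1}" for i :: nat and b
  define R where "R = (\<Union>i<q. S i a \<union> S i c)"
  have SB: "S i b \<in> sets borel" for i b unfolding S_def using window_measure(2)[OF s(1,2)] by auto
  have Sm: "measure lborel (S i b) \<le> s" for i b
    unfolding S_def measure_def using window_measure(1)[OF s(1,2)] s(1) by (intro enn2real_leI)
  have RB: "R \<in> sets borel" unfolding R_def using SB by auto
  have Rsub: "R \<subseteq> {0..<1}" by (auto simp: R_def S_def)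
  have R4: "measure lborel R \<le> 1 / 4"
  proof -
    have "measure lborel R \<le> (\<Sum>i<q. measure lborel (S i a \<union> S i c))"
      unfolding R_def using SB by (intro measure_UNION_le) auto
    also have "\<dots> \<le> (\<Sum>i<q. s + s)"
    proof (rule sum_mono)
      fix i
      have "measure lborel (S i a \<union> S i c) \<le> measure lborel (S i a) + measure lborel (S i c)"
        using SB by (intro measure_Un_le) auto
      then show "measure lborel (S i a \<union> S i c) \<le> s + s" using Sm[of i a] Sm[of i c] by linarith
    qed
    also have "\<dots> = 1 / 4" using s(4) by simp
    finally show ?thesis .
  qed
  define B' where "B' = {y. y + s \<in> B} \<inter> {0..<1}"
  have "{y. y + s \<in> B} \<in> sets borel" unfolding B_def by measurable
  then have B'B: "B' \<in> sets borel" by (auto simp: B'_def)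
  have B'm: "measure lborel B' = measure lborel (B \<inter> {0..<1})"
  proof -
    have "B' = {y. y + s \<in> B \<inter> {s..<s + 1}}" by (auto simp: B'_def)
    then have "emeasure lborel B' = emeasure lborel (B \<inter> {s..<s + 1})"
      using lborel_translate[of "B \<inter> {s..<s + 1}" s] BB by simp
    also have "\<dots> = emeasure lborel (B \<inter> {0..<1})"
      by (rule emeasure_periodic[OF BB B1]) (auto intro: lborel_translate)
    finally show ?thesis by (simp add: measure_def)
  qed
  \<comment> \<open>Off R none of the q images crosses a break point, so \<Phi> (y + s) - \<Phi> y
    is an orbit integral of \<Lambda> and close to K/8; then \<Phi> is large at y or at y +
    s.\<close>
  have cover: "{0..<1} \<subseteq> R \<union> ((B \<inter> {0..<1}) \<union> B')"
  proof
    fix y :: real assume y: "y \<in> {0..<1}"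
    show "y \<in> R \<union> ((B \<inter> {0..<1}) \<union> B')"
    proof (cases "y \<in> R")
      case False
      have inc: "ln (D (g (y + s + real i * \<alpha>))) - ln (D (g (y + real i * \<alpha>))) =
          (\<integral>z. indicator {y + real i * \<alpha>..<y + real i * \<alpha> + s} z * \<Lambda> z \<partial>lborel)" if i: "i < q" for i
      proof -
        have e: "y + s + real i * \<alpha> = y + real i * \<alpha> + s" by simp
        have "ln (D (g (y + real i * \<alpha> + s))) - ln (D (g (y + real i * \<alpha>))) =
            (\<integral>t. indicator {g (y + real i * \<alpha>)..<g (y + real i * \<alpha> + s)} t * l t \<partial>lborel)"
        proof (rule incr)
          show "g (y + real i * \<alpha>) \<le> g (y + real i * \<alpha> + s)" using s(1) by (intro equivariant_mono[OF g(4)]) simp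
          show "\<forall>z\<in>{g (y + real i * \<alpha>)..g (y + real i * \<alpha> + s)}. frac z \<notin> {a, c}"
          proof
            fix z assume "z \<in> {g (y + real i * \<alpha>)..g (y + real i * \<alpha> + s)}"
          then have z: "g (y + real i * \<alpha>) \<le> z" "z \<le> g (y + real i * \<alpha> + s)" by auto
          have hz: "y + real i * \<alpha> \<le> h z" "h z \<le> y + real i * \<alpha> + s"
            using equivariant_mono[OF h'(1) z(1)] equivariant_mono[OF h'(1) z(2)] by (simp_all add: g(1))
          have "y \<in> S i b" if "frac z = b" for b
          proof -
            have "h z = h (b + of_int \<lfloor>z\<rfloor>)" by (rule arg_cong[OF frac_eq_translate[OF that]])
            also have "\<dots> = h b + of_int \<lfloor>z\<rfloor>" using equivariant_int[OF h'(1), of b "\<lfloor>z\<rfloor>"] by simp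
            finally have "h z = h b + of_int \<lfloor>z\<rfloor>" .
            then show ?thesis unfolding S_def using hz y by (intro IntI CollectI exI[of _ "\<lfloor>z\<rfloor>"]) auto
          qed
          then show "frac z \<notin> {a, c}" using False i by (auto simp: R_def)
          qed
        qed
        then show ?thesis unfolding e \<Lambda>int .
      qed
      have "\<Phi> (y + s) - \<Phi> y = (\<Sum>i<q. \<integral>z. indicator {y + real i * \<alpha>..<y + real i * \<alpha> + s} z * \<Lambda> z \<partial>lborel)"
        unfolding \<Phi>_def sum_subtractf[symmetric] by (intro sum.cong refl inc) simp
      then have "\<bar>(\<Phi> (y + s) - \<Phi> y) - mean l / 8\<bar> \<le> \<bar>mean l\<bar> / 16"
        using Q[OF _ nr(1) s(1,3), of y] nr(2) by (simp add: s(4) mean\<Lambda>)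
      then have "\<bar>mean l\<bar> / 16 \<le> \<bar>\<Phi> (y + s)\<bar> + \<bar>\<Phi> y\<bar>" by linarith
      then have "\<kappa> \<le> \<bar>\<Phi> (y + s)\<bar> \<or> \<kappa> \<le> \<bar>\<Phi> y\<bar>" unfolding \<kappa>_def by linarith
      then show ?thesis using y by (auto simp: B_def B'_def)
    qed simp
  qed
  have "1 = measure lborel {0..<1::real}" by simp
  also have "\<dots> \<le> measure lborel (R \<union> ((B \<inter> {0..<1}) \<union> B'))"
    using cover RB BB B'B Rsub by (intro measure_mono_fmeasurable fmeas) (auto simp: B'_def)
  also have "\<dots> \<le> measure lborel R + measure lborel ((B \<inter> {0..<1}) \<union> B')"
    using RB BB B'B by (intro measure_Un_le) auto
  also have "measure lborel ((B \<inter> {0..<1}) \<union> B') \<le> measure lborel (B \<inter> {0..<1}) + measure lborel B'"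
    using BB B'B by (intro measure_Un_le) auto
  finally show False using R4 B4 B'm by linarith
qed

theorem theorem1p8:
  fixes f :: "real \<Rightarrow> real" and a c :: real
  assumes "class_P f"
    and "rotation_number f \<notin> \<rat>"
    and "break_points f = {a, c}" and "a \<noteq> c"
    and "jump_ratio f a * jump_ratio f c \<noteq> 1"
    and "\<And>I. is_interval I \<Longrightarrow> (\<forall>x\<in>I. frac x \<notin> {a, c}) \<Longrightarrow>
               absolutely_continuous_on I (deriv f)"
    and "deriv (deriv f) absolutely_integrable_on {0..<1}"
  shows "(\<exists>!\<mu>. invariant_prob f \<mu>) \<and>
         (\<forall>\<mu>. invariant_prob f \<mu> \<longrightarrow> singular_on_circle \<mu>)"
proof -
  have f: "circle_lift f" using assms(1) by (simp add: class_P_def)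
  obtain \<alpha> where \<alpha>: "(\<lambda>n. (f ^^ n) 0 / real n) \<longlonglongrightarrow> \<alpha>" "\<And>n x. \<bar>(f ^^ n) x - x - n * \<alpha>\<bar> \<le> 2"
    using translation_number[OF circle_lift_equivariant[OF f]] by metis
  have irr: "\<alpha> \<notin> \<rat>"
  proof
    assume "\<alpha> \<in> \<rat>"
    then have "frac \<alpha> \<in> \<rat>" by (simp add: frac_def)
    then show False using assms(2) limI[OF \<alpha>(1)] by (simp add: rotation_number_def)
  qed
  obtain h where h: "semiconj \<alpha> f h" using semiconj_exists[OF circle_lift_equivariant[OF f] \<alpha>(2) irr] .
  note inv = invariant_prob_circle_invariant[OF f h]
  have uniq: "\<mu> = circle_invariant h" if "invariant_prob f \<mu>" for \<mu>
    by (rule invariant_prob_unique[OF f h irr that inv])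
  have "singular_on_circle (circle_invariant h)"
  proof (rule ccontr)
    assume ns: "\<not> singular_on_circle (circle_invariant h)"
    \<comment> \<open>Stated for arbitrary a < c, so that it can be applied with the two break
      points exchanged.\<close>
    have False if prems: "break_points f = {a, c}" "a < c" "jump_ratio f a * jump_ratio f c \<noteq> 1"
      "\<And>I. is_interval I \<Longrightarrow> (\<forall>x\<in>I. frac x \<notin> {a, c}) \<Longrightarrow> absolutely_continuous_on I (deriv f)" for a c
    proof -
      obtain D V B l where D: "lebesgue_jacobian f D" "\<And>x. D (x + 1) = D x" "equivariant V B"
        "\<And>x y. x \<le> y \<Longrightarrow> \<bar>ln (D x) - ln (D y)\<bar> \<le> B y - B x" "periodic_integrable l" "mean l \<noteq> 0"
        "\<And>x y. x \<le> y \<Longrightarrow> \<forall>z\<in>{x..y}. frac z \<notin> {a, c} \<Longrightarrow>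
          ln (D y) - ln (D x) = (\<integral>t. indicator {x..<y} t * l t \<partial>lborel)"
        by (rule piecewise_smooth_lift[OF assms(1) prems], assumption, assumption, rule that)
      have lac: "emeasure lborel A = 0" if "A \<in> sets borel" "emeasure lborel {y. section_of h y \<in> A} = 0" for A
        by (rule lebesgue_absolutely_continuous[OF f h irr D(1,3,4) ns that])
      show False
        by (rule not_lebesgue_absolutely_continuous[OF f h irr D(1,2,5,6) D(7) lac])
    qed
    note contra = this
    show False
    proof (cases "a < c")
      case True then show False using contra[of a c] assms(3,5,6) by blast
    next
      case False
      then have "c < a" using assms(4) by simp
      moreover have "break_points f = {c, a}" "jump_ratio f c * jump_ratio f a \<noteq> 1"
        using assms(3,5) by (auto simp: mult.commute)
      moreover have "absolutely_continuous_on I (deriv f)" if "is_interval I" "\<forall>x\<in>I. frac x \<notin> {c, a}" for I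
        using assms(6)[of I] that by (simp add: insert_commute)
      ultimately show False using contra[of c a] by blast
    qed
  qed
  then show ?thesis using inv uniq by blast
qed

end
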